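(* Let $A$ be an irreducible square matrix with nonnegative integer entries which is not a permutation matrix, and let $G_A$ be its directed graph. Let $\mathcal{P}$ be a partition of the out-going edges of $G_A$, and let $A^{[\mathcal{P}]}$ be the transition matrix of the out-split graph of $G_A$ formed using $\mathcal{P}$. Then there exists an isomorphism of $C^*$-algebras $\Phi^{[\mathcal{P}]}:\mathcal{O}_A\to\mathcal{O}_{A^{[\mathcal{P}]}}$ satisfying $\Phi^{[\mathcal{P}]}(\mathcal{D}_A)=\mathcal{D}_{A^{[\mathcal{P}]}}$ such that $$\Phi^{[\mathcal{P}]}\circ\rho^A_t=\rho^{A^{[\mathcal{P}]}}_t\circ\Phi^{[\mathcal{P}]}\qquad\text{for all } t\in\mathbb{T}.$$
   Context: A square matrix $A$ with nonnegative integer entries is irreducible if for all $i,j$ there is $n\ge1$ with $A^n(i,j)>0$. For an $N\times N$ nonnegative integer matrix $A$, $G_A=(\mathcal{V},\mathcal{E})$ is the directed graph with $N$ vertices $I_1,\dots,I_N$ and $A(i,j)$ edges from $I_i$ to $I_j$; $s(e),t(e)$ are the source and target of an edge $e$. The transition matrix of a finite directed graph is the matrix indexed by its vertices whose $(I,J)$ entry is the number of edges from $I$ to $J$. The Cuntz--Krieger algebra $\mathcal{O}_A$ is the universal $C^*$-algebra generated by partial isometries $S_a$, $a\in\mathcal{E}$, with $\sum_{a\in\mathcal{E}}S_aS_a^*=1$ and $S_a^*S_a=\sum_{b\in\mathcal{E},\,s(b)=t(a)}S_bS_b^*$ for all $a$. $\mathcal{D}_A$ is the $C^*$-subalgebra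 generated by all projections $S_{\mu_1}\cdots S_{\mu_n}S_{\mu_n}^*\cdots S_{\mu_1}^*$. $\mathbb{T}=\mathbb{R}/\mathbb{Z}$, and the gauge action $\rho^A$ is given by $\rho^A_t(S_a)=e^{2\pi\sqrt{-1}t}S_a$. Out-splitting: let $\mathcal{E}_I=\{e\in\mathcal{E}: s(e)=I\}$. A partition $\mathcal{P}$ of the out-going edges consists of a partition of $\mathcal{E}_I$ into disjoint nonempty sets $\mathcal{E}_I=\mathcal{E}_I^1\cup\cdots\cup\mathcal{E}_I^{m(I)}$ for each vertex $I\in\mathcal{V}$. The out-split graph $G^{[\mathcal{P}]}$ formed from $G=G_A$ using $\mathcal{P}$ has vertex set $\bigcup_{I\in\mathcal{V}}\{I^1,\dots,I^{m(I)}\}$, and for each edge $e\in\mathcal{E}_I^i$ with $t(e)=J$ it has edges $e^1,\dots,e^{m(J)}$ with $s(e^j)=I^i$ and $t(e^j)=J^j$ for $j=1,\dots,m(J)$; there are no other edges. *)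

theory Defs
  imports
    Complex_Main
    "HOL-Library.Poly_Mapping"
    "HOL-Library.FuncSet"
    "HOL-Library.Disjoint_Sets"
    "HOL-Combinatorics.Permutations"
    "HOL-Algebra.QuotRing"
    "Jordan_Normal_Form.Matrix"
    "Graph_Theory.Digraph"
begin

section \<open>Matrices and graphs\<close>

definition irreducible_matrix :: "nat mat \<Rightarrow> bool" where
  "irreducible_matrix A \<longleftrightarrow> square_mat A \<and>
     (\<forall>i<dim_row A. \<forall>j<dim_row A. \<exists>n\<ge>1. (A ^\<^sub>m n) $$ (i, j) > 0)"

definition permutation_matrix :: "nat mat \<Rightarrow> bool" where
  "permutation_matrix A \<longleftrightarrow> (\<exists>\<sigma>. \<sigma> permutes {..<dim_row A} \<and>
     A = mat (dim_row A) (dim_row A) (\<lambda>(i, j). if j = \<sigma> i then 1 else 0))"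

text \<open>Vertices are numbered from 0; the third component of an edge \<open>(i, j, k)\<close> distinguishes the
  \<open>A(i, j)\<close> parallel edges from \<open>i\<close> to \<open>j\<close>.\<close>

type_synonym edge = "nat \<times> nat \<times> nat"

definition graph_of :: "nat mat \<Rightarrow> (nat, edge) pre_digraph" where
  "graph_of A = \<lparr> verts = {..<dim_row A},
     arcs = {(i, j, k). i < dim_row A \<and> j < dim_row A \<and> k < A $$ (i, j)},
     tail = (\<lambda>(i, j, k). i), head = (\<lambda>(i, j, k). j) \<rparr>"

text \<open>Matrices are indexed by an initial segment of the naturals, so the transition matrix is taken
  with respect to an enumeration \<open>vs\<close> of the vertices.\<close>

definition transition_matrix :: "('v, 'e) pre_digraph \<Rightarrow> 'v list \<Rightarrow> nat mat" where
  "transition_matrix G vs = mat (length vs) (length vs)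
     (\<lambda>(i, j). card {e \<in> arcs G. tail G e = vs ! i \<and> head G e = vs ! j})"

text \<open>The edges leaving \<open>I\<close> are partitioned into \<open>P I 1, \<dots>, P I (m I)\<close>.\<close>

definition out_edge_partition ::
  "('v, 'e) pre_digraph \<Rightarrow> ('v \<Rightarrow> nat) \<Rightarrow> ('v \<Rightarrow> nat \<Rightarrow> 'e set) \<Rightarrow> bool" where
  "out_edge_partition G m P \<longleftrightarrow> (\<forall>I\<in>verts G.
     (\<Union>i\<in>{1..m I}. P I i) = out_arcs G I \<and>
     disjoint_family_on (P I) {1..m I} \<and>
     (\<forall>i\<in>{1..m I}. P I i \<noteq> {}))"

text \<open>The pair \<open>(I, i)\<close> is the vertex \<open>I\<^sup>i\<close> and the pair \<open>(e, j)\<close> is the edge \<open>e\<^sup>j\<close>.\<close>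

definition out_split ::
  "('v, 'e) pre_digraph \<Rightarrow> ('v \<Rightarrow> nat) \<Rightarrow> ('v \<Rightarrow> nat \<Rightarrow> 'e set) \<Rightarrow> ('v \<times> nat, 'e \<times> nat) pre_digraph" where
  "out_split G m P = \<lparr> verts = (SIGMA I:verts G. {1..m I}),
     arcs = (SIGMA e:arcs G. {1..m (head G e)}),
     tail = (\<lambda>(e, j). (tail G e, THE i. i \<in> {1..m (tail G e)} \<and> e \<in> P (tail G e) i)),
     head = (\<lambda>(e, j). (head G e, j)) \<rparr>"


section \<open>C*-algebras\<close>

record 'a cstar = "'a ring" +
  scal :: "complex \<Rightarrow> 'a \<Rightarrow> 'a"
  adj :: "'a \<Rightarrow> 'a"
  nrm :: "'a \<Rightarrow> real"

text \<open>Unital C*-algebras, the zero algebra included.\<close>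

locale cstar_algebra = ring A for A :: "'a cstar" (structure) +
  assumes scal_closed: "x \<in> carrier A \<Longrightarrow> scal A c x \<in> carrier A"
    and scal_add_right: "\<lbrakk>x \<in> carrier A; y \<in> carrier A\<rbrakk> \<Longrightarrow> scal A c (x \<oplus> y) = scal A c x \<oplus> scal A c y"
    and scal_add_left: "x \<in> carrier A \<Longrightarrow> scal A (c + d) x = scal A c x \<oplus> scal A d x"
    and scal_scal: "x \<in> carrier A \<Longrightarrow> scal A c (scal A d x) = scal A (c * d) x"
    and scal_one: "x \<in> carrier A \<Longrightarrow> scal A 1 x = x"
    and scal_mult_left: "\<lbrakk>x \<in> carrier A; y \<in> carrier A\<rbrakk> \<Longrightarrow> scal A c x \<otimes> y = scal A c (x \<otimes> y)"
    and scal_mult_right: "\<lbrakk>x \<in> carrier A; y \<in> carrier A\<rbrakk> \<Longrightarrow> x \<otimes> scal A c y = scal A c (x \<otimes> y)"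
    and adj_closed: "x \<in> carrier A \<Longrightarrow> adj A x \<in> carrier A"
    and adj_adj: "x \<in> carrier A \<Longrightarrow> adj A (adj A x) = x"
    and adj_add: "\<lbrakk>x \<in> carrier A; y \<in> carrier A\<rbrakk> \<Longrightarrow> adj A (x \<oplus> y) = adj A x \<oplus> adj A y"
    and adj_scal: "x \<in> carrier A \<Longrightarrow> adj A (scal A c x) = scal A (cnj c) (adj A x)"
    and adj_mult: "\<lbrakk>x \<in> carrier A; y \<in> carrier A\<rbrakk> \<Longrightarrow> adj A (x \<otimes> y) = adj A y \<otimes> adj A x"
    and nrm_eq_0_iff: "x \<in> carrier A \<Longrightarrow> nrm A x = 0 \<longleftrightarrow> x = \<zero>"
    and nrm_add: "\<lbrakk>x \<in> carrier A; y \<in> carrier A\<rbrakk> \<Longrightarrow> nrm A (x \<oplus> y) \<le> nrm A x + nrm A y"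
    and nrm_scal: "x \<in> carrier A \<Longrightarrow> nrm A (scal A c x) = cmod c * nrm A x"
    and nrm_mult: "\<lbrakk>x \<in> carrier A; y \<in> carrier A\<rbrakk> \<Longrightarrow> nrm A (x \<otimes> y) \<le> nrm A x * nrm A y"
    and nrm_adj_mult: "x \<in> carrier A \<Longrightarrow> nrm A (adj A x \<otimes> x) = (nrm A x)\<^sup>2"
    and complete: "\<lbrakk>\<And>n. X n \<in> carrier A;
        \<And>e. e > 0 \<Longrightarrow> \<exists>N. \<forall>i\<ge>N. \<forall>j\<ge>N. nrm A (X i \<ominus> X j) < e\<rbrakk>
      \<Longrightarrow> \<exists>x\<in>carrier A. (\<lambda>n. nrm A (X (n::nat) \<ominus> x)) \<longlonglongrightarrow> 0"

definition star_hom :: "'a cstar \<Rightarrow> 'b cstar \<Rightarrow> ('a \<Rightarrow> 'b) \<Rightarrow> bool" where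
  "star_hom A B f \<longleftrightarrow> f \<in> Ring.ring_hom A B \<and>
     (\<forall>x\<in>carrier A. \<forall>c. f (scal A c x) = scal B c (f x)) \<and>
     (\<forall>x\<in>carrier A. f (adj A x) = adj B (f x))"

text \<open>A bijective *-homomorphism of C*-algebras is automatically isometric; stating this in the
  definition avoids an appeal to automatic continuity.\<close>

definition cstar_iso :: "'a cstar \<Rightarrow> 'b cstar \<Rightarrow> ('a \<Rightarrow> 'b) \<Rightarrow> bool" where
  "cstar_iso A B f \<longleftrightarrow> star_hom A B f \<and> bij_betw f (carrier A) (carrier B) \<and>
     (\<forall>x\<in>carrier A. nrm B (f x) = nrm A x)"

definition cstar_subalgebra :: "'a cstar \<Rightarrow> 'a set \<Rightarrow> bool" where
  "cstar_subalgebra A B \<longleftrightarrow> B \<subseteq> carrier A \<and> \<zero>\<^bsub>A\<^esub> \<in> B \<and>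
     (\<forall>x\<in>B. \<forall>y\<in>B. x \<oplus>\<^bsub>A\<^esub> y \<in> B \<and> x \<otimes>\<^bsub>A\<^esub> y \<in> B) \<and>
     (\<forall>x\<in>B. adj A x \<in> B \<and> (\<forall>c. scal A c x \<in> B)) \<and>
     (\<forall>X. \<forall>x\<in>carrier A. (\<forall>n::nat. X n \<in> B) \<longrightarrow> (\<lambda>n. nrm A (X n \<ominus>\<^bsub>A\<^esub> x)) \<longlonglongrightarrow> 0 \<longrightarrow> x \<in> B)"

definition generated_cstar_subalgebra :: "'a cstar \<Rightarrow> 'a set \<Rightarrow> 'a set" where
  "generated_cstar_subalgebra A M = \<Inter>{B. cstar_subalgebra A B \<and> M \<subseteq> B}"


section \<open>Cuntz--Krieger families\<close>

definition partial_isometry :: "'a cstar \<Rightarrow> 'a \<Rightarrow> bool" where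
  "partial_isometry A s \<longleftrightarrow> s \<in> carrier A \<and> s \<otimes>\<^bsub>A\<^esub> adj A s \<otimes>\<^bsub>A\<^esub> s = s"

definition ck_family :: "('v, 'e) pre_digraph \<Rightarrow> 'a cstar \<Rightarrow> ('e \<Rightarrow> 'a) \<Rightarrow> bool" where
  "ck_family G A S \<longleftrightarrow>
     (\<forall>a\<in>arcs G. partial_isometry A (S a)) \<and>
     (\<Oplus>\<^bsub>A\<^esub>a\<in>arcs G. S a \<otimes>\<^bsub>A\<^esub> adj A (S a)) = \<one>\<^bsub>A\<^esub> \<and>
     (\<forall>a\<in>arcs G. adj A (S a) \<otimes>\<^bsub>A\<^esub> S a =
        (\<Oplus>\<^bsub>A\<^esub>b\<in>{b \<in> arcs G. tail G b = head G a}. S b \<otimes>\<^bsub>A\<^esub> adj A (S b)))"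


section \<open>The free *-algebra\<close>

text \<open>A letter is a generator \<open>(a, False)\<close> or its formal adjoint \<open>(a, True)\<close>. The type
  \<open>'e star_word \<Rightarrow>\<^sub>0 complex\<close> of finitely supported functions, with the convolution
  product of \<^theory>\<open>HOL-Library.Poly_Mapping\<close>, is the free unital *-algebra on \<open>'e\<close>.\<close>

datatype 'e star_word = Word (letters: "('e \<times> bool) list")

instantiation star_word :: (type) monoid_add
begin

definition zero_star_word :: "'a star_word" where "0 = Word []"

definition plus_star_word :: "'a star_word \<Rightarrow> 'a star_word \<Rightarrow> 'a star_word" where
  "v + w = Word (letters v @ letters w)"

instance by standard (simp_all add: zero_star_word_def plus_star_word_def)

end

definition word_adj :: "'e star_word \<Rightarrow> 'e star_word" where
  "word_adj w = Word (rev (map (\<lambda>(a, b). (a, \<not> b)) (letters w)))"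

lemma word_adj_adj [simp]: "word_adj (word_adj w) = w"
  by (cases w) (simp add: word_adj_def rev_map o_def case_prod_beta)

type_synonym 'e free_star = "'e star_word \<Rightarrow>\<^sub>0 complex"

lift_definition free_adj :: "'e free_star \<Rightarrow> 'e free_star" is
  "\<lambda>x w. cnj (x (word_adj w))"
proof -
  fix x :: "'e star_word \<Rightarrow> complex" assume "finite {w. x w \<noteq> 0}"
  moreover have "{w. cnj (x (word_adj w)) \<noteq> 0} = word_adj -` {w. x w \<noteq> 0}" by auto
  moreover have "inj (word_adj :: 'e star_word \<Rightarrow> _)" by (metis injI word_adj_adj)
  ultimately show "finite {w. cnj (x (word_adj w)) \<noteq> 0}" by (metis finite_vimageI)
qed

abbreviation free_scal :: "complex \<Rightarrow> 'e free_star \<Rightarrow> 'e free_star" where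
  "free_scal c \<equiv> Poly_Mapping.map ((*) c)"

definition free_gen :: "'e \<Rightarrow> 'e free_star" where
  "free_gen a = Poly_Mapping.single (Word [(a, False)]) 1"

definition free_alg :: "'e set \<Rightarrow> 'e free_star set" where
  "free_alg E = {x. \<forall>w\<in>Poly_Mapping.keys x. fst ` set (letters w) \<subseteq> E}"


section \<open>Universal C*-algebras\<close>

definition cstar_seminorm :: "'e set \<Rightarrow> ('e free_star \<Rightarrow> real) \<Rightarrow> bool" where
  "cstar_seminorm E p \<longleftrightarrow>
     (\<forall>x\<in>free_alg E. \<forall>y\<in>free_alg E. p (x + y) \<le> p x + p y \<and> p (x * y) \<le> p x * p y) \<and>
     (\<forall>x\<in>free_alg E. (\<forall>c. p (free_scal c x) = cmod c * p x) \<and> p (free_adj x * x) = (p x)\<^sup>2)"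

text \<open>The completion of the free *-algebra in a C*-seminorm: Cauchy sequences modulo null
  sequences.\<close>

definition cauchy_ring :: "'e set \<Rightarrow> ('e free_star \<Rightarrow> real) \<Rightarrow> (nat \<Rightarrow> 'e free_star) ring" where
  "cauchy_ring E p = \<lparr> carrier = {x. (\<forall>n. x n \<in> free_alg E) \<and>
       (\<forall>e>0. \<exists>N. \<forall>i\<ge>N. \<forall>j\<ge>N. p (x i - x j) < e)},
     monoid.mult = (\<lambda>x y n. x n * y n), monoid.one = (\<lambda>n. 1),
     zero = (\<lambda>n. 0), add = (\<lambda>x y n. x n + y n) \<rparr>"

definition null_seqs :: "'e set \<Rightarrow> ('e free_star \<Rightarrow> real) \<Rightarrow> (nat \<Rightarrow> 'e free_star) set" where
  "null_seqs E p = {x. (\<forall>n. x n \<in> free_alg E) \<and> (\<lambda>n. p (x n)) \<longlonglongrightarrow> 0}"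

definition seq_class ::
  "'e set \<Rightarrow> ('e free_star \<Rightarrow> real) \<Rightarrow> (nat \<Rightarrow> 'e free_star) \<Rightarrow> (nat \<Rightarrow> 'e free_star) set" where
  "seq_class E p x = null_seqs E p +>\<^bsub>cauchy_ring E p\<^esub> x"

definition completion ::
  "'e set \<Rightarrow> ('e free_star \<Rightarrow> real) \<Rightarrow> (nat \<Rightarrow> 'e free_star) set cstar" where
  "completion E p = ring.extend (cauchy_ring E p Quot null_seqs E p)
     (cstar.fields
       (\<lambda>c X. \<Union>x\<in>X. seq_class E p (\<lambda>n. free_scal c (x n)))
       (\<lambda>X. \<Union>x\<in>X. seq_class E p (\<lambda>n. free_adj (x n)))
       (\<lambda>X. THE r. \<forall>x\<in>X. (\<lambda>n. p (x n)) \<longlonglongrightarrow> r))"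

text \<open>The universal C*-algebra on generators \<open>E\<close> and relations \<open>r = 0\<close>, \<open>r \<in> R\<close>, is the
  completion of the free *-algebra in the largest C*-seminorm vanishing on \<open>R\<close>. It exists
  provided that the C*-seminorms in question are bounded on each generator.\<close>

definition univ_seminorms :: "'e set \<Rightarrow> 'e free_star set \<Rightarrow> ('e free_star \<Rightarrow> real) set" where
  "univ_seminorms E R = {p. cstar_seminorm E p \<and> (\<forall>r\<in>R. p r = 0)}"

definition univ_norm :: "'e set \<Rightarrow> 'e free_star set \<Rightarrow> 'e free_star \<Rightarrow> real" where
  "univ_norm E R x = (SUP p\<in>univ_seminorms E R. p x)"

definition univ_cstar :: "'e set \<Rightarrow> 'e free_star set \<Rightarrow> (nat \<Rightarrow> 'e free_star) set cstar" where
  "univ_cstar E R = completion E (univ_norm E R)"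

definition univ_gen :: "'e set \<Rightarrow> 'e free_star set \<Rightarrow> 'e \<Rightarrow> (nat \<Rightarrow> 'e free_star) set" where
  "univ_gen E R a = seq_class E (univ_norm E R) (\<lambda>n. free_gen a)"


section \<open>Cuntz--Krieger algebras\<close>

definition ck_relations :: "('v, 'e) pre_digraph \<Rightarrow> 'e free_star set" where
  "ck_relations G =
     {free_gen a * free_adj (free_gen a) * free_gen a - free_gen a | a. a \<in> arcs G} \<union>
     {(\<Sum>a\<in>arcs G. free_gen a * free_adj (free_gen a)) - 1} \<union>
     {free_adj (free_gen a) * free_gen a -
       (\<Sum>b\<in>{b \<in> arcs G. tail G b = head G a}. free_gen b * free_adj (free_gen b)) | a. a \<in> arcs G}"

text \<open>Below, \<open>cuntz_krieger_universal\<close> shows that \<open>cuntz_krieger A\<close> has the universal property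
  among the Cuntz--Krieger families in unital C*-algebras over an arbitrary type, and
  \<open>gauge_action\<close> that the gauge action is well defined.\<close>

type_synonym ck_elem = "(nat \<Rightarrow> edge free_star) set"

definition cuntz_krieger :: "nat mat \<Rightarrow> ck_elem cstar" where
  "cuntz_krieger A = univ_cstar (arcs (graph_of A)) (ck_relations (graph_of A))"

definition ck_gen :: "nat mat \<Rightarrow> edge \<Rightarrow> ck_elem" where
  "ck_gen A = univ_gen (arcs (graph_of A)) (ck_relations (graph_of A))"

definition ck_word :: "nat mat \<Rightarrow> edge list \<Rightarrow> ck_elem" where
  "ck_word A \<mu> = foldr (\<lambda>a x. ck_gen A a \<otimes>\<^bsub>cuntz_krieger A\<^esub> x) \<mu> \<one>\<^bsub>cuntz_krieger A\<^esub>"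

text \<open>All nonempty edge sequences are admitted: \<open>S\<^sub>\<mu> = 0\<close> unless \<open>\<mu>\<close> is a path.\<close>

definition ck_diagonal :: "nat mat \<Rightarrow> ck_elem set" where
  "ck_diagonal A = generated_cstar_subalgebra (cuntz_krieger A)
     {ck_word A \<mu> \<otimes>\<^bsub>cuntz_krieger A\<^esub> adj (cuntz_krieger A) (ck_word A \<mu>) | \<mu>.
        \<mu> \<noteq> [] \<and> set \<mu> \<subseteq> arcs (graph_of A)}"

text \<open>The parameter \<open>t\<close> is a real representative of an element of \<open>\<real>/\<int>\<close>.\<close>

definition gauge_action :: "nat mat \<Rightarrow> real \<Rightarrow> ck_elem \<Rightarrow> ck_elem" where
  "gauge_action A t = (THE f. f \<in> extensional (carrier (cuntz_krieger A)) \<and>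
     cstar_iso (cuntz_krieger A) (cuntz_krieger A) f \<and>
     (\<forall>a\<in>arcs (graph_of A).
        f (ck_gen A a) = scal (cuntz_krieger A) (exp (2 * pi * \<i> * t)) (ck_gen A a)))"


section \<open>Seminorms on the free *-algebra\<close>

definition words :: "'e set \<Rightarrow> 'e star_word set" where
  "words E = {w. fst ` set (letters w) \<subseteq> E}"

lemma words_0 [simp]: "0 \<in> words E"
  by (simp add: words_def zero_star_word_def)

lemma words_add [simp]: "v \<in> words E \<Longrightarrow> w \<in> words E \<Longrightarrow> v + w \<in> words E"
  by (auto simp: words_def plus_star_word_def)

lemma words_adj [simp]: "word_adj w \<in> words E \<longleftrightarrow> w \<in> words E"
  by (auto simp: words_def word_adj_def image_image case_prod_beta)

lemma word_adj_0 [simp]: "word_adj 0 = 0"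
  by (simp add: word_adj_def zero_star_word_def)

lemma word_adj_add: "word_adj (v + w) = word_adj w + word_adj v"
  by (simp add: word_adj_def plus_star_word_def)

lemma free_alg_iff: "x \<in> free_alg E \<longleftrightarrow> Poly_Mapping.keys x \<subseteq> words E"
  by (auto simp: free_alg_def words_def)

lemma lookup_free_scal [simp]: "Poly_Mapping.lookup (free_scal c x) w = c * Poly_Mapping.lookup x w"
  by transfer (simp add: when_def)

lemma lookup_free_adj [simp]:
  "Poly_Mapping.lookup (free_adj x) w = cnj (Poly_Mapping.lookup x (word_adj w))"
  by transfer simp

lemma keys_free_adj: "Poly_Mapping.keys (free_adj x) = word_adj ` Poly_Mapping.keys x"
proof (intro equalityI subsetI)
  fix w assume "w \<in> Poly_Mapping.keys (free_adj x)"
  then have "word_adj w \<in> Poly_Mapping.keys x" by (simp add: in_keys_iff)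
  then show "w \<in> word_adj ` Poly_Mapping.keys x" by (metis image_eqI word_adj_adj)
qed (auto simp: in_keys_iff)

lemma free_alg_0 [simp]: "0 \<in> free_alg E" by (simp add: free_alg_iff)
lemma free_alg_1 [simp]: "1 \<in> free_alg E" by (simp add: free_alg_iff)
lemma free_alg_add [simp]: "x \<in> free_alg E \<Longrightarrow> y \<in> free_alg E \<Longrightarrow> x + y \<in> free_alg E"
  using keys_add[of x y] by (auto simp: free_alg_iff)
lemma free_alg_mult [simp]: "x \<in> free_alg E \<Longrightarrow> y \<in> free_alg E \<Longrightarrow> x * y \<in> free_alg E"
  using keys_mult[of x y] words_add unfolding free_alg_iff by blast
lemma free_alg_uminus [simp]: "- x \<in> free_alg E \<longleftrightarrow> x \<in> free_alg E"
  by (simp add: free_alg_iff in_keys_iff subset_iff)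
lemma free_alg_diff [simp]: "x \<in> free_alg E \<Longrightarrow> y \<in> free_alg E \<Longrightarrow> x - y \<in> free_alg E"
  using free_alg_add[of x E "- y"] by simp
lemma free_alg_scal [simp]: "x \<in> free_alg E \<Longrightarrow> free_scal c x \<in> free_alg E"
  by (auto simp: free_alg_iff in_keys_iff subset_iff)
lemma free_alg_adj [simp]: "x \<in> free_alg E \<Longrightarrow> free_adj x \<in> free_alg E"
  by (auto simp: free_alg_iff keys_free_adj)
lemma free_alg_single: "w \<in> words E \<Longrightarrow> Poly_Mapping.single w c \<in> free_alg E"
  by (simp add: free_alg_iff)
lemma free_alg_gen [simp]: "a \<in> E \<Longrightarrow> free_gen a \<in> free_alg E"
  by (simp add: free_gen_def free_alg_single words_def)
lemma free_alg_sum [simp]: "(\<And>i. i \<in> I \<Longrightarrow> f i \<in> free_alg E) \<Longrightarrow> sum f I \<in> free_alg E"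
  by (induction I rule: infinite_finite_induct) auto

lemma free_adj_0 [simp]: "free_adj 0 = 0" by (rule poly_mapping_eqI) simp
lemma free_adj_add: "free_adj (x + y) = free_adj x + free_adj y"
  by (rule poly_mapping_eqI) (simp add: lookup_add)
lemma free_adj_diff: "free_adj (x - y) = free_adj x - free_adj y"
  by (rule poly_mapping_eqI) (simp add: lookup_minus)
lemma free_adj_sum: "free_adj (sum f I) = (\<Sum>i\<in>I. free_adj (f i))"
  by (induction I rule: infinite_finite_induct) (auto simp: free_adj_add)
lemma free_adj_adj [simp]: "free_adj (free_adj x) = x" by (rule poly_mapping_eqI) simp
lemma free_adj_scal: "free_adj (free_scal c x) = free_scal (cnj c) (free_adj x)"
  by (rule poly_mapping_eqI) simp
lemma free_adj_single: "free_adj (Poly_Mapping.single w c) = Poly_Mapping.single (word_adj w) (cnj c)"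
  by (rule poly_mapping_eqI) (auto simp: lookup_single when_def)

lemma free_sum: "x = (\<Sum>w\<in>Poly_Mapping.keys x. Poly_Mapping.single w (Poly_Mapping.lookup x w))"
proof (rule poly_mapping_eqI)
  fix v
  show "Poly_Mapping.lookup x v = Poly_Mapping.lookup
      (\<Sum>w\<in>Poly_Mapping.keys x. Poly_Mapping.single w (Poly_Mapping.lookup x w)) v"
    by (cases "v \<in> Poly_Mapping.keys x")
      (auto simp: lookup_sum lookup_single when_def sum.delta in_keys_iff)
qed

lemma free_induct [consumes 1, case_names single add]:
  assumes x: "x \<in> free_alg E"
    and single: "\<And>w c. w \<in> words E \<Longrightarrow> Q (Poly_Mapping.single w c)"
    and add: "\<And>x y. x \<in> free_alg E \<Longrightarrow> y \<in> free_alg E \<Longrightarrow> Q x \<Longrightarrow> Q y \<Longrightarrow> Q (x + y)"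
  shows "Q x"
proof -
  have "Q (sum f W) \<and> sum f W \<in> free_alg E"
    if W: "finite W" "W \<subseteq> words E" and f: "\<And>w. \<exists>c. f w = Poly_Mapping.single w c" for W f
    using W
  proof (induction W rule: finite_induct)
    case empty
    show ?case using single[of 0 0] by simp
  next
    case (insert w W)
    obtain c where c: "f w = Poly_Mapping.single w c" using f by blast
    then show ?case using insert
      by (simp add: add single free_alg_single)
  qed
  from this[of "Poly_Mapping.keys x" "\<lambda>w. Poly_Mapping.single w (Poly_Mapping.lookup x w)"]
  show ?thesis using x free_sum[of x] by (auto simp: free_alg_iff)
qed

lemma free_alg_UNIV [simp]: "x \<in> free_alg UNIV" by (simp add: free_alg_iff words_def)

lemma free_adj_mult: "free_adj (x * y) = free_adj y * free_adj (x :: 'e free_star)"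
proof -
  have "x \<in> free_alg UNIV" "y \<in> free_alg UNIV" by simp_all
  then show ?thesis
  proof (induction x rule: free_induct)
    case (single w c)
    from \<open>y \<in> free_alg UNIV\<close> show ?case
      by (induction y rule: free_induct)
        (simp_all add: free_adj_add mult_single free_adj_single word_adj_add distrib_left distrib_right
          mult.commute)
  qed (simp_all add: free_adj_add distrib_left distrib_right)
qed

lemma free_adj_1 [simp]: "free_adj 1 = 1"
  using free_adj_single[of 0 1] by simp

lemma free_scal_conv: "free_scal c x = Poly_Mapping.single 0 c * x"
  by (rule mult_map_scale_conv_mult)

lemma free_scal_mult_left: "free_scal c x * y = free_scal c (x * y)"
  by (simp add: free_scal_conv mult.assoc)

lemma single0_comm: "Poly_Mapping.single 0 c * x = x * Poly_Mapping.single 0 c"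
  for x :: "'e free_star"
proof -
  have "x \<in> free_alg UNIV" by simp
  then show ?thesis
    by (induction x rule: free_induct) (simp_all add: mult_single distrib_left distrib_right mult.commute)
qed

lemma free_scal_mult_right: "x * free_scal c y = free_scal c (x * y)"
  by (metis free_scal_conv mult.assoc single0_comm)

lemma free_scal_add: "free_scal c (x + y) = free_scal c x + free_scal c y"
  by (rule poly_mapping_eqI) (simp add: lookup_add algebra_simps)
lemma free_scal_diff: "free_scal c (x - y) = free_scal c x - free_scal c y"
  by (rule poly_mapping_eqI) (simp add: lookup_minus algebra_simps)
lemma free_scal_add_left: "free_scal (c + d) x = free_scal c x + free_scal d x"
  by (rule poly_mapping_eqI) (simp add: lookup_add algebra_simps)
lemma free_scal_scal: "free_scal c (free_scal d x) = free_scal (c * d) x"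
  by (rule poly_mapping_eqI) (simp add: algebra_simps)
lemma free_scal_1 [simp]: "free_scal 1 x = x"
  by (rule poly_mapping_eqI) simp
lemma free_scal_m1: "free_scal (-1) x = - x"
  by (rule poly_mapping_eqI) simp
lemma free_scal_0 [simp]: "free_scal 0 x = 0"
  by (rule poly_mapping_eqI) simp


locale seminormed =
  fixes E :: "'e set" and p :: "'e free_star \<Rightarrow> real"
  assumes p: "cstar_seminorm E p"
begin

abbreviation F where "F \<equiv> free_alg E"

lemma p_add: "x \<in> F \<Longrightarrow> y \<in> F \<Longrightarrow> p (x + y) \<le> p x + p y"
  using p by (auto simp: cstar_seminorm_def)
lemma p_mult: "x \<in> F \<Longrightarrow> y \<in> F \<Longrightarrow> p (x * y) \<le> p x * p y"
  using p by (auto simp: cstar_seminorm_def)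
lemma p_scal: "x \<in> F \<Longrightarrow> p (free_scal c x) = cmod c * p x"
  using p by (auto simp: cstar_seminorm_def)
lemma p_cstar: "x \<in> F \<Longrightarrow> p (free_adj x * x) = (p x)\<^sup>2"
  using p by (auto simp: cstar_seminorm_def)
lemma p_0 [simp]: "p 0 = 0" using p_scal[of 0 0] by simp
lemma p_uminus: "x \<in> F \<Longrightarrow> p (- x) = p x" using p_scal[of x "-1"] by (simp add: free_scal_m1)
lemma p_nonneg: "x \<in> F \<Longrightarrow> p x \<ge> 0"
  using p_add[of x "- x"] by (simp add: p_uminus)
lemma p_minus_commute: "x \<in> F \<Longrightarrow> y \<in> F \<Longrightarrow> p (x - y) = p (y - x)"
  using p_uminus[of "x - y"] by simp
lemma p_diff: "x \<in> F \<Longrightarrow> y \<in> F \<Longrightarrow> p (x - y) \<le> p x + p y"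
  using p_add[of x "- y"] by (simp add: p_uminus)
lemma p_triangle: "x \<in> F \<Longrightarrow> y \<in> F \<Longrightarrow> z \<in> F \<Longrightarrow> p (x - z) \<le> p (x - y) + p (y - z)"
  using p_add[of "x - y" "y - z"] by simp
lemma p_rev: "x \<in> F \<Longrightarrow> y \<in> F \<Longrightarrow> \<bar>p x - p y\<bar> \<le> p (x - y)"
  using p_add[of "x - y" y] p_add[of "y - x" x] p_minus_commute[of x y] by simp
lemma p_adj: assumes "x \<in> F" shows "p (free_adj x) = p x"
proof -
  have *: "p y \<le> p (free_adj y)" if "y \<in> F" for y
  proof (cases "p y = 0")
    case False
    have "p y * p y \<le> p (free_adj y) * p y"
      using p_cstar[OF that] p_mult[of "free_adj y" y] that by (simp add: power2_eq_square)
    moreover have "p y > 0" using p_nonneg[OF that] False by simp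
    ultimately show ?thesis by simp
  qed (use that in \<open>simp add: p_nonneg\<close>)
  show ?thesis using *[of x] *[of "free_adj x"] assms by simp
qed
lemma p_1: "p 1 \<le> 1"
proof -
  have "p 1 = (p 1)\<^sup>2" using p_cstar[of 1] by simp
  then show ?thesis by (cases "p 1 = 0") (auto simp: power2_eq_square)
qed

end


section \<open>The completion is a C*-algebra\<close>

lemma cauchy_ring_simps [simp]:
  "monoid.mult (cauchy_ring E p) = (\<lambda>x y n. x n * y n)"
  "monoid.one (cauchy_ring E p) = (\<lambda>n. 1)"
  "ring.zero (cauchy_ring E p) = (\<lambda>n. 0)"
  "ring.add (cauchy_ring E p) = (\<lambda>x y n. x n + y n)"
  by (simp_all add: cauchy_ring_def)

context seminormed
begin

abbreviation CR where "CR \<equiv> cauchy_ring E p"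
abbreviation NS where "NS \<equiv> null_seqs E p"

lemma CR_iff: "x \<in> carrier CR \<longleftrightarrow> (\<forall>n. x n \<in> F) \<and> (\<forall>e>0. \<exists>N. \<forall>i\<ge>N. \<forall>j\<ge>N. p (x i - x j) < e)"
  by (simp add: cauchy_ring_def)

lemma CR_F [simp]: "x \<in> carrier CR \<Longrightarrow> x n \<in> F" by (simp add: CR_iff)

lemma CR_D: "x \<in> carrier CR \<Longrightarrow> e > 0 \<Longrightarrow> \<exists>N. \<forall>i\<ge>N. \<forall>j\<ge>N. p (x i - x j) < e"
  by (simp add: CR_iff)

lemma CR_dominated:
  assumes "\<And>n. y n \<in> F" "x \<in> carrier CR" "C > 0" "\<And>i j. p (y i - y j) \<le> C * p (x i - x j)"
  shows "y \<in> carrier CR"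
  unfolding CR_iff
proof (intro conjI allI impI)
  fix e :: real assume "e > 0"
  with CR_D[OF assms(2), of "e / C"] assms(3) obtain N
    where N: "\<forall>i\<ge>N. \<forall>j\<ge>N. p (x i - x j) < e / C" by auto
  have "p (y i - y j) < e" if "i \<ge> N" "j \<ge> N" for i j
  proof -
    have "C * p (x i - x j) < e" using N that assms(3) by (simp add: field_simps)
    with assms(4)[of i j] show ?thesis by simp
  qed
  then show "\<exists>N. \<forall>i\<ge>N. \<forall>j\<ge>N. p (y i - y j) < e" by blast
qed (rule assms)

lemma CR_dominated2:
  assumes "\<And>n. z n \<in> F" "x \<in> carrier CR" "y \<in> carrier CR" "C > 0"
    "\<And>i j. p (z i - z j) \<le> C * (p (x i - x j) + p (y i - y j))"
  shows "z \<in> carrier CR"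
  unfolding CR_iff
proof (intro conjI allI impI)
  fix e :: real assume "e > 0"
  with CR_D[OF assms(2), of "e / (2 * C)"] CR_D[OF assms(3), of "e / (2 * C)"] assms(4) obtain M N
    where N: "\<forall>i\<ge>N. \<forall>j\<ge>N. p (x i - x j) < e / (2 * C)"
      and M: "\<forall>i\<ge>M. \<forall>j\<ge>M. p (y i - y j) < e / (2 * C)" by auto
  have "p (z i - z j) < e" if "i \<ge> max M N" "j \<ge> max M N" for i j
  proof -
    have "p (x i - x j) < e / (2 * C)" "p (y i - y j) < e / (2 * C)" using M N that by auto
    then have "p (x i - x j) + p (y i - y j) < e / C" by (simp add: field_simps)
    then have "C * (p (x i - x j) + p (y i - y j)) < e" using assms(4) by (simp add: field_simps)
    with assms(5)[of i j] show ?thesis by simp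
  qed
  then show "\<exists>N. \<forall>i\<ge>N. \<forall>j\<ge>N. p (z i - z j) < e" by blast
qed (rule assms)

lemma CR_bounded:
  assumes "x \<in> carrier CR" obtains M where "M > 0" "\<And>n. p (x n) \<le> M"
proof -
  obtain N where N: "\<forall>i\<ge>N. \<forall>j\<ge>N. p (x i - x j) < 1" using CR_D[OF assms, of 1] by auto
  define M where "M = (\<Sum>i\<le>N. p (x i)) + 1"
  have le: "p (x i) \<le> (\<Sum>i\<le>N. p (x i))" if "i \<le> N" for i
    using that assms by (intro member_le_sum) (auto simp: p_nonneg)
  have "p (x n) \<le> M" for n
  proof (cases "n \<le> N")
    case True then show ?thesis using le[of n] by (simp add: M_def)
  next
    case False
    have "\<bar>p (x n) - p (x N)\<bar> < 1" using p_rev[of "x n" "x N"] N False assms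
      by (metis CR_F le_trans linear order_le_less_trans)
    then show ?thesis using le[of N] by (simp add: M_def)
  qed
  moreover have "M > 0" using sum_nonneg[of "{..N}" "\<lambda>i. p (x i)"] assms
    by (simp add: M_def p_nonneg add_nonneg_pos)
  ultimately show ?thesis using that by blast
qed

lemma CR_const [simp]: "(\<lambda>n. c) \<in> carrier CR \<longleftrightarrow> c \<in> F" by (simp add: CR_iff)

lemma CR_add [simp]:
  assumes "x \<in> carrier CR" "y \<in> carrier CR" shows "(\<lambda>n. x n + y n) \<in> carrier CR"
proof (rule CR_dominated2[OF _ assms, where C = 1])
  show "p (x i + y i - (x j + y j)) \<le> 1 * (p (x i - x j) + p (y i - y j))" for i j
    using p_add[of "x i - x j" "y i - y j"] assms by (simp add: add_diff_add)
qed (use assms in auto)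

lemma CR_scal [simp]:
  assumes "x \<in> carrier CR" shows "(\<lambda>n. free_scal c (x n)) \<in> carrier CR"
  using assms
proof (rule CR_dominated[rotated])
  show "cmod c + 1 > 0" by (simp add: add_nonneg_pos)
  show "p (free_scal c (x i) - free_scal c (x j)) \<le> (cmod c + 1) * p (x i - x j)" for i j
    using assms p_nonneg[of "x i - x j"]
    by (simp add: free_scal_diff[symmetric] p_scal algebra_simps)
qed (use assms in auto)

lemma CR_uminus [simp]:
  assumes "x \<in> carrier CR" shows "(\<lambda>n. - x n) \<in> carrier CR"
  using CR_scal[OF assms, of "-1"] by (simp add: free_scal_m1)

lemma CR_diff [simp]:
  assumes "x \<in> carrier CR" "y \<in> carrier CR" shows "(\<lambda>n. x n - y n) \<in> carrier CR"
  using CR_add[OF assms(1) CR_uminus[OF assms(2)]] by simp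

lemma CR_adj [simp]:
  assumes "x \<in> carrier CR" shows "(\<lambda>n. free_adj (x n)) \<in> carrier CR"
  using assms
  by (rule CR_dominated[where C = 1, rotated])
    (use assms in \<open>auto simp: free_adj_diff[symmetric] p_adj\<close>)

lemma CR_mult [simp]:
  assumes "x \<in> carrier CR" "y \<in> carrier CR" shows "(\<lambda>n. x n * y n) \<in> carrier CR"
proof -
  obtain M where M: "M > 0" "\<And>n. p (x n) \<le> M" using CR_bounded[OF assms(1)] by blast
  obtain K where K: "K > 0" "\<And>n. p (y n) \<le> K" using CR_bounded[OF assms(2)] by blast
  show ?thesis
  proof (rule CR_dominated2[OF _ assms, where C = "M + K"])
    fix i j
    have "p (x i * y i - x j * y j) = p (x i * (y i - y j) + (x i - x j) * y j)"
      by (simp add: algebra_simps)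
    also have "\<dots> \<le> p (x i) * p (y i - y j) + p (x i - x j) * p (y j)"
      using assms by (intro order_trans[OF p_add] add_mono p_mult) auto
    also have "\<dots> \<le> M * p (y i - y j) + p (x i - x j) * K"
      using assms M(2)[of i] K(2)[of j] by (intro add_mono mult_mono) (auto simp: p_nonneg M(1) less_imp_le)
    also have "\<dots> \<le> (M + K) * (p (x i - x j) + p (y i - y j))"
      using M(1) K(1) assms p_nonneg[of "x i - x j"] p_nonneg[of "y i - y j"] by (simp add: algebra_simps)
    finally show "p (x i * y i - x j * y j) \<le> (M + K) * (p (x i - x j) + p (y i - y j))" .
  qed (use assms M(1) K(1) in auto)
qed

lemma ring_CR: "ring CR"
proof (rule ringI)
  show "abelian_group CR"
  proof (rule abelian_groupI)
    show "\<exists>y\<in>carrier CR. y \<oplus>\<^bsub>CR\<^esub> x = \<zero>\<^bsub>CR\<^esub>" if "x \<in> carrier CR" for x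
      using that by (intro bexI[of _ "\<lambda>n. - x n"]) auto
  qed (auto simp: add.assoc add.commute)
  show "Group.monoid CR" by unfold_locales (auto simp: mult.assoc)
qed (auto simp: distrib_left distrib_right)

lemma NS_F: "x \<in> NS \<Longrightarrow> x n \<in> F" by (simp add: null_seqs_def)

lemma NS_I:
  assumes "\<And>n. x n \<in> F" "\<And>n. p (x n) \<le> f n" "f \<longlonglongrightarrow> 0" shows "x \<in> NS"
  unfolding null_seqs_def
proof (intro CollectI conjI allI)
  show "(\<lambda>n. p (x n)) \<longlonglongrightarrow> 0"
    by (rule tendsto_sandwich[OF _ _ tendsto_const assms(3)])
      (auto intro!: always_eventually p_nonneg assms)
qed (rule assms)

lemma NS_0: "(\<lambda>n. 0) \<in> NS" by (simp add: null_seqs_def)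

lemma NS_tendsto: "x \<in> NS \<Longrightarrow> (\<lambda>n. p (x n)) \<longlonglongrightarrow> 0" by (simp add: null_seqs_def)

lemma NS_CR: assumes "x \<in> NS" shows "x \<in> carrier CR"
  unfolding CR_iff
proof (intro conjI allI impI)
  fix e :: real assume "e > 0"
  then obtain N where N: "\<And>n. n \<ge> N \<Longrightarrow> p (x n) < e / 2"
    using order_tendstoD(2)[OF NS_tendsto[OF assms], of "e / 2"] by (auto simp: eventually_sequentially)
  have "p (x i - x j) < e" if "i \<ge> N" "j \<ge> N" for i j
    using p_diff[of "x i" "x j"] N[of i] N[of j] that NS_F[OF assms] by auto
  then show "\<exists>N. \<forall>i\<ge>N. \<forall>j\<ge>N. p (x i - x j) < e" by blast
qed (rule NS_F[OF assms])

lemma NS_add [simp]: assumes "x \<in> NS" "y \<in> NS" shows "(\<lambda>n. x n + y n) \<in> NS"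
  using tendsto_add[OF NS_tendsto[OF assms(1)] NS_tendsto[OF assms(2)]] assms
  by (intro NS_I[where f = "\<lambda>n. p (x n) + p (y n)"]) (auto simp: NS_F p_add)

lemma NS_scal [simp]: assumes "x \<in> NS" shows "(\<lambda>n. free_scal c (x n)) \<in> NS"
  using tendsto_mult[OF tendsto_const[of "cmod c"] NS_tendsto[OF assms(1)]] assms
  by (intro NS_I[where f = "\<lambda>n. cmod c * p (x n)"]) (auto simp: NS_F p_scal)

lemma NS_uminus [simp]: assumes "x \<in> NS" shows "(\<lambda>n. - x n) \<in> NS"
  using NS_scal[OF assms, of "-1"] by (simp add: free_scal_m1)

lemma NS_adj [simp]: assumes "x \<in> NS" shows "(\<lambda>n. free_adj (x n)) \<in> NS"
  using NS_tendsto[OF assms(1)] assms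
  by (intro NS_I[where f = "\<lambda>n. p (x n)"]) (auto simp: NS_F p_adj)

lemma NS_mult_left [simp]:
  assumes "x \<in> carrier CR" "y \<in> NS" shows "(\<lambda>n. x n * y n) \<in> NS"
proof -
  obtain M where M: "M > 0" "\<And>n. p (x n) \<le> M" using CR_bounded[OF assms(1)] by blast
  have "p (x n * y n) \<le> M * p (y n)" for n
    using assms M(2)[of n] by (intro order_trans[OF p_mult] mult_right_mono) (auto simp: p_nonneg NS_F)
  then show ?thesis using tendsto_mult[OF tendsto_const[of M] NS_tendsto[OF assms(2)]] assms
    by (intro NS_I[where f = "\<lambda>n. M * p (y n)"]) (auto simp: NS_F)
qed

lemma NS_mult_right [simp]:
  assumes "x \<in> carrier CR" "y \<in> NS" shows "(\<lambda>n. y n * x n) \<in> NS"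
  using NS_adj[OF NS_mult_left[OF CR_adj[OF assms(1)] NS_adj[OF assms(2)]]] by (simp add: free_adj_mult)

interpretation CR: ring CR by (rule ring_CR)

lemma CR_a_inv: "x \<in> carrier CR \<Longrightarrow> \<ominus>\<^bsub>CR\<^esub> x = (\<lambda>n. - x n)"
  by (rule CR.minus_equality) auto

lemma CR_minus: "x \<in> carrier CR \<Longrightarrow> y \<in> carrier CR \<Longrightarrow> x \<ominus>\<^bsub>CR\<^esub> y = (\<lambda>n. x n - y n)"
  by (simp add: a_minus_def CR_a_inv)

lemma ideal_NS: "ideal NS CR"
proof (rule idealI[OF ring_CR])
  show "subgroup NS (add_monoid CR)"
  proof (unfold_locales)
    show "inv\<^bsub>add_monoid CR\<^esub> x \<in> NS" if "x \<in> NS" for x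
      using CR_a_inv[of x] that by (simp add: a_inv_def NS_CR)
    show "\<one>\<^bsub>add_monoid CR\<^esub> \<in> NS" by (simp add: null_seqs_def)
  qed (auto simp: NS_CR)
qed auto

interpretation NS: ideal NS CR by (rule ideal_NS)

abbreviation cls where "cls \<equiv> seq_class E p"

lemma cls_eq_iff:
  "x \<in> carrier CR \<Longrightarrow> y \<in> carrier CR \<Longrightarrow> cls x = cls y \<longleftrightarrow> (\<lambda>n. x n - y n) \<in> NS"
  unfolding seq_class_def
  using CR.quotient_eq_iff_same_a_r_cos[OF ideal_NS, of x y] by (simp add: CR_minus)

lemma cls_self: "x \<in> carrier CR \<Longrightarrow> x \<in> cls x"
  unfolding seq_class_def by (rule NS.a_rcos_self)

lemma mem_cls: assumes "x \<in> carrier CR" "y \<in> cls x"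
  shows "y \<in> carrier CR" "(\<lambda>n. y n - x n) \<in> NS"
  using assms unfolding seq_class_def by (auto simp: a_r_coset_def' NS_CR)

abbreviation C where "C \<equiv> completion E p"

lemma C_carrier: "carrier C = cls ` carrier CR"
  by (auto simp: completion_def ring.defs cstar.defs FactRing_def A_RCOSETS_def' seq_class_def)

lemma C_mult: "x \<in> carrier CR \<Longrightarrow> y \<in> carrier CR \<Longrightarrow> cls x \<otimes>\<^bsub>C\<^esub> cls y = cls (\<lambda>n. x n * y n)"
  using NS.rcoset_mult_add[of x y]
  by (simp add: completion_def ring.defs cstar.defs FactRing_def seq_class_def)

lemma C_add: "x \<in> carrier CR \<Longrightarrow> y \<in> carrier CR \<Longrightarrow> cls x \<oplus>\<^bsub>C\<^esub> cls y = cls (\<lambda>n. x n + y n)"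
  using NS.a_rcos_sum[of x y]
  by (simp add: completion_def ring.defs cstar.defs FactRing_def seq_class_def)

lemma C_one: "\<one>\<^bsub>C\<^esub> = cls (\<lambda>n. 1)"
  by (simp add: completion_def ring.defs cstar.defs FactRing_def seq_class_def)

lemma C_zero: "\<zero>\<^bsub>C\<^esub> = cls (\<lambda>n. 0)"
proof -
  have "cls (\<lambda>n. 0) = NS" unfolding seq_class_def by (rule CR.a_rcos_zero[OF ideal_NS NS_0])
  then show ?thesis by (simp add: completion_def ring.defs cstar.defs FactRing_def)
qed

lemma ring_C: "ring C"
proof -
  interpret Q: ring "CR Quot NS" by (rule NS.quotient_is_ring)
  have eq: "carrier C = carrier (CR Quot NS)" "monoid.mult C = monoid.mult (CR Quot NS)"
    "monoid.one C = monoid.one (CR Quot NS)" "ring.zero C = ring.zero (CR Quot NS)"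
    "ring.add C = ring.add (CR Quot NS)"
    by (simp_all add: completion_def ring.defs cstar.defs)
  show ?thesis
  proof (rule ringI)
    show "abelian_group C"
    proof (rule abelian_groupI)
      show "\<exists>y\<in>carrier C. y \<oplus>\<^bsub>C\<^esub> x = \<zero>\<^bsub>C\<^esub>" if "x \<in> carrier C" for x
        using that unfolding eq by (intro bexI[of _ "\<ominus>\<^bsub>CR Quot NS\<^esub> x"]) (auto simp: Q.l_neg)
      show "x \<oplus>\<^bsub>C\<^esub> y = y \<oplus>\<^bsub>C\<^esub> x" if "x \<in> carrier C" "y \<in> carrier C" for x y
        using that unfolding eq by (rule Q.a_comm)
    qed (simp_all add: eq Q.a_assoc)
    show "Group.monoid C" by (rule monoidI) (simp_all add: eq Q.m_assoc)
  qed (simp_all add: eq Q.l_distr Q.r_distr)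
qed

lemma C_scal: assumes "x \<in> carrier CR" shows "scal C c (cls x) = cls (\<lambda>n. free_scal c (x n))"
proof -
  have "cls (\<lambda>n. free_scal c (y n)) = cls (\<lambda>n. free_scal c (x n))" if "y \<in> cls x" for y
    using mem_cls[OF assms that] assms NS_scal[of "\<lambda>n. y n - x n" c]
    by (subst cls_eq_iff) (auto simp: free_scal_diff)
  then have "(\<Union>y\<in>cls x. cls (\<lambda>n. free_scal c (y n))) = cls (\<lambda>n. free_scal c (x n))"
    using cls_self[OF assms] by blast
  moreover have "scal C c (cls x) = (\<Union>y\<in>cls x. cls (\<lambda>n. free_scal c (y n)))"
    by (simp add: completion_def ring.defs cstar.defs)
  ultimately show ?thesis by simp
qed

lemma C_adj: assumes "x \<in> carrier CR" shows "adj C (cls x) = cls (\<lambda>n. free_adj (x n))"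
proof -
  have "cls (\<lambda>n. free_adj (y n)) = cls (\<lambda>n. free_adj (x n))" if "y \<in> cls x" for y
    using mem_cls[OF assms that] assms NS_adj[of "\<lambda>n. y n - x n"]
    by (subst cls_eq_iff) (auto simp: free_adj_diff)
  then have "(\<Union>y\<in>cls x. cls (\<lambda>n. free_adj (y n))) = cls (\<lambda>n. free_adj (x n))"
    using cls_self[OF assms] by blast
  moreover have "adj C (cls x) = (\<Union>y\<in>cls x. cls (\<lambda>n. free_adj (y n)))"
    by (simp add: completion_def ring.defs cstar.defs)
  ultimately show ?thesis by simp
qed

lemma C_a_inv: "x \<in> carrier CR \<Longrightarrow> \<ominus>\<^bsub>C\<^esub> cls x = cls (\<lambda>n. - x n)"
proof -
  assume x: "x \<in> carrier CR"
  interpret C: ring C by (rule ring_C)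
  show ?thesis
    by (rule C.minus_equality) (use x in \<open>auto simp: C_add C_zero C_carrier\<close>)
qed

lemma C_minus: "x \<in> carrier CR \<Longrightarrow> y \<in> carrier CR \<Longrightarrow> cls x \<ominus>\<^bsub>C\<^esub> cls y = cls (\<lambda>n. x n - y n)"
  by (simp add: a_minus_def C_a_inv C_add)

lemma p_convergent: assumes "x \<in> carrier CR" shows "convergent (\<lambda>n. p (x n))"
proof -
  have "Cauchy (\<lambda>n. p (x n))"
  proof (rule CauchyI)
    fix e :: real assume "e > 0"
    then obtain N where N: "\<forall>i\<ge>N. \<forall>j\<ge>N. p (x i - x j) < e" using CR_D[OF assms] by blast
    then have "norm (p (x i) - p (x j)) < e" if "i \<ge> N" "j \<ge> N" for i j
      using p_rev[of "x i" "x j"] that assms by (metis CR_F order_le_less_trans real_norm_def)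
    then show "\<exists>M. \<forall>m\<ge>M. \<forall>n\<ge>M. norm (p (x m) - p (x n)) < e" by blast
  qed
  then show ?thesis by (rule real_Cauchy_convergent)
qed

lemma C_nrm_eq: assumes x: "x \<in> carrier CR" and r: "(\<lambda>n. p (x n)) \<longlonglongrightarrow> r" shows "nrm C (cls x) = r"
proof -
  have "(\<lambda>n. p (y n)) \<longlonglongrightarrow> r" if "y \<in> cls x" for y
  proof -
    have y: "y \<in> carrier CR" "(\<lambda>n. y n - x n) \<in> NS" using mem_cls[OF x that] by auto
    have "(\<lambda>n. p (y n) - p (x n)) \<longlonglongrightarrow> 0"
      by (rule tendsto_rabs_zero_cancel, rule tendsto_sandwich[OF _ _ tendsto_const NS_tendsto[OF y(2)]])
        (auto intro!: always_eventually p_rev simp: x y)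
    from tendsto_add[OF this r] show ?thesis by simp
  qed
  then have "(THE r. \<forall>y\<in>cls x. (\<lambda>n. p (y n)) \<longlonglongrightarrow> r) = r"
    using cls_self[OF x] by (intro the_equality) (auto intro: LIMSEQ_unique)
  then show ?thesis by (simp add: completion_def ring.defs cstar.defs)
qed

lemma C_nrm: "x \<in> carrier CR \<Longrightarrow> (\<lambda>n. p (x n)) \<longlonglongrightarrow> nrm C (cls x)"
  using p_convergent[of x] C_nrm_eq[of x] unfolding convergent_def by blast

lemma C_nrm_const: "a \<in> F \<Longrightarrow> nrm C (cls (\<lambda>n. a)) = p a"
  by (rule C_nrm_eq) auto

lemma C_nrm_le: assumes "x \<in> carrier CR" "\<And>n. n \<ge> N \<Longrightarrow> p (x n) \<le> e" shows "nrm C (cls x) \<le> e"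
  using C_nrm[OF assms(1)] by (rule LIMSEQ_le_const2) (use assms(2) in blast)

lemma C_nrm_0_iff:
  assumes x: "x \<in> carrier CR" shows "nrm C (cls x) = 0 \<longleftrightarrow> cls x = \<zero>\<^bsub>C\<^esub>"
proof -
  have "cls x = \<zero>\<^bsub>C\<^esub> \<longleftrightarrow> x \<in> NS"
    unfolding C_zero using cls_eq_iff[OF x NS_CR[OF NS_0]] by (simp only: diff_0_right)
  also have "\<dots> \<longleftrightarrow> (\<lambda>n. p (x n)) \<longlonglongrightarrow> 0"
    using x by (simp only: null_seqs_def mem_Collect_eq CR_F simp_thms)
  also have "\<dots> \<longleftrightarrow> nrm C (cls x) = 0"
    using C_nrm[OF x] C_nrm_eq[OF x, of 0] by metis
  finally show ?thesis by blast
qed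

lemma C_approx:
  assumes "x \<in> carrier CR" "e > 0"
  shows "\<exists>N. \<forall>i\<ge>N. nrm C (cls (\<lambda>n. x n - x i)) \<le> e"
proof -
  obtain N where N: "\<forall>i\<ge>N. \<forall>j\<ge>N. p (x i - x j) < e" using CR_D[OF assms] by blast
  have "nrm C (cls (\<lambda>n. x n - x i)) \<le> e" if "i \<ge> N" for i
    by (rule C_nrm_le[where N = N]) (use assms N that less_imp_le in auto)
  then show ?thesis by blast
qed

end


context seminormed
begin

lemma cstar_C: "cstar_algebra C"
proof -
  interpret C: ring C by (rule ring_C)
  have le: "nrm C (cls z) \<le> nrm C (cls x) + nrm C (cls y)"
    if "x \<in> carrier CR" "y \<in> carrier CR" "z \<in> carrier CR" "\<And>n. p (z n) \<le> p (x n) + p (y n)" for x y z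
    by (rule LIMSEQ_le[OF C_nrm[OF that(3)] tendsto_add[OF C_nrm[OF that(1)] C_nrm[OF that(2)]]])
      (use that(4) in auto)
  show ?thesis
  proof (unfold_locales, goal_cases)
    case (14 x y)
    then obtain x' y' where *: "x = cls x'" "y = cls y'" "x' \<in> carrier CR" "y' \<in> carrier CR"
      by (auto simp: C_carrier)
    show ?case by (simp add: * C_add, rule le) (auto simp: * p_add)
  next
    case (15 x c)
    then obtain x' where *: "x = cls x'" "x' \<in> carrier CR" by (auto simp: C_carrier)
    show ?case unfolding * C_scal[OF *(2)]
      by (rule C_nrm_eq) (auto simp: * p_scal intro!: tendsto_mult C_nrm)
  next
    case (16 x y)
    then obtain x' y' where *: "x = cls x'" "y = cls y'" "x' \<in> carrier CR" "y' \<in> carrier CR"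
      by (auto simp: C_carrier)
    show ?case unfolding * C_mult[OF *(3,4)]
      by (rule LIMSEQ_le[OF C_nrm tendsto_mult[OF C_nrm C_nrm]]) (auto simp: * p_mult)
  next
    case (17 x)
    then obtain x' where *: "x = cls x'" "x' \<in> carrier CR" by (auto simp: C_carrier)
    have "(\<lambda>n. p (free_adj (x' n) * x' n)) \<longlonglongrightarrow> (nrm C x)\<^sup>2"
      using tendsto_power[OF C_nrm[OF *(2)], of 2] * by (simp add: p_cstar)
    then show ?case unfolding * using *(2) by (simp add: C_adj C_mult C_nrm_eq)
  next
    case (18 X)
    have "\<exists>x. X n = cls x \<and> x \<in> carrier CR" for n using 18(1)[of n] by (auto simp: C_carrier)
    then obtain x where x: "\<And>n. X n = cls (x n)" "\<And>n. x n \<in> carrier CR" by metis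
    have "\<exists>i. nrm C (cls (\<lambda>n. x k n - x k i)) \<le> inverse (Suc k)" for k
      using C_approx[OF x(2)[of k], of "inverse (Suc k)"] by auto
    then obtain s where s: "\<And>k. nrm C (cls (\<lambda>n. x k n - x k (s k))) \<le> inverse (Suc k)" by metis
    define y where "y = (\<lambda>k. x k (s k))"
    have yF: "y k \<in> F" for k by (simp add: y_def x)
    have s1: "nrm C (cls (\<lambda>n. x k n - y k)) \<le> inverse (Suc k)" for k using s by (simp add: y_def)
    have s2: "nrm C (cls (\<lambda>n. y k - x k n)) \<le> inverse (Suc k)" for k
    proof -
      have "nrm C (cls (\<lambda>n. y k - x k n)) = nrm C (cls (\<lambda>n. x k n - y k))"
        using C_nrm[of "\<lambda>n. x k n - y k"] x(2) yF
        by (intro C_nrm_eq) (auto simp: p_minus_commute[of "y k"])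
      then show ?thesis using s1 by simp
    qed
    have yd: "p (y k - y l) \<le> inverse (Suc k) + (nrm C (X k \<ominus>\<^bsub>C\<^esub> X l) + inverse (Suc l))" for k l
    proof -
      have "p (y k - y l) = nrm C (cls (\<lambda>n. y k - y l))" by (simp add: C_nrm_const yF)
      also have "\<dots> \<le> nrm C (cls (\<lambda>n. y k - x k n)) + nrm C (cls (\<lambda>n. x k n - y l))"
        using x(2) yF by (intro le) (auto intro: p_triangle)
      also have "nrm C (cls (\<lambda>n. x k n - y l)) \<le> nrm C (cls (\<lambda>n. x k n - x l n)) + nrm C (cls (\<lambda>n. x l n - y l))"
        using x(2) yF by (intro le) (auto intro: p_triangle)
      also have "cls (\<lambda>n. x k n - x l n) = X k \<ominus>\<^bsub>C\<^esub> X l" using x by (simp add: C_minus)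
      finally show ?thesis using s1[of l] s2[of k] by linarith
    qed
    have inv: "(\<lambda>k. inverse (real (Suc k))) \<longlonglongrightarrow> 0" by (rule LIMSEQ_inverse_real_of_nat)
    have yC: "y \<in> carrier CR"
      unfolding CR_iff
    proof (intro conjI allI impI yF)
      fix e :: real assume e: "e > 0"
      obtain N1 where N1: "\<forall>i\<ge>N1. \<forall>j\<ge>N1. nrm C (X i \<ominus>\<^bsub>C\<^esub> X j) < e / 3"
        using 18(2)[of "e / 3"] e by auto
      obtain N2 where N2: "\<And>k. k \<ge> N2 \<Longrightarrow> inverse (real (Suc k)) < e / 3"
        using order_tendstoD(2)[OF inv, of "e / 3"] e by (auto simp: eventually_sequentially)
      have "p (y i - y j) < e" if "i \<ge> max N1 N2" "j \<ge> max N1 N2" for i j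
      proof -
        have "nrm C (X i \<ominus>\<^bsub>C\<^esub> X j) < e / 3" using N1 that by simp
        then show ?thesis using yd[of i j] N2[of i] N2[of j] that by simp
      qed
      then show "\<exists>N. \<forall>i\<ge>N. \<forall>j\<ge>N. p (y i - y j) < e" by blast
    qed
    have "(\<lambda>k. nrm C (X k \<ominus>\<^bsub>C\<^esub> cls y)) \<longlonglongrightarrow> 0"
    proof (rule LIMSEQ_I)
      fix e :: real assume e: "e > 0"
      obtain N1 where N1: "\<forall>i\<ge>N1. \<forall>j\<ge>N1. p (y i - y j) < e / 3"
        using CR_D[OF yC, of "e / 3"] e by auto
      obtain N2 where N2: "\<And>k. k \<ge> N2 \<Longrightarrow> inverse (real (Suc k)) < e / 3"
        using order_tendstoD(2)[OF inv, of "e / 3"] e by (auto simp: eventually_sequentially)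
      have "norm (nrm C (X k \<ominus>\<^bsub>C\<^esub> cls y) - 0) < e" if k: "k \<ge> max N1 N2" for k
      proof -
        have "X k \<ominus>\<^bsub>C\<^esub> cls y = cls (\<lambda>n. x k n - y n)" using x yC by (simp add: C_minus)
        moreover have "nrm C (cls (\<lambda>n. x k n - y n)) \<le> nrm C (cls (\<lambda>n. x k n - y k)) + nrm C (cls (\<lambda>n. y k - y n))"
          using x(2) yF yC by (intro le) (auto intro: p_triangle)
        moreover have "nrm C (cls (\<lambda>n. y k - y n)) \<le> e / 3"
          by (rule C_nrm_le[where N = N1]) (use yF yC N1 k less_imp_le in auto)
        moreover have "inverse (real (Suc k)) < e / 3" using N2[of k] k by simp
        moreover have "nrm C (cls (\<lambda>n. x k n - y n)) \<ge> 0"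
          using C_nrm[of "\<lambda>n. x k n - y n"] x(2) yC by (intro LIMSEQ_le_const) (auto intro!: p_nonneg)
        ultimately show ?thesis using s1[of k] e by simp
      qed
      then show "\<exists>N. \<forall>k\<ge>N. norm (nrm C (X k \<ominus>\<^bsub>C\<^esub> cls y) - 0) < e" by blast
    qed
    then show ?case using yC by (auto simp: C_carrier)
  next
    case (13 x) then show ?case using C_nrm_0_iff by (auto simp: C_carrier)
  qed (auto simp: C_carrier C_scal C_adj C_mult C_add C_one free_scal_add free_scal_add_left free_scal_scal
      free_scal_mult_left free_scal_mult_right free_adj_add free_adj_mult free_adj_scal)
qed

end


section \<open>The largest C*-seminorm\<close>

lemma seminormed_zero: "seminormed E (\<lambda>x. 0)"
  by unfold_locales (simp add: cstar_seminorm_def)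

locale cstar_presentation =
  fixes E :: "'e set" and R :: "'e free_star set"
  assumes gen_bounded: "a \<in> E \<Longrightarrow> \<exists>M. \<forall>p\<in>univ_seminorms E R. p (free_gen a) \<le> M"
begin

lemma univ_seminorms_D: "p \<in> univ_seminorms E R \<Longrightarrow> seminormed E p"
  by (simp add: univ_seminorms_def seminormed_def)

lemma letter_bounded:
  assumes "fst l \<in> E"
  shows "\<exists>M\<ge>0. \<forall>p\<in>univ_seminorms E R. p (Poly_Mapping.single (Word [l]) 1) \<le> M"
proof -
  obtain a b where l: "l = (a, b)" "a \<in> E" using assms by (cases l) auto
  obtain M where M: "\<And>p. p \<in> univ_seminorms E R \<Longrightarrow> p (free_gen a) \<le> M"
    using gen_bounded[OF l(2)] by blast
  have adj: "Poly_Mapping.single (Word [(a, True)]) 1 = free_adj (free_gen a)"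
    by (simp add: free_gen_def free_adj_single word_adj_def)
  have "p (Poly_Mapping.single (Word [l]) 1) \<le> max M 0" if pm: "p \<in> univ_seminorms E R" for p
  proof -
    interpret seminormed E p using pm by (rule univ_seminorms_D)
    show ?thesis using M[OF pm] l p_adj[of "free_gen a"] adj
      by (cases b) (auto simp: free_gen_def[symmetric])
  qed
  then show ?thesis by (intro exI[of _ "max M 0"]) auto
qed

lemma word_bounded:
  assumes "fst ` set ls \<subseteq> E"
  shows "\<exists>M\<ge>0. \<forall>p\<in>univ_seminorms E R. p (Poly_Mapping.single (Word ls) 1) \<le> M"
  using assms
proof (induction ls)
  case Nil
  have "p (Poly_Mapping.single (Word []) 1) \<le> 1" if "p \<in> univ_seminorms E R" for p
  proof -
    interpret seminormed E p using that by (rule univ_seminorms_D)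
    show ?thesis using p_1 by (simp add: zero_star_word_def[symmetric])
  qed
  then show ?case by (intro exI[of _ 1]) auto
next
  case (Cons l ls)
  obtain M where M: "M \<ge> 0" "\<And>p. p \<in> univ_seminorms E R \<Longrightarrow> p (Poly_Mapping.single (Word [l]) 1) \<le> M"
    using letter_bounded[of l] Cons.prems by auto
  obtain K where K: "K \<ge> 0" "\<And>p. p \<in> univ_seminorms E R \<Longrightarrow> p (Poly_Mapping.single (Word ls) 1) \<le> K"
    using Cons by auto
  have "p (Poly_Mapping.single (Word (l # ls)) 1) \<le> M * K" if pm: "p \<in> univ_seminorms E R" for p
  proof -
    interpret seminormed E p using pm by (rule univ_seminorms_D)
    have eq: "Poly_Mapping.single (Word (l # ls)) 1
        = Poly_Mapping.single (Word [l]) 1 * Poly_Mapping.single (Word ls) (1::complex)"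
      by (simp add: mult_single plus_star_word_def)
    have F: "Poly_Mapping.single (Word [l]) 1 \<in> F" "Poly_Mapping.single (Word ls) 1 \<in> F"
      using Cons.prems by (auto simp: free_alg_iff words_def)
    show ?thesis unfolding eq
      by (rule order_trans[OF p_mult[OF F] mult_mono[OF M(2)[OF pm] K(2)[OF pm] M(1) p_nonneg[OF F(2)]]])
  qed
  then show ?case using M(1) K(1) by (intro exI[of _ "M * K"]) auto
qed

lemma bounded: assumes "x \<in> free_alg E" shows "\<exists>M. \<forall>p\<in>univ_seminorms E R. p x \<le> M"
  using assms
proof (induction x rule: free_induct)
  case (single w c)
  obtain M where M: "\<And>p. p \<in> univ_seminorms E R \<Longrightarrow> p (Poly_Mapping.single w 1) \<le> M"
    using word_bounded[of "letters w"] single by (auto simp: words_def)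
  have "p (Poly_Mapping.single w c) \<le> cmod c * M" if pm: "p \<in> univ_seminorms E R" for p
  proof -
    interpret seminormed E p using pm by (rule univ_seminorms_D)
    have eq: "Poly_Mapping.single w c = free_scal c (Poly_Mapping.single w 1)"
      by (rule poly_mapping_eqI) (simp add: lookup_single when_def)
    show ?thesis
      unfolding eq p_scal[OF free_alg_single[OF single]] by (rule mult_left_mono[OF M[OF pm]]) simp
  qed
  then show ?case by blast
next
  case (add x y)
  obtain M where M: "\<And>p. p \<in> univ_seminorms E R \<Longrightarrow> p x \<le> M" using add by blast
  obtain K where K: "\<And>p. p \<in> univ_seminorms E R \<Longrightarrow> p y \<le> K" using add by blast
  have "p (x + y) \<le> M + K" if pm: "p \<in> univ_seminorms E R" for p
    using M[OF pm] K[OF pm] seminormed.p_add[OF univ_seminorms_D[OF pm] add.hyps] by linarith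
  then show ?case by blast
qed

abbreviation N where "N \<equiv> univ_norm E R"

lemma zero_mem: "(\<lambda>x. 0) \<in> univ_seminorms E R"
  using seminormed_zero[of E] by (simp add: univ_seminorms_def seminormed_def)

lemma N_upper: "p \<in> univ_seminorms E R \<Longrightarrow> x \<in> free_alg E \<Longrightarrow> p x \<le> N x"
  unfolding univ_norm_def using bounded[of x] by (intro cSUP_upper) (auto simp: bdd_above_def)

lemma N_least: "(\<And>p. p \<in> univ_seminorms E R \<Longrightarrow> p x \<le> M) \<Longrightarrow> N x \<le> M"
  unfolding univ_norm_def using zero_mem by (intro cSUP_least) auto

lemma N_nonneg: "x \<in> free_alg E \<Longrightarrow> 0 \<le> N x"
  using N_upper[OF zero_mem] by simp

lemma N_seminorm: "cstar_seminorm E N"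
  unfolding cstar_seminorm_def
proof (intro conjI ballI allI)
  fix x y :: "'e free_star" assume xy: "x \<in> free_alg E" "y \<in> free_alg E"
  show "N (x + y) \<le> N x + N y"
    using seminormed.p_add[OF univ_seminorms_D xy] N_upper xy
    by (intro N_least) (meson add_mono order_trans)
  show "N (x * y) \<le> N x * N y"
    using seminormed.p_mult[OF univ_seminorms_D xy] N_upper xy seminormed.p_nonneg[OF univ_seminorms_D] N_nonneg
    by (intro N_least) (meson mult_mono order_trans)
next
  fix x :: "'e free_star" and c assume x: "x \<in> free_alg E"
  have le: "N (free_scal c x) \<le> cmod c * N x" if "x \<in> free_alg E" for c x
  proof (rule N_least)
    fix p assume pm: "p \<in> univ_seminorms E R"
    show "p (free_scal c x) \<le> cmod c * N x"
      using seminormed.p_scal[OF univ_seminorms_D[OF pm] that, of c] N_upper[OF pm that]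
      by (simp add: mult_left_mono)
  qed
  show "N (free_scal c x) = cmod c * N x"
  proof (cases "c = 0")
    case False
    have "cmod c * N x \<le> N (free_scal c x)"
      using le[of "free_scal c x" "inverse c"] x False
      by (simp add: free_scal_scal norm_inverse norm_divide divide_simps mult.commute)
    with le[OF x, of c] show ?thesis by simp
  qed (use le[OF x, of 0] N_nonneg[of 0] in simp)
next
  fix x :: "'e free_star" assume x: "x \<in> free_alg E"
  have "N (free_adj x * x) \<le> (N x)\<^sup>2"
  proof (rule N_least)
    fix p assume pm: "p \<in> univ_seminorms E R"
    interpret seminormed E p using pm by (rule univ_seminorms_D)
    show "p (free_adj x * x) \<le> (N x)\<^sup>2"
      using p_cstar[OF x] N_upper[OF pm x] p_nonneg[OF x] by (simp add: power_mono)
  qed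
  moreover have "N x \<le> sqrt (N (free_adj x * x))"
  proof (rule N_least)
    fix p assume pm: "p \<in> univ_seminorms E R"
    interpret seminormed E p using pm by (rule univ_seminorms_D)
    show "p x \<le> sqrt (N (free_adj x * x))"
      using p_cstar[OF x] N_upper[OF pm, of "free_adj x * x"] x by (intro real_le_rsqrt) simp
  qed
  then have "(N x)\<^sup>2 \<le> N (free_adj x * x)"
    using N_nonneg[OF x] N_nonneg[of "free_adj x * x"] x
    by (metis free_alg_adj free_alg_mult power_mono real_sqrt_pow2)
  ultimately show "N (free_adj x * x) = (N x)\<^sup>2" by simp
qed

sublocale seminormed E N by unfold_locales (rule N_seminorm)

lemma N_rel: "r \<in> R \<Longrightarrow> r \<in> free_alg E \<Longrightarrow> N r = 0"
  using N_nonneg[of r] by (intro antisym[OF N_least]) (auto simp: univ_seminorms_def)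

end


context cstar_algebra
begin

lemma scal_0 [simp]: "x \<in> carrier A \<Longrightarrow> scal A 0 x = \<zero>"
  using nrm_scal[of x 0] nrm_eq_0_iff[of "scal A 0 x"] scal_closed[of x 0] by simp

lemma nrm_zero [simp]: "nrm A \<zero> = 0" using nrm_eq_0_iff[of \<zero>] by simp

lemma scal_zero [simp]: "scal A c \<zero> = \<zero>"
  using nrm_scal[of \<zero> c] nrm_eq_0_iff[of "scal A c \<zero>"] scal_closed[of \<zero> c] by simp

lemma a_inv_scal: "x \<in> carrier A \<Longrightarrow> \<ominus> x = scal A (-1) x"
proof (rule minus_equality)
  assume x: "x \<in> carrier A"
  show "scal A (-1) x \<oplus> x = \<zero>"
    using scal_add_left[OF x, of "-1" 1] x by (simp add: scal_one)
qed (auto intro: scal_closed)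

lemma nrm_a_inv: "x \<in> carrier A \<Longrightarrow> nrm A (\<ominus> x) = nrm A x"
  by (simp add: a_inv_scal nrm_scal)

lemma nrm_nonneg: "x \<in> carrier A \<Longrightarrow> 0 \<le> nrm A x"
  using nrm_add[of x "\<ominus> x"] by (simp add: r_neg nrm_a_inv)

lemma minus_add_minus: "x \<in> carrier A \<Longrightarrow> y \<in> carrier A \<Longrightarrow> z \<in> carrier A \<Longrightarrow> x \<ominus> z = (x \<ominus> y) \<oplus> (y \<ominus> z)"
  by (simp add: a_minus_def a_assoc) (metis a_assoc a_inv_closed add.l_inv_ex l_neg l_zero)

lemma nrm_triangle:
  "x \<in> carrier A \<Longrightarrow> y \<in> carrier A \<Longrightarrow> z \<in> carrier A \<Longrightarrow> nrm A (x \<ominus> z) \<le> nrm A (x \<ominus> y) + nrm A (y \<ominus> z)"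
  using nrm_add[of "x \<ominus> y" "y \<ominus> z"] by (simp add: minus_add_minus[of x y z])

lemma nrm_minus_commute: "x \<in> carrier A \<Longrightarrow> y \<in> carrier A \<Longrightarrow> nrm A (x \<ominus> y) = nrm A (y \<ominus> x)"
  using nrm_a_inv[of "x \<ominus> y"] by (simp add: minus_add a_minus_def a_comm)

lemma nrm_minus_0: "x \<in> carrier A \<Longrightarrow> y \<in> carrier A \<Longrightarrow> nrm A (x \<ominus> y) = 0 \<longleftrightarrow> x = y"
  using nrm_eq_0_iff[of "x \<ominus> y"] by (metis a_minus_def a_inv_closed add.inv_solve_right l_zero minus_closed r_neg zero_closed)

lemma nrm_rev: "x \<in> carrier A \<Longrightarrow> y \<in> carrier A \<Longrightarrow> nrm A x \<le> nrm A y + nrm A (x \<ominus> y)"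
  using nrm_triangle[of x y \<zero>] by (simp add: a_minus_def)

lemma nrm_adj: assumes "x \<in> carrier A" shows "nrm A (adj A x) = nrm A x"
proof -
  have *: "nrm A y \<le> nrm A (adj A y)" if "y \<in> carrier A" for y
  proof (cases "nrm A y = 0")
    case False
    have "nrm A y * nrm A y \<le> nrm A (adj A y) * nrm A y"
      using nrm_adj_mult[OF that] nrm_mult[of "adj A y" y] that adj_closed by (simp add: power2_eq_square)
    moreover have "nrm A y > 0" using nrm_nonneg[OF that] False by simp
    ultimately show ?thesis by simp
  qed (use that adj_closed nrm_nonneg in auto)
  show ?thesis using *[of x] *[of "adj A x"] assms by (simp add: adj_closed adj_adj)
qed

lemma adj_zero [simp]: "adj A \<zero> = \<zero>"
  using nrm_adj[of \<zero>] nrm_eq_0_iff[of "adj A \<zero>"] adj_closed[of \<zero>] by simp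

lemma adj_one [simp]: "adj A \<one> = \<one>"
proof -
  have "adj A (adj A \<one> \<otimes> \<one>) = adj A \<one> \<otimes> adj A (adj A \<one>)"
    by (rule adj_mult) (simp_all add: adj_closed)
  then show ?thesis by (simp add: adj_closed adj_adj)
qed

definition lim_to :: "(nat \<Rightarrow> 'a) \<Rightarrow> 'a \<Rightarrow> bool" where
  "lim_to X x \<longleftrightarrow> (\<lambda>n. nrm A (X n \<ominus> x)) \<longlonglongrightarrow> 0"

lemma lim_toI:
  assumes "\<And>n. X n \<in> carrier A" "x \<in> carrier A" "\<And>n. nrm A (X n \<ominus> x) \<le> f n" "f \<longlonglongrightarrow> 0"
  shows "lim_to X x"
  unfolding lim_to_def
  by (rule tendsto_sandwich[OF _ _ tendsto_const assms(4)])
    (use assms in \<open>auto intro!: always_eventually nrm_nonneg\<close>)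

lemma lim_to_unique:
  assumes "\<And>n. X n \<in> carrier A" "x \<in> carrier A" "y \<in> carrier A" "lim_to X x" "lim_to X y"
  shows "x = y"
proof -
  have "(\<lambda>n. nrm A (X n \<ominus> x) + nrm A (X n \<ominus> y)) \<longlonglongrightarrow> 0 + 0"
    using assms(4,5) unfolding lim_to_def by (rule tendsto_add)
  then have "nrm A (x \<ominus> y) \<le> 0"
    using nrm_triangle[of x _ y] nrm_minus_commute[of x] assms(1-3)
    by (intro LIMSEQ_le_const) auto
  then show ?thesis using nrm_minus_0[of x y] nrm_nonneg[of "x \<ominus> y"] assms by simp
qed

lemma lim_to_add:
  assumes "\<And>n. X n \<in> carrier A" "\<And>n. Y n \<in> carrier A" "x \<in> carrier A" "y \<in> carrier A" "lim_to X x" "lim_to Y y"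
  shows "lim_to (\<lambda>n. X n \<oplus> Y n) (x \<oplus> y)"
proof (rule lim_toI)
  show "(\<lambda>n. nrm A (X n \<ominus> x) + nrm A (Y n \<ominus> y)) \<longlonglongrightarrow> 0"
    using tendsto_add[OF assms(5,6)[unfolded lim_to_def]] by simp
  show "nrm A (X n \<oplus> Y n \<ominus> (x \<oplus> y)) \<le> nrm A (X n \<ominus> x) + nrm A (Y n \<ominus> y)" for n
  proof -
    have "X n \<oplus> Y n \<ominus> (x \<oplus> y) = (X n \<ominus> x) \<oplus> (Y n \<ominus> y)"
      using assms(1)[of n] assms(2)[of n] assms(3,4) by (simp add: a_minus_def minus_add a_ac)
    then show ?thesis using nrm_add[of "X n \<ominus> x" "Y n \<ominus> y"] assms by simp
  qed
qed (use assms in auto)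

lemma lim_to_scal:
  assumes "\<And>n. X n \<in> carrier A" "x \<in> carrier A" "lim_to X x"
  shows "lim_to (\<lambda>n. scal A c (X n)) (scal A c x)"
proof (rule lim_toI)
  show "(\<lambda>n. cmod c * nrm A (X n \<ominus> x)) \<longlonglongrightarrow> 0"
    using tendsto_mult[OF tendsto_const[of "cmod c"] assms(3)[unfolded lim_to_def]] by simp
  show "nrm A (scal A c (X n) \<ominus> scal A c x) \<le> cmod c * nrm A (X n \<ominus> x)" for n
  proof -
    have "scal A c (X n) \<ominus> scal A c x = scal A c (X n \<ominus> x)"
      using assms(1)[of n] assms(2) by (simp add: a_minus_def a_inv_scal scal_add_right scal_scal scal_closed)
    then show ?thesis using assms by (simp add: nrm_scal)
  qed
qed (use assms scal_closed in auto)

lemma lim_to_adj: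
  assumes "\<And>n. X n \<in> carrier A" "x \<in> carrier A" "lim_to X x"
  shows "lim_to (\<lambda>n. adj A (X n)) (adj A x)"
proof (rule lim_toI)
  show "(\<lambda>n. nrm A (X n \<ominus> x)) \<longlonglongrightarrow> 0" using assms(3) by (simp add: lim_to_def)
  show "nrm A (adj A (X n) \<ominus> adj A x) \<le> nrm A (X n \<ominus> x)" for n
  proof -
    have "adj A (X n) \<ominus> adj A x = adj A (X n \<ominus> x)"
      using assms(1)[of n] assms(2) by (simp add: a_minus_def a_inv_scal adj_add adj_scal scal_closed adj_closed)
    then show ?thesis using assms by (simp add: nrm_adj)
  qed
qed (use assms adj_closed in auto)

lemma lim_to_nrm:
  assumes "\<And>n. X n \<in> carrier A" "x \<in> carrier A" "lim_to X x"
  shows "(\<lambda>n. nrm A (X n)) \<longlonglongrightarrow> nrm A x"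
proof -
  have "\<bar>nrm A (X n) - nrm A x\<bar> \<le> nrm A (X n \<ominus> x)" for n
    using nrm_rev[OF assms(1)[of n] assms(2)] nrm_rev[OF assms(2) assms(1)[of n]]
      nrm_minus_commute[OF assms(2) assms(1)[of n]] by linarith
  then have "(\<lambda>n. nrm A (X n) - nrm A x) \<longlonglongrightarrow> 0"
    by - (rule tendsto_rabs_zero_cancel,
      rule tendsto_sandwich[OF _ _ tendsto_const assms(3)[unfolded lim_to_def]],
      auto intro!: always_eventually)
  from tendsto_add[OF this tendsto_const[of "nrm A x"]] show ?thesis by simp
qed

lemma lim_to_mult:
  assumes "\<And>n. X n \<in> carrier A" "\<And>n. Y n \<in> carrier A" "x \<in> carrier A" "y \<in> carrier A" "lim_to X x" "lim_to Y y"
  shows "lim_to (\<lambda>n. X n \<otimes> Y n) (x \<otimes> y)"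
proof (rule lim_toI)
  have "(\<lambda>n. nrm A (X n) * nrm A (Y n \<ominus> y) + nrm A (X n \<ominus> x) * nrm A y) \<longlonglongrightarrow> nrm A x * 0 + 0 * nrm A y"
    using assms(5,6) lim_to_nrm[OF assms(1,3,5)] unfolding lim_to_def by (intro tendsto_intros)
  then show "(\<lambda>n. nrm A (X n) * nrm A (Y n \<ominus> y) + nrm A (X n \<ominus> x) * nrm A y) \<longlonglongrightarrow> 0" by simp
  show "nrm A (X n \<otimes> Y n \<ominus> x \<otimes> y) \<le> nrm A (X n) * nrm A (Y n \<ominus> y) + nrm A (X n \<ominus> x) * nrm A y" for n
  proof -
    note c = assms(1)[of n] assms(2)[of n] assms(3,4)
    have "X n \<otimes> (Y n \<ominus> y) = X n \<otimes> Y n \<ominus> X n \<otimes> y" "(X n \<ominus> x) \<otimes> y = X n \<otimes> y \<ominus> x \<otimes> y"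
      using c by (simp_all add: a_minus_def r_distr l_distr r_minus l_minus)
    then have "X n \<otimes> Y n \<ominus> x \<otimes> y = X n \<otimes> (Y n \<ominus> y) \<oplus> (X n \<ominus> x) \<otimes> y"
      using c minus_add_minus[of "X n \<otimes> Y n" "X n \<otimes> y" "x \<otimes> y"] by simp
    then show ?thesis
      using c nrm_add[of "X n \<otimes> (Y n \<ominus> y)" "(X n \<ominus> x) \<otimes> y"]
        nrm_mult[of "X n" "Y n \<ominus> y"] nrm_mult[of "X n \<ominus> x" y] by simp
  qed
qed (use assms in auto)

end


section \<open>Evaluation in a C*-algebra and its extension to the completion\<close>

lemma star_homD:
  assumes "star_hom A B f"
  shows "x \<in> carrier A \<Longrightarrow> f x \<in> carrier B"
    and "x \<in> carrier A \<Longrightarrow> y \<in> carrier A \<Longrightarrow> f (x \<oplus>\<^bsub>A\<^esub> y) = f x \<oplus>\<^bsub>B\<^esub> f y"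
    and "x \<in> carrier A \<Longrightarrow> y \<in> carrier A \<Longrightarrow> f (x \<otimes>\<^bsub>A\<^esub> y) = f x \<otimes>\<^bsub>B\<^esub> f y"
    and "f \<one>\<^bsub>A\<^esub> = \<one>\<^bsub>B\<^esub>"
    and "x \<in> carrier A \<Longrightarrow> f (scal A c x) = scal B c (f x)"
    and "x \<in> carrier A \<Longrightarrow> f (adj A x) = adj B (f x)"
  using assms by (auto simp: star_hom_def ring_hom_closed ring_hom_add ring_hom_mult ring_hom_one)

lemma star_hom_minus:
  assumes "star_hom A B f" "cstar_algebra A" "cstar_algebra B" "x \<in> carrier A" "y \<in> carrier A"
  shows "f (x \<ominus>\<^bsub>A\<^esub> y) = f x \<ominus>\<^bsub>B\<^esub> f y"
proof -
  interpret A: cstar_algebra A by fact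
  interpret B: cstar_algebra B by fact
  note h = star_homD[OF assms(1)]
  show ?thesis using assms(4,5)
    by (simp add: a_minus_def A.a_inv_scal B.a_inv_scal h A.scal_closed)
qed

context cstar_algebra
begin

definition word_eval :: "('e \<Rightarrow> 'a) \<Rightarrow> 'e star_word \<Rightarrow> 'a" where
  "word_eval T w = foldr (\<lambda>(a, b) x. (if b then adj A (T a) else T a) \<otimes> x) (letters w) \<one>"

definition free_eval :: "('e \<Rightarrow> 'a) \<Rightarrow> 'e free_star \<Rightarrow> 'a" where
  "free_eval T x = (\<Oplus>w\<in>Poly_Mapping.keys x. scal A (Poly_Mapping.lookup x w) (word_eval T w))"

lemma word_eval_0 [simp]: "word_eval T 0 = \<one>"
  by (simp add: word_eval_def zero_star_word_def)

context
  fixes E :: "'e set" and T assumes T: "T \<in> E \<rightarrow> carrier A"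
begin

lemma letter_closed: "a \<in> E \<Longrightarrow> (if b then adj A (T a) else T a) \<in> carrier A"
  using T by (auto intro: adj_closed)

lemma word_eval_closed: assumes "w \<in> words E" shows "word_eval T w \<in> carrier A"
proof -
  have "fst ` set ls \<subseteq> E \<Longrightarrow> word_eval T (Word ls) \<in> carrier A" for ls
    by (induction ls) (use letter_closed in \<open>auto simp: word_eval_def simp del: if_split\<close>)
  from this[of "letters w"] assms show ?thesis by (simp add: words_def)
qed

lemma word_eval_add:
  assumes "v \<in> words E" "w \<in> words E"
  shows "word_eval T (v + w) = word_eval T v \<otimes> word_eval T w"
proof -
  have "fst ` set ls \<subseteq> E \<Longrightarrow> word_eval T (Word (ls @ letters w)) = word_eval T (Word ls) \<otimes> word_eval T w" for ls
  proof (induction ls)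
    case Nil then show ?case using word_eval_closed[OF assms(2)] by (simp add: word_eval_def)
  next
    case (Cons l ls)
    obtain a b where l: "l = (a, b)" by (cases l)
    have "word_eval T (Word ls) \<in> carrier A" using Cons.prems by (intro word_eval_closed) (auto simp: words_def)
    then have *: "(if b then adj A (T a) else T a) \<otimes> (word_eval T (Word ls) \<otimes> word_eval T w)
        = (if b then adj A (T a) else T a) \<otimes> word_eval T (Word ls) \<otimes> word_eval T w"
      using word_eval_closed[OF assms(2)] letter_closed[of a b] Cons.prems l
      by (intro m_assoc[symmetric]) auto
    have "word_eval T (Word (l # zs)) = (if b then adj A (T a) else T a) \<otimes> word_eval T (Word zs)" for zs
      by (simp add: word_eval_def l)
    then show ?case using Cons * by simp
  qed
  from this[of "letters v"] assms show ?thesis by (simp add: words_def plus_star_word_def)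
qed

lemma word_eval_single: "a \<in> E \<Longrightarrow> word_eval T (Word [(a, b)]) = (if b then adj A (T a) else T a)"
  using letter_closed[of a b] by (simp add: word_eval_def)

lemma word_eval_adj:
  assumes "w \<in> words E" shows "word_eval T (word_adj w) = adj A (word_eval T w)"
proof -
  have "fst ` set ls \<subseteq> E \<Longrightarrow> word_eval T (word_adj (Word ls)) = adj A (word_eval T (Word ls))" for ls
  proof (induction ls)
    case Nil then show ?case by (simp add: word_eval_def word_adj_def)
  next
    case (Cons l ls)
    obtain a b where l: "l = (a, b)" by (cases l)
    have aE: "a \<in> E" using Cons.prems l by auto
    have W: "Word [l] \<in> words E" "Word ls \<in> words E" "Word [(a, \<not> b)] \<in> words E"
      using Cons.prems l by (auto simp: words_def)
    have eq: "Word (l # ls) = Word [l] + Word ls" by (simp add: plus_star_word_def)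
    have "word_adj (Word [l]) = Word [(a, \<not> b)]" by (simp add: word_adj_def l)
    moreover have "word_eval T (Word [(a, \<not> b)]) = adj A (word_eval T (Word [l]))"
      using T aE by (cases b) (auto simp: word_eval_single l adj_adj Pi_iff)
    ultimately show ?case
      using Cons W by (simp add: eq word_adj_add word_eval_add adj_mult word_eval_closed)
  qed
  from this[of "letters w"] assms show ?thesis by (simp add: words_def)
qed

lemma free_eval_superset:
  assumes "finite K" "Poly_Mapping.keys x \<subseteq> K" "K \<subseteq> words E"
  shows "free_eval T x = (\<Oplus>w\<in>K. scal A (Poly_Mapping.lookup x w) (word_eval T w))"
  unfolding free_eval_def
  by (rule add.finprod_mono_neutral_cong_left[OF assms(1,2)])
    (use assms(3) in \<open>auto simp: in_keys_iff word_eval_closed subset_iff intro!: scal_closed\<close>)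

lemma free_eval_closed: "x \<in> free_alg E \<Longrightarrow> free_eval T x \<in> carrier A"
  unfolding free_eval_def free_alg_iff
  by (intro finsum_closed) (auto intro!: scal_closed word_eval_closed)

lemma free_eval_add:
  assumes "x \<in> free_alg E" "y \<in> free_alg E"
  shows "free_eval T (x + y) = free_eval T x \<oplus> free_eval T y"
proof -
  define K where "K = Poly_Mapping.keys x \<union> Poly_Mapping.keys y"
  have K: "finite K" "Poly_Mapping.keys x \<subseteq> K" "Poly_Mapping.keys y \<subseteq> K" "Poly_Mapping.keys (x + y) \<subseteq> K"
      "K \<subseteq> words E"
    using assms Poly_Mapping.keys_add[of x y] by (auto simp: K_def free_alg_iff)
  have c: "w \<in> K \<Longrightarrow> word_eval T w \<in> carrier A" for w using K(5) by (auto intro: word_eval_closed)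
  have "free_eval T (x + y) = (\<Oplus>w\<in>K. scal A (Poly_Mapping.lookup x w) (word_eval T w)
      \<oplus> scal A (Poly_Mapping.lookup y w) (word_eval T w))"
    unfolding free_eval_superset[OF K(1,4,5)]
    by (rule finsum_cong') (use c in \<open>auto simp: lookup_add scal_add_left intro!: scal_closed\<close>)
  also have "\<dots> = free_eval T x \<oplus> free_eval T y"
    unfolding free_eval_superset[OF K(1,2,5)] free_eval_superset[OF K(1,3,5)]
    by (rule finsum_addf) (use c in \<open>auto intro!: scal_closed\<close>)
  finally show ?thesis .
qed

lemma free_eval_single:
  assumes "w \<in> words E" shows "free_eval T (Poly_Mapping.single w c) = scal A c (word_eval T w)"
  using free_eval_superset[of "{w}" "Poly_Mapping.single w c"] assms
  by (simp add: word_eval_closed scal_closed)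

lemma free_eval_scal: assumes "x \<in> free_alg E" shows "free_eval T (free_scal c x) = scal A c (free_eval T x)"
  using assms
proof (induction x rule: free_induct)
  case (single w d)
  then show ?case by (simp add: free_eval_single scal_scal word_eval_closed)
qed (simp add: free_scal_add free_eval_add free_eval_closed scal_add_right)

lemma free_eval_adj: assumes "x \<in> free_alg E" shows "free_eval T (free_adj x) = adj A (free_eval T x)"
  using assms
proof (induction x rule: free_induct)
  case (single w d)
  then show ?case
    by (simp add: free_adj_single free_eval_single adj_scal word_eval_closed word_eval_adj)
qed (simp add: free_adj_add free_eval_add free_eval_closed adj_add)

lemma free_eval_mult:
  assumes "x \<in> free_alg E" "y \<in> free_alg E"
  shows "free_eval T (x * y) = free_eval T x \<otimes> free_eval T y"
  using assms
proof (induction x rule: free_induct)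
  case (single v c)
  note v = single(1)
  from \<open>y \<in> free_alg E\<close> show ?case
  proof (induction y rule: free_induct)
    case (single w d)
    then show ?case using v
      by (simp add: mult_single free_eval_single word_eval_add scal_mult_left scal_mult_right scal_scal
          word_eval_closed scal_closed mult.commute)
  qed (use v in \<open>simp add: distrib_left free_eval_add free_eval_closed free_alg_single r_distr\<close>)
qed (simp add: distrib_right free_eval_add free_eval_closed l_distr)

lemma free_eval_1 [simp]: "free_eval T 1 = \<one>"
  using free_eval_single[of 0 1] by (simp add: scal_one)

lemma free_eval_0 [simp]: "free_eval T 0 = \<zero>" by (simp add: free_eval_def)

lemma free_eval_gen: "a \<in> E \<Longrightarrow> free_eval T (free_gen a) = T a"
  using T by (auto simp: free_gen_def free_eval_single words_def word_eval_single scal_one Pi_iff)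

lemma free_eval_uminus: "x \<in> free_alg E \<Longrightarrow> free_eval T (- x) = \<ominus> free_eval T x"
  using free_eval_scal[of x "-1"] by (simp add: free_scal_m1 a_inv_scal free_eval_closed)

lemma free_eval_diff:
  "x \<in> free_alg E \<Longrightarrow> y \<in> free_alg E \<Longrightarrow> free_eval T (x - y) = free_eval T x \<ominus> free_eval T y"
  using free_eval_add[of x "- y"] by (simp add: free_eval_uminus a_minus_def)

lemma free_eval_sum:
  "(\<And>i. i \<in> I \<Longrightarrow> f i \<in> free_alg E) \<Longrightarrow> free_eval T (sum f I) = (\<Oplus>i\<in>I. free_eval T (f i))"
  by (induction I rule: infinite_finite_induct) (auto simp: free_eval_add free_eval_closed)

lemma nrm_free_eval_seminorm: "cstar_seminorm E (\<lambda>x. nrm A (free_eval T x))"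
  unfolding cstar_seminorm_def
  by (auto simp: free_eval_add free_eval_mult free_eval_scal free_eval_adj free_eval_closed
      nrm_add nrm_mult nrm_scal nrm_adj_mult)

end

end


locale cstar_extension = seminormed E p + B: cstar_algebra B
  for E :: "'e set" and p and B :: "'b cstar" +
  fixes T :: "'e \<Rightarrow> 'b"
  assumes T: "T \<in> E \<rightarrow> carrier B"
    and eval_le: "x \<in> free_alg E \<Longrightarrow> nrm B (B.free_eval T x) \<le> p x"
begin

abbreviation ev where "ev \<equiv> B.free_eval T"

lemmas ev_simps = B.free_eval_add[OF T] B.free_eval_mult[OF T] B.free_eval_scal[OF T]
  B.free_eval_adj[OF T] B.free_eval_1[OF T] B.free_eval_diff[OF T] B.free_eval_gen[OF T]

lemma ev_closed [simp]: "x \<in> F \<Longrightarrow> ev x \<in> carrier B" by (rule B.free_eval_closed[OF T])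

lemma ev_limit:
  assumes x: "x \<in> carrier CR" shows "\<exists>b\<in>carrier B. B.lim_to (\<lambda>n. ev (x n)) b"
  unfolding B.lim_to_def
proof (rule B.complete)
  fix e :: real assume "e > 0"
  then obtain N where N: "\<forall>i\<ge>N. \<forall>j\<ge>N. p (x i - x j) < e" using CR_D[OF x] by blast
  have "nrm B (ev (x i) \<ominus>\<^bsub>B\<^esub> ev (x j)) \<le> p (x i - x j)" for i j
    using eval_le[of "x i - x j"] x by (simp add: ev_simps)
  then show "\<exists>N. \<forall>i\<ge>N. \<forall>j\<ge>N. nrm B (ev (x i) \<ominus>\<^bsub>B\<^esub> ev (x j)) < e"
    using N by (meson order_le_less_trans)
qed (use x in simp)

definition ext where
  "ext X = (THE b. b \<in> carrier B \<and> (\<exists>x\<in>carrier CR. X = cls x \<and> B.lim_to (\<lambda>n. ev (x n)) b))"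

lemma ev_limit_cong:
  assumes "x \<in> carrier CR" "y \<in> carrier CR" "cls x = cls y" "b \<in> carrier B" "B.lim_to (\<lambda>n. ev (x n)) b"
  shows "B.lim_to (\<lambda>n. ev (y n)) b"
proof (rule B.lim_toI)
  have "(\<lambda>n. y n - x n) \<in> NS" using assms(1-3) cls_eq_iff[of y x] by simp
  from tendsto_add[OF NS_tendsto[OF this] assms(5)[unfolded B.lim_to_def]]
  show "(\<lambda>n. p (y n - x n) + nrm B (ev (x n) \<ominus>\<^bsub>B\<^esub> b)) \<longlonglongrightarrow> 0" by simp
  show "nrm B (ev (y n) \<ominus>\<^bsub>B\<^esub> b) \<le> p (y n - x n) + nrm B (ev (x n) \<ominus>\<^bsub>B\<^esub> b)" for n
    using B.nrm_triangle[of "ev (y n)" "ev (x n)" b] eval_le[of "y n - x n"] assms(1,2,4)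
    by (simp add: ev_simps)
qed (use assms in auto)

lemma ext_eq:
  assumes "x \<in> carrier CR" "b \<in> carrier B" "B.lim_to (\<lambda>n. ev (x n)) b" shows "ext (cls x) = b"
  unfolding ext_def
proof (rule the_equality)
  fix c assume "c \<in> carrier B \<and> (\<exists>y\<in>carrier CR. cls x = cls y \<and> B.lim_to (\<lambda>n. ev (y n)) c)"
  then obtain y where y: "c \<in> carrier B" "y \<in> carrier CR" "cls x = cls y" "B.lim_to (\<lambda>n. ev (y n)) c" by blast
  have "B.lim_to (\<lambda>n. ev (x n)) c" using ev_limit_cong[OF y(2) assms(1) y(3)[symmetric] y(1,4)] .
  then show "c = b" using assms y(1) by (intro B.lim_to_unique[of "\<lambda>n. ev (x n)"]) auto
qed (use assms in blast)

lemma ext_lim: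
  assumes "x \<in> carrier CR" shows "ext (cls x) \<in> carrier B" "B.lim_to (\<lambda>n. ev (x n)) (ext (cls x))"
  using ev_limit[OF assms] ext_eq[OF assms] by auto

lemma ext_const: assumes "a \<in> F" shows "ext (cls (\<lambda>n. a)) = ev a"
proof (rule ext_eq)
  have "nrm B (ev a \<ominus>\<^bsub>B\<^esub> ev a) = 0" using B.nrm_minus_0[of "ev a" "ev a"] assms by simp
  then show "B.lim_to (\<lambda>n. ev a) (ev a)" by (simp add: B.lim_to_def)
qed (use assms in auto)

lemma star_hom_ext: "star_hom C B ext"
  unfolding star_hom_def
proof (intro conjI ballI allI)
  show "ext \<in> Ring.ring_hom C B"
  proof (rule ring_hom_memI)
    show "ext x \<in> carrier B" if "x \<in> carrier C" for x
      using that ext_lim by (auto simp: C_carrier)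
    show "ext (x \<otimes>\<^bsub>C\<^esub> y) = ext x \<otimes>\<^bsub>B\<^esub> ext y" if "x \<in> carrier C" "y \<in> carrier C" for x y
    proof -
      obtain x' y' where *: "x = cls x'" "y = cls y'" "x' \<in> carrier CR" "y' \<in> carrier CR"
        using \<open>x \<in> carrier C\<close> \<open>y \<in> carrier C\<close> by (auto simp: C_carrier)
      have "B.lim_to (\<lambda>n. ev (x' n) \<otimes>\<^bsub>B\<^esub> ev (y' n)) (ext x \<otimes>\<^bsub>B\<^esub> ext y)"
        unfolding * by (rule B.lim_to_mult) (use * ext_lim in auto)
      then show ?thesis unfolding *(1,2) C_mult[OF *(3,4)]
        using * ext_lim by (intro ext_eq) (auto simp: ev_simps)
    qed
    show "ext (x \<oplus>\<^bsub>C\<^esub> y) = ext x \<oplus>\<^bsub>B\<^esub> ext y" if "x \<in> carrier C" "y \<in> carrier C" for x y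
    proof -
      obtain x' y' where *: "x = cls x'" "y = cls y'" "x' \<in> carrier CR" "y' \<in> carrier CR"
        using \<open>x \<in> carrier C\<close> \<open>y \<in> carrier C\<close> by (auto simp: C_carrier)
      have "B.lim_to (\<lambda>n. ev (x' n) \<oplus>\<^bsub>B\<^esub> ev (y' n)) (ext x \<oplus>\<^bsub>B\<^esub> ext y)"
        unfolding * by (rule B.lim_to_add) (use * ext_lim in auto)
      then show ?thesis unfolding *(1,2) C_add[OF *(3,4)]
        using * ext_lim by (intro ext_eq) (auto simp: ev_simps)
    qed
    show "ext \<one>\<^bsub>C\<^esub> = \<one>\<^bsub>B\<^esub>" using ext_const[of 1] by (simp add: C_one ev_simps)
  qed
next
  fix x c assume "x \<in> carrier C"
  then obtain x' where *: "x = cls x'" "x' \<in> carrier CR" by (auto simp: C_carrier)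
  have "B.lim_to (\<lambda>n. scal B c (ev (x' n))) (scal B c (ext x))"
    unfolding * by (rule B.lim_to_scal) (use * ext_lim in auto)
  then show "ext (scal C c x) = scal B c (ext x)" unfolding *(1) C_scal[OF *(2)]
    using * ext_lim by (intro ext_eq) (auto simp: ev_simps B.scal_closed)
next
  fix x assume "x \<in> carrier C"
  then obtain x' where *: "x = cls x'" "x' \<in> carrier CR" by (auto simp: C_carrier)
  have "B.lim_to (\<lambda>n. adj B (ev (x' n))) (adj B (ext x))"
    unfolding * by (rule B.lim_to_adj) (use * ext_lim in auto)
  then show "ext (adj C x) = adj B (ext x)" unfolding *(1) C_adj[OF *(2)]
    using * ext_lim by (intro ext_eq) (auto simp: ev_simps B.adj_closed)
qed

lemma nrm_ext_le: assumes "X \<in> carrier C" shows "nrm B (ext X) \<le> nrm C X"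
proof -
  obtain x where x: "X = cls x" "x \<in> carrier CR" using assms by (auto simp: C_carrier)
  have "(\<lambda>n. nrm B (ev (x n))) \<longlonglongrightarrow> nrm B (ext X)"
    unfolding x by (rule B.lim_to_nrm) (use x ext_lim in auto)
  then show ?thesis
    using C_nrm[OF x(2)] unfolding x(1) by (rule LIMSEQ_le) (use x eval_le in auto)
qed

end


context seminormed
begin

lemma C_const_lim:
  assumes "x \<in> carrier CR" shows "cstar_algebra.lim_to C (\<lambda>i. cls (\<lambda>n. x i)) (cls x)"
proof -
  interpret C: cstar_algebra C by (rule cstar_C)
  show ?thesis unfolding C.lim_to_def
  proof (rule LIMSEQ_I)
    fix e :: real assume "e > 0"
    then obtain N where N: "\<And>i. i \<ge> N \<Longrightarrow> nrm C (cls (\<lambda>n. x n - x i)) \<le> e / 2"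
      using C_approx[OF assms, of "e / 2"] by auto
    have "norm (nrm C (cls (\<lambda>n. x i) \<ominus>\<^bsub>C\<^esub> cls x) - 0) < e" if "i \<ge> N" for i
    proof -
      have c: "cls (\<lambda>n. x i) \<in> carrier C" "cls x \<in> carrier C" using assms by (auto simp: C_carrier)
      have "nrm C (cls (\<lambda>n. x i) \<ominus>\<^bsub>C\<^esub> cls x) = nrm C (cls (\<lambda>n. x n - x i))"
        using C.nrm_minus_commute[OF c] C_minus[of x "\<lambda>n. x i"] assms by simp
      moreover have "nrm C (cls (\<lambda>n. x i) \<ominus>\<^bsub>C\<^esub> cls x) \<ge> 0" using c by (intro C.nrm_nonneg) simp
      ultimately show ?thesis using N[OF that] \<open>e > 0\<close> by simp
    qed
    then show "\<exists>N. \<forall>i\<ge>N. norm (nrm C (cls (\<lambda>n. x i) \<ominus>\<^bsub>C\<^esub> cls x) - 0) < e" by blast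
  qed
qed

lemma contractive_lim:
  assumes "cstar_algebra B" "star_hom C B f" "\<And>X. X \<in> carrier C \<Longrightarrow> nrm B (f X) \<le> nrm C X"
    and x: "x \<in> carrier CR"
  shows "cstar_algebra.lim_to B (\<lambda>i. f (cls (\<lambda>n. x i))) (f (cls x))"
proof -
  interpret C: cstar_algebra C by (rule cstar_C)
  interpret B: cstar_algebra B by fact
  have c: "cls (\<lambda>n. x i) \<in> carrier C" "cls x \<in> carrier C" for i using x by (auto simp: C_carrier)
  show ?thesis
  proof (rule B.lim_toI[OF _ _ _ C_const_lim[OF x, unfolded C.lim_to_def]])
    show "nrm B (f (cls (\<lambda>n. x i)) \<ominus>\<^bsub>B\<^esub> f (cls x)) \<le> nrm C (cls (\<lambda>n. x i) \<ominus>\<^bsub>C\<^esub> cls x)" for i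
      using assms(3)[of "cls (\<lambda>n. x i) \<ominus>\<^bsub>C\<^esub> cls x"] c
      by (simp add: star_hom_minus[OF assms(2) cstar_C assms(1)])
  qed (use c star_homD(1)[OF assms(2)] in auto)
qed

lemma star_hom_const_eq:
  assumes A: "cstar_algebra B" and f: "star_hom C B f"
    and x: "x \<in> F"
  shows "f (cls (\<lambda>n. x)) = cstar_algebra.free_eval B (\<lambda>a. f (cls (\<lambda>n. free_gen a))) x"
proof -
  interpret C: cstar_algebra C by (rule cstar_C)
  interpret B: cstar_algebra B by fact
  define T where "T = (\<lambda>a. f (cls (\<lambda>n. free_gen a)))"
  have c: "cls (\<lambda>n. y) \<in> carrier C" if "y \<in> F" for y using that by (auto simp: C_carrier)
  have T: "T \<in> E \<rightarrow> carrier B" using c star_homD(1)[OF f] by (auto simp: T_def)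
  have w: "f (cls (\<lambda>n. Poly_Mapping.single (Word ls) 1)) = B.word_eval T (Word ls)" if "fst ` set ls \<subseteq> E" for ls
    using that
  proof (induction ls)
    case Nil
    then show ?case using star_homD(4)[OF f]
      by (simp add: zero_star_word_def[symmetric] C_one)
  next
    case (Cons l ls)
    obtain a b where l: "l = (a, b)" by (cases l)
    have aE: "a \<in> E" using Cons.prems l by auto
    have F1: "Poly_Mapping.single (Word [l]) 1 \<in> F" "Poly_Mapping.single (Word ls) 1 \<in> F"
      using Cons.prems by (auto simp: free_alg_iff words_def)
    have eq: "Poly_Mapping.single (Word (l # ls)) 1
        = Poly_Mapping.single (Word [l]) 1 * Poly_Mapping.single (Word ls) (1::complex)"
      by (simp add: mult_single plus_star_word_def)
    have "Poly_Mapping.single (Word [(a, True)]) 1 = free_adj (free_gen a)"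
      by (simp add: free_gen_def free_adj_single word_adj_def)
    then have "f (cls (\<lambda>n. Poly_Mapping.single (Word [l]) 1)) = (if b then adj B (T a) else T a)"
      using star_homD(6)[OF f c[of "free_gen a"]] aE C_adj[of "\<lambda>n. free_gen a"]
      by (cases b) (auto simp: l T_def free_gen_def[symmetric])
    moreover have "f (cls (\<lambda>n. Poly_Mapping.single (Word (l # ls)) 1)) =
      f (cls (\<lambda>n. Poly_Mapping.single (Word [l]) 1)) \<otimes>\<^bsub>B\<^esub> f (cls (\<lambda>n. Poly_Mapping.single (Word ls) 1))"
      unfolding eq using star_homD(3)[OF f c[OF F1(1)] c[OF F1(2)]] C_mult[of "\<lambda>n. Poly_Mapping.single (Word [l]) 1" "\<lambda>n. Poly_Mapping.single (Word ls) 1"] F1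
      by simp
    ultimately show ?case using Cons by (simp add: B.word_eval_def l)
  qed
  show ?thesis unfolding T_def[symmetric] using x
  proof (induction x rule: free_induct)
    case (single w' d)
    have eq: "Poly_Mapping.single w' d = free_scal d (Poly_Mapping.single w' 1)"
      by (rule poly_mapping_eqI) (simp add: lookup_single when_def)
    have F1: "Poly_Mapping.single w' 1 \<in> F" using single by (rule free_alg_single)
    have "f (cls (\<lambda>n. Poly_Mapping.single w' d)) = scal B d (f (cls (\<lambda>n. Poly_Mapping.single w' 1)))"
      unfolding eq using star_homD(5)[OF f c[OF F1], of d] C_scal[of "\<lambda>n. Poly_Mapping.single w' 1" d] F1
      by (simp only: CR_const)
    then show ?case using w[of "letters w'"] single B.free_eval_single[OF T single]
      by (simp add: words_def)
  next
    case (add x y)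
    then show ?case using star_homD(2)[OF f c[OF add(1)] c[OF add(2)]] C_add[of "\<lambda>n. x" "\<lambda>n. y"]
      by (simp add: B.free_eval_add[OF T])
  qed
qed

lemma star_hom_unique:
  assumes "cstar_algebra B" "star_hom C B f" "\<And>X. X \<in> carrier C \<Longrightarrow> nrm B (f X) \<le> nrm C X"
    "star_hom C B g" "\<And>X. X \<in> carrier C \<Longrightarrow> nrm B (g X) \<le> nrm C X"
    "\<And>a. a \<in> E \<Longrightarrow> f (cls (\<lambda>n. free_gen a)) = g (cls (\<lambda>n. free_gen a))"
    and X: "X \<in> carrier C"
  shows "f X = g X"
proof -
  interpret B: cstar_algebra B by fact
  obtain x where x: "X = cls x" "x \<in> carrier CR" using X by (auto simp: C_carrier)
  have c: "cls (\<lambda>n. y) \<in> carrier C" if "y \<in> F" for y using that by (auto simp: C_carrier)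
  have "f (cls (\<lambda>n. y)) = g (cls (\<lambda>n. y))" if y: "y \<in> F" for y
  proof -
    define T where "T h a = (if a \<in> E then h (cls (\<lambda>n. free_gen a)) else \<zero>\<^bsub>B\<^esub>)" for h :: "(nat \<Rightarrow> 'e free_star) set \<Rightarrow> _" and a
    have "B.word_eval (\<lambda>a. h (cls (\<lambda>n. free_gen a))) w = B.word_eval (T h) w" if "w \<in> words E" for w h
    proof -
      have "fst ` set ls \<subseteq> E \<Longrightarrow> B.word_eval (\<lambda>a. h (cls (\<lambda>n. free_gen a))) (Word ls) = B.word_eval (T h) (Word ls)" for ls
        by (induction ls) (auto simp: B.word_eval_def T_def)
      from this[of "letters w"] that show ?thesis by (simp add: words_def)
    qed
    moreover have "T f = T g" using assms(6) by (auto simp: T_def)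
    ultimately have we: "B.word_eval (\<lambda>a. f (cls (\<lambda>n. free_gen a))) w = B.word_eval (\<lambda>a. g (cls (\<lambda>n. free_gen a))) w"
      if "w \<in> words E" for w using that by metis
    have Tg: "(\<lambda>a. g (cls (\<lambda>n. free_gen a))) \<in> E \<rightarrow> carrier B"
      using c star_homD(1)[OF assms(4)] by auto
    show ?thesis
      unfolding star_hom_const_eq[OF assms(1,2) y] star_hom_const_eq[OF assms(1,4) y] B.free_eval_def
      by (rule B.finsum_cong')
        (use y we B.word_eval_closed[OF Tg] in \<open>auto simp: free_alg_iff subset_iff intro!: B.scal_closed\<close>)
  qed
  then have "(\<lambda>i. f (cls (\<lambda>n. x i))) = (\<lambda>i. g (cls (\<lambda>n. x i)))" using x by auto
  then show ?thesis
    using contractive_lim[OF assms(1,2,3) x(2)] contractive_lim[OF assms(1,4,5) x(2)] c x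
    by (intro B.lim_to_unique[of "\<lambda>i. g (cls (\<lambda>n. x i))"])
      (auto intro!: star_homD(1)[OF assms(2)] star_homD(1)[OF assms(4)] simp: C_carrier)
qed

end


section \<open>The universal property\<close>

context cstar_presentation
begin

lemma universal:
  assumes B: "cstar_algebra B" and T: "T \<in> E \<rightarrow> carrier B"
    and rel: "\<And>r. r \<in> R \<Longrightarrow> r \<in> free_alg E \<and> cstar_algebra.free_eval B T r = \<zero>\<^bsub>B\<^esub>"
  shows "\<exists>!f. f \<in> extensional (carrier (univ_cstar E R)) \<and> star_hom (univ_cstar E R) B f \<and>
    (\<forall>x\<in>carrier (univ_cstar E R). nrm B (f x) \<le> nrm (univ_cstar E R) x) \<and>
    (\<forall>a\<in>E. f (univ_gen E R a) = T a)"
proof -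
  interpret B: cstar_algebra B by fact
  have "(\<lambda>x. nrm B (B.free_eval T x)) \<in> univ_seminorms E R"
    using B.nrm_free_eval_seminorm[OF T] rel by (simp add: univ_seminorms_def)
  then interpret X: cstar_extension E N B T
    using T N_upper by unfold_locales auto
  have C: "univ_cstar E R = C" by (simp add: univ_cstar_def)
  interpret C: cstar_algebra C by (rule cstar_C)
  define f where "f = restrict X.ext (carrier C)"
  have "star_hom C B f" using X.star_hom_ext
    by (auto simp: f_def star_hom_def Ring.ring_hom_def C.scal_closed C.adj_closed)
  moreover have "\<forall>x\<in>carrier C. nrm B (f x) \<le> nrm C x" using X.nrm_ext_le by (simp add: f_def)
  moreover have "\<forall>a\<in>E. f (univ_gen E R a) = T a"
    using X.ext_const by (auto simp: f_def univ_gen_def C_carrier X.ev_simps)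
  moreover have "f \<in> extensional (carrier C)" by (simp add: f_def)
  moreover have "g = h"
    if g: "g \<in> extensional (carrier C)" "star_hom C B g" "\<forall>x\<in>carrier C. nrm B (g x) \<le> nrm C x" "\<forall>a\<in>E. g (univ_gen E R a) = T a"
      and h: "h \<in> extensional (carrier C)" "star_hom C B h" "\<forall>x\<in>carrier C. nrm B (h x) \<le> nrm C x" "\<forall>a\<in>E. h (univ_gen E R a) = T a" for g h
    using g(1) h(1)
  proof (rule extensionalityI)
    show "g x = h x" if "x \<in> carrier C" for x
      using star_hom_unique[OF B g(2) _ h(2) _ _ that] g(3,4) h(3,4) by (auto simp: univ_gen_def)
  qed
  ultimately show ?thesis unfolding C by blast
qed

lemma cls_const_rel: assumes "r \<in> R" "r \<in> free_alg E" shows "cls (\<lambda>n. r) = \<zero>\<^bsub>C\<^esub>"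
  using C_nrm_0_iff[of "\<lambda>n. r"] C_nrm_const[of r] N_rel assms by simp

lemma cls_const_sum:
  assumes "\<And>i. i \<in> I \<Longrightarrow> f i \<in> free_alg E"
  shows "cls (\<lambda>n. sum f I) = (\<Oplus>\<^bsub>C\<^esub>i\<in>I. cls (\<lambda>n. f i))"
proof -
  interpret C: cstar_algebra C by (rule cstar_C)
  show ?thesis using assms
  proof (induction I rule: infinite_finite_induct)
    case (insert i I)
    have "cls (\<lambda>n. f i + sum f I) = cls (\<lambda>n. f i) \<oplus>\<^bsub>C\<^esub> cls (\<lambda>n. sum f I)"
      using insert.prems by (subst C_add) auto
    then show ?case using insert by (subst C.finsum_insert) (auto simp: C_carrier)
  qed (simp_all add: C_zero)
qed

end

lemma ck_relations_free_alg: assumes "r \<in> ck_relations G" shows "r \<in> free_alg (arcs G)"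
  using assms unfolding ck_relations_def by (auto intro!: free_alg_diff free_alg_mult free_alg_sum)

lemma ck_presentation: "cstar_presentation (arcs G) (ck_relations G)"
proof (unfold_locales, intro exI ballI)
  fix a p assume a: "a \<in> arcs G" and pm: "p \<in> univ_seminorms (arcs G) (ck_relations G)"
  interpret seminormed "arcs G" p using pm by (simp add: univ_seminorms_def seminormed_def)
  define s where "s = free_gen a"
  define q where "q = free_adj s * s"
  have F: "s \<in> F" "q \<in> F" using a by (simp_all add: s_def q_def)
  have "s * free_adj s * s - s \<in> ck_relations G" using a by (auto simp: ck_relations_def s_def)
  then have "p (s * free_adj s * s - s) = 0" using pm by (simp add: univ_seminorms_def)
  moreover have "free_adj q * q - q = free_adj s * (s * free_adj s * s - s)"
    by (simp add: q_def free_adj_mult algebra_simps)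
  ultimately have "p (free_adj q * q - q) \<le> 0"
    using p_mult[of "free_adj s" "s * free_adj s * s - s"] F by simp
  then have "p (free_adj q * q) = p q"
    using p_rev[of "free_adj q * q" q] F by simp
  then have "(p q)\<^sup>2 = p q" using p_cstar[OF F(2)] by simp
  then have "p q \<le> 1" by (cases "p q = 0") (auto simp: power2_eq_square)
  then have "(p s)\<^sup>2 \<le> 1" using p_cstar[OF F(1)] by (simp add: q_def)
  then show "p (free_gen a) \<le> 1" by (simp add: s_def abs_square_le_1)
qed

lemma ck_family_eval:
  assumes B: "cstar_algebra B" and S: "ck_family G B T" and r: "r \<in> ck_relations G"
  shows "cstar_algebra.free_eval B T r = \<zero>\<^bsub>B\<^esub>"
proof -
  interpret B: cstar_algebra B by fact
  have T: "T \<in> arcs G \<rightarrow> carrier B" using S by (auto simp: ck_family_def partial_isometry_def)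
  have c: "a \<in> arcs G \<Longrightarrow> T a \<in> carrier B" for a using T by auto
  note simps = B.free_eval_mult[OF T] B.free_eval_adj[OF T] B.free_eval_gen[OF T] B.free_eval_diff[OF T]
    B.free_eval_1[OF T]
  have sum: "B.free_eval T (\<Sum>a\<in>I. free_gen a * free_adj (free_gen a)) = (\<Oplus>\<^bsub>B\<^esub>a\<in>I. T a \<otimes>\<^bsub>B\<^esub> adj B (T a))"
    if "I \<subseteq> arcs G" for I
    using that c
    by (subst B.free_eval_sum[OF T], force, intro B.finsum_cong')
      (auto simp: simps subset_iff intro!: B.adj_closed)
  have sumF: "(\<Sum>a\<in>I. free_gen a * free_adj (free_gen a)) \<in> free_alg (arcs G)" if "I \<subseteq> arcs G" for I
    using that by (auto intro!: free_alg_sum)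
  have z: "x \<ominus>\<^bsub>B\<^esub> x = \<zero>\<^bsub>B\<^esub>" if "x \<in> carrier B" for x
    using that by (simp add: a_minus_def B.r_neg)
  from r consider
      a where "a \<in> arcs G" "r = free_gen a * free_adj (free_gen a) * free_gen a - free_gen a"
    | "r = (\<Sum>a\<in>arcs G. free_gen a * free_adj (free_gen a)) - 1"
    | a where "a \<in> arcs G" "r = free_adj (free_gen a) * free_gen a -
       (\<Sum>b\<in>{b \<in> arcs G. tail G b = head G a}. free_gen b * free_adj (free_gen b))"
    unfolding ck_relations_def by blast
  then show ?thesis
  proof cases
    case 1
    then show ?thesis using S c[of a] z by (simp add: simps ck_family_def partial_isometry_def)
  next
    case 2
    then show ?thesis using S z sum[of "arcs G"] sumF[of "arcs G"] by (simp add: simps ck_family_def)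
  next
    case 3
    let ?I = "{b \<in> arcs G. tail G b = head G a}"
    have "B.free_eval T r = adj B (T a) \<otimes>\<^bsub>B\<^esub> T a \<ominus>\<^bsub>B\<^esub> (\<Oplus>\<^bsub>B\<^esub>b\<in>?I. T b \<otimes>\<^bsub>B\<^esub> adj B (T b))"
      using 3 sum[of ?I] sumF[of ?I] by (simp add: simps)
    also have "(\<Oplus>\<^bsub>B\<^esub>b\<in>?I. T b \<otimes>\<^bsub>B\<^esub> adj B (T b)) = adj B (T a) \<otimes>\<^bsub>B\<^esub> T a"
      using S 3(1) by (simp add: ck_family_def)
    finally show ?thesis using z c[OF 3(1)] by (simp add: B.adj_closed)
  qed
qed

lemma ck_universal:
  assumes B: "cstar_algebra B" and S: "ck_family G B T"
  shows "\<exists>!f. f \<in> extensional (carrier (univ_cstar (arcs G) (ck_relations G))) \<and>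
    star_hom (univ_cstar (arcs G) (ck_relations G)) B f \<and>
    (\<forall>x\<in>carrier (univ_cstar (arcs G) (ck_relations G)).
       nrm B (f x) \<le> nrm (univ_cstar (arcs G) (ck_relations G)) x) \<and>
    (\<forall>a\<in>arcs G. f (univ_gen (arcs G) (ck_relations G) a) = T a)"
proof (rule cstar_presentation.universal[OF ck_presentation B])
  show "T \<in> arcs G \<rightarrow> carrier B" using S by (auto simp: ck_family_def partial_isometry_def)
qed (use ck_family_eval[OF B S] ck_relations_free_alg in blast)

lemma ck_univ_family:
  "ck_family G (univ_cstar (arcs G) (ck_relations G)) (univ_gen (arcs G) (ck_relations G))"
proof -
  interpret cstar_presentation "arcs G" "ck_relations G" by (rule ck_presentation)
  interpret C: cstar_algebra C by (rule cstar_C)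
  define S where "S = univ_gen (arcs G) (ck_relations G)"
  have S: "S a = cls (\<lambda>n. free_gen a)" for a by (simp add: S_def univ_gen_def)
  have eqI: "cls (\<lambda>n. x) = cls (\<lambda>n. y)" if "x - y \<in> ck_relations G" "x \<in> F" "y \<in> F" for x y
    using cls_const_rel[OF that(1)] that C_minus[of "\<lambda>n. x" "\<lambda>n. y"] C.nrm_minus_0[of "cls (\<lambda>n. x)" "cls (\<lambda>n. y)"]
    by (simp add: C_carrier)
  have SS: "S a \<otimes>\<^bsub>C\<^esub> adj C (S a) = cls (\<lambda>n. free_gen a * free_adj (free_gen a))"
     "adj C (S a) \<otimes>\<^bsub>C\<^esub> S a = cls (\<lambda>n. free_adj (free_gen a) * free_gen a)" if "a \<in> arcs G" for a
    using that by (simp_all add: S C_adj C_mult)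
  have sum: "(\<Oplus>\<^bsub>C\<^esub>a\<in>I. S a \<otimes>\<^bsub>C\<^esub> adj C (S a)) = cls (\<lambda>n. \<Sum>a\<in>I. free_gen a * free_adj (free_gen a))"
    if "I \<subseteq> arcs G" for I
    using that by (subst cls_const_sum, force, intro C.finsum_cong') (auto simp: SS subset_iff C_carrier)
  have sumF: "(\<Sum>a\<in>I. free_gen a * free_adj (free_gen a)) \<in> F" if "I \<subseteq> arcs G" for I
    using that by (auto intro!: free_alg_sum)
  have "ck_family G C S"
    unfolding ck_family_def partial_isometry_def
  proof (intro conjI ballI)
    fix a assume a: "a \<in> arcs G"
    show "S a \<in> carrier C" using a by (auto simp: S C_carrier)
    have "S a \<otimes>\<^bsub>C\<^esub> adj C (S a) \<otimes>\<^bsub>C\<^esub> S a = cls (\<lambda>n. free_gen a * free_adj (free_gen a) * free_gen a)"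
      unfolding SS[OF a] unfolding S using a by (simp add: C_mult)
    also have "\<dots> = S a" unfolding S using a by (intro eqI) (auto simp: ck_relations_def)
    finally show "S a \<otimes>\<^bsub>C\<^esub> adj C (S a) \<otimes>\<^bsub>C\<^esub> S a = S a" .
    have "free_adj (free_gen a) * free_gen a -
       (\<Sum>b\<in>{b \<in> arcs G. tail G b = head G a}. free_gen b * free_adj (free_gen b)) \<in> ck_relations G"
      using a unfolding ck_relations_def by blast
    moreover have I: "{b \<in> arcs G. tail G b = head G a} \<subseteq> arcs G" by blast
    ultimately show "adj C (S a) \<otimes>\<^bsub>C\<^esub> S a =
        (\<Oplus>\<^bsub>C\<^esub>b\<in>{b \<in> arcs G. tail G b = head G a}. S b \<otimes>\<^bsub>C\<^esub> adj C (S b))"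
      unfolding SS(2)[OF a] sum[OF I] using sumF[OF I] a by (intro eqI) auto
  next
    show "(\<Oplus>\<^bsub>C\<^esub>a\<in>arcs G. S a \<otimes>\<^bsub>C\<^esub> adj C (S a)) = \<one>\<^bsub>C\<^esub>"
      unfolding sum[OF subset_refl] C_one
      by (rule eqI) (auto simp: ck_relations_def intro!: sumF free_alg_sum)
  qed
  then show ?thesis by (simp add: univ_cstar_def S_def)
qed

theorem cuntz_krieger_cstar_algebra: "cstar_algebra (cuntz_krieger A)"
proof -
  interpret cstar_presentation "arcs (graph_of A)" "ck_relations (graph_of A)" by (rule ck_presentation)
  show ?thesis using cstar_C by (simp add: cuntz_krieger_def univ_cstar_def)
qed

theorem cuntz_krieger_family: "ck_family (graph_of A) (cuntz_krieger A) (ck_gen A)"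
  unfolding cuntz_krieger_def ck_gen_def by (rule ck_univ_family)

theorem cuntz_krieger_universal:
  assumes "cstar_algebra B" "ck_family (graph_of A) B T"
  shows "\<exists>!f. f \<in> extensional (carrier (cuntz_krieger A)) \<and> star_hom (cuntz_krieger A) B f \<and>
    (\<forall>x\<in>carrier (cuntz_krieger A). nrm B (f x) \<le> nrm (cuntz_krieger A) x) \<and>
    (\<forall>a\<in>arcs (graph_of A). f (ck_gen A a) = T a)"
  unfolding cuntz_krieger_def ck_gen_def by (rule ck_universal[OF assms])

lemma (in cstar_algebra) ck_family_scal:
  assumes S: "ck_family G A S" and c: "cmod c = 1"
  shows "ck_family G A (\<lambda>a. scal A c (S a))"
proof -
  have closed: "a \<in> arcs G \<Longrightarrow> S a \<in> carrier A" for a using S by (simp add: ck_family_def partial_isometry_def)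
  have cc: "c * cnj c = 1" using c by (simp add: complex_norm_square[symmetric])
  have 1: "scal A c (S a) \<otimes> adj A (scal A c (S a)) = S a \<otimes> adj A (S a)"
      "adj A (scal A c (S a)) \<otimes> scal A c (S a) = adj A (S a) \<otimes> S a" if "a \<in> arcs G" for a
    using closed[OF that] cc
    by (simp_all add: adj_scal scal_mult_left scal_mult_right scal_scal scal_closed adj_closed scal_one mult.commute)
  have 2: "scal A c (S a) \<otimes> adj A (scal A c (S a)) \<otimes> scal A c (S a) = scal A c (S a)" if "a \<in> arcs G" for a
    unfolding 1(1)[OF that] using S that closed[OF that]
    by (simp add: ck_family_def partial_isometry_def scal_mult_right adj_closed)
  have sum: "(\<Oplus>a\<in>I. scal A c (S a) \<otimes> adj A (scal A c (S a))) = (\<Oplus>a\<in>I. S a \<otimes> adj A (S a))"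
    if "I \<subseteq> arcs G" for I
    using that by (intro finsum_cong') (auto simp: 1 subset_iff intro!: closed adj_closed)
  show ?thesis unfolding ck_family_def partial_isometry_def
  proof (intro conjI ballI)
    fix a assume a: "a \<in> arcs G"
    have I: "{b \<in> arcs G. tail G b = head G a} \<subseteq> arcs G" by blast
    show "adj A (scal A c (S a)) \<otimes> scal A c (S a)
        = (\<Oplus>b\<in>{b \<in> arcs G. tail G b = head G a}. scal A c (S b) \<otimes> adj A (scal A c (S b)))"
      unfolding sum[OF I] 1(2)[OF a] using S a by (simp add: ck_family_def)
  qed (use S 2 closed scal_closed sum[OF subset_refl] in \<open>auto simp: ck_family_def\<close>)
qed

theorem gauge_action:
  shows "gauge_action A t \<in> extensional (carrier (cuntz_krieger A))"
    and "cstar_iso (cuntz_krieger A) (cuntz_krieger A) (gauge_action A t)"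
    and "a \<in> arcs (graph_of A) \<Longrightarrow>
      gauge_action A t (ck_gen A a) = scal (cuntz_krieger A) (exp (2 * pi * \<i> * t)) (ck_gen A a)"
proof -
  define X where "X = cuntz_krieger A"
  define S where "S = ck_gen A"
  define G where "G = graph_of A"
  interpret X: cstar_algebra X unfolding X_def by (rule cuntz_krieger_cstar_algebra)
  have fam: "ck_family G X S" unfolding X_def S_def G_def by (rule cuntz_krieger_family)
  have Sc: "a \<in> arcs G \<Longrightarrow> S a \<in> carrier X" for a using fam by (simp add: ck_family_def partial_isometry_def)
  define good where "good c f \<longleftrightarrow> f \<in> extensional (carrier X) \<and> star_hom X X f \<and>
    (\<forall>x\<in>carrier X. nrm X (f x) \<le> nrm X x) \<and> (\<forall>a\<in>arcs G. f (S a) = scal X c (S a))" for c f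
  have ex1: "\<exists>!f. good c f" if "cmod c = 1" for c
    using cuntz_krieger_universal[of X A "\<lambda>a. scal X c (S a)"] X.cstar_algebra_axioms
      X.ck_family_scal[OF fam that]
    unfolding X_def[symmetric] S_def[symmetric] G_def[symmetric] good_def by blast
  have id: "restrict (\<lambda>x. x) (carrier X) = f" if "good 1 f" for f
  proof -
    have "good 1 (restrict (\<lambda>x. x) (carrier X))"
      using Sc by (auto simp: good_def star_hom_def Ring.ring_hom_def X.scal_closed X.adj_closed X.scal_one)
    then show ?thesis using ex1[of 1] that by auto
  qed
  have comp: "restrict (f \<circ> g) (carrier X) = restrict (\<lambda>x. x) (carrier X)"
    if f: "good c f" and g: "good d g" and cd: "c * d = 1" for f g c d
  proof -
    note fh = star_homD[of X X f] note gh = star_homD[of X X g]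
    have hf: "star_hom X X f" and hg: "star_hom X X g" using f g by (auto simp: good_def)
    have "good 1 (restrict (f \<circ> g) (carrier X))"
      unfolding good_def
    proof (intro conjI ballI)
      show "star_hom X X (restrict (f \<circ> g) (carrier X))"
        unfolding star_hom_def Ring.ring_hom_def
        by (auto simp: fh[OF hf] gh[OF hg] X.scal_closed X.adj_closed)
      show "nrm X (restrict (f \<circ> g) (carrier X) x) \<le> nrm X x" if "x \<in> carrier X" for x
        using f g that gh(1)[OF hg that] by (auto simp: good_def intro: order_trans)
      show "restrict (f \<circ> g) (carrier X) (S a) = scal X 1 (S a)" if "a \<in> arcs G" for a
        using f g that Sc[OF that] cd
        by (simp add: good_def fh(5)[OF hf] X.scal_scal mult.commute)
    qed simp
    then show ?thesis using id by simp
  qed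
  define c where "c = exp (2 * pi * \<i> * t)"
  have c1: "cmod c = 1" "cmod (cnj c) = 1" by (simp_all add: c_def)
  then have cc: "c * cnj c = 1" "cnj c * c = 1" by (simp_all add: complex_norm_square[symmetric] mult.commute)
  obtain f where f: "good c f" using ex1[OF c1(1)] by blast
  obtain g where g: "good (cnj c) g" using ex1[OF c1(2)] by blast
  have fg: "f (g x) = x" "g (f x) = x" if "x \<in> carrier X" for x
    using fun_cong[OF comp[OF f g cc(1)], of x] fun_cong[OF comp[OF g f cc(2)], of x] that by simp_all
  have cl: "f x \<in> carrier X" "g x \<in> carrier X" if "x \<in> carrier X" for x
    using f g that star_homD(1)[of X X] by (auto simp: good_def)
  have iso: "cstar_iso X X f"
    unfolding cstar_iso_def
  proof (intro conjI ballI)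
    show "star_hom X X f" using f by (simp add: good_def)
    show "bij_betw f (carrier X) (carrier X)" by (rule bij_betw_byWitness[where f' = g]) (use fg cl in auto)
    show "nrm X (f x) = nrm X x" if "x \<in> carrier X" for x
    proof (rule antisym)
      show "nrm X (f x) \<le> nrm X x" using f that by (simp add: good_def)
      show "nrm X x \<le> nrm X (f x)" using g fg(2)[OF that] cl(1)[OF that] by (metis good_def)
    qed
  qed
  have "gauge_action A t = f"
    unfolding gauge_action_def X_def[symmetric] S_def[symmetric] G_def[symmetric] c_def[symmetric]
  proof (rule the_equality)
    show "f \<in> extensional (carrier X) \<and> cstar_iso X X f \<and> (\<forall>a\<in>arcs G. f (S a) = scal X c (S a))"
      using f iso by (simp add: good_def)
    fix h assume "h \<in> extensional (carrier X) \<and> cstar_iso X X h \<and> (\<forall>a\<in>arcs G. h (S a) = scal X c (S a))"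
    then have "good c h" by (auto simp: good_def cstar_iso_def)
    then show "h = f" using ex1[OF c1(1)] f by blast
  qed
  then show "gauge_action A t \<in> extensional (carrier (cuntz_krieger A))"
    "cstar_iso (cuntz_krieger A) (cuntz_krieger A) (gauge_action A t)"
    "a \<in> arcs (graph_of A) \<Longrightarrow>
      gauge_action A t (ck_gen A a) = scal (cuntz_krieger A) (exp (2 * pi * \<i> * t)) (ck_gen A a)"
    using f iso by (auto simp: good_def X_def S_def G_def c_def)
qed

end

theory Submission
  imports Defs "HOL-Computational_Algebra.Polynomial"
begin

text \<open>
  Let \<open>G\<close> be the graph of \<open>A\<close> and \<open>H\<close> its out-splitting. Up to a numbering of edges and vertices, \<open>H\<close> is the
  graph of \<open>B\<close> (\<open>transition_graph_iso\<close>), and the Cuntz--Krieger relations do not depend on the numbering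
  (\<open>ck_family_relabel\<close>). So it suffices to translate Cuntz--Krieger families between \<open>G\<close> and \<open>H\<close>. From a
  family \<open>S\<close> for \<open>H\<close> one obtains a family for \<open>G\<close> by adding up copies, \<open>M\<^sub>e = \<Sum>\<^sub>j S(e, j)\<close>. From a family
  \<open>T\<close> for \<open>G\<close> one obtains a family for \<open>H\<close> by \<open>R(e, j) = T\<^sub>e Q\<close>, where \<open>Q\<close> is the sum of the range projections
  of the \<open>T\<^sub>f\<close> with \<open>f\<close> in the class \<open>j\<close> of the edges leaving the head of \<open>e\<close>. These constructions are inverse
  to each other (\<open>split_merge\<close>, \<open>merge_split\<close>). By the universal property they give contractive
  *-homomorphisms in both directions that are inverse on generators, hence an isometric isomorphism.

  The isomorphism intertwines the gauge actions because \<open>M\<^sub>e\<close> is a sum of generators. For the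
  diagonals, the diagonal of any family commutes with the source projections and is stable under
  \<open>x \<mapsto> S\<^sub>a x S\<^sub>a\<^sup>*\<close> (\<open>diagonal_commute\<close>, \<open>diagonal_conj\<close>). Therefore it is stable under the corresponding
  maps for \<open>M\<close> and \<open>R\<close> as well, and these maps generate the image of the other diagonal from the unit.

  All these computations rest on one analytic fact: the range projections of a Cuntz--Krieger
  family, which add up to the unit, are mutually orthogonal (\<open>projections_orthogonal\<close>). Usually this is
  read off from the order structure of a C*-algebra. Here it is derived from the C*-identity alone:
  if \<open>h\<close> is a self-adjoint element of a corner with unit \<open>p\<close>, and \<open>p + h\<close> and \<open>p - h\<close> are contractions, then
  \<open>h = 0\<close> (\<open>corner_unit_extreme\<close>).
\<close>


section \<open>Projections with sum one are orthogonal\<close>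

context cstar_algebra
begin

declare scal_closed [simp] adj_closed [simp]

definition projection :: "'a \<Rightarrow> bool" where
  "projection p \<longleftrightarrow> p \<in> carrier A \<and> p \<otimes> p = p \<and> adj A p = p"

lemma projection_nrm_le_1:
  assumes "projection p" shows "nrm A p \<le> 1"
proof -
  have "nrm A p = (nrm A p)\<^sup>2"
    using assms nrm_adj_mult[of p] by (simp add: projection_def)
  then show ?thesis by (cases "nrm A p = 0") (auto simp: power2_eq_square)
qed

lemma projection_one: "projection \<one>"
  by (simp add: projection_def)

text \<open>For a projection \<open>p\<close> and a self-adjoint \<open>h\<close> in the corner \<open>pAp\<close>, this is the polynomial \<open>q(h)\<close>
computed in the corner, whose unit is \<open>p\<close>. It turns identities between elements of the corner into
identities of complex polynomials.\<close>

definition corner_poly :: "'a \<Rightarrow> 'a \<Rightarrow> complex poly \<Rightarrow> 'a" where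
  "corner_poly p h q = fold_coeffs (\<lambda>a x. scal A a p \<oplus> h \<otimes> x) q \<zero>"

context
  fixes p h
  assumes p: "projection p" and h: "h \<in> carrier A" "adj A h = h" "p \<otimes> h = h"
begin

private abbreviation ev where "ev \<equiv> corner_poly p h"

private lemma pc: "p \<in> carrier A" "p \<otimes> p = p" "adj A p = p"
  using p by (simp_all add: projection_def)

lemma corner_commute: "h \<otimes> p = h"
  using adj_mult[of p h] pc h by simp

lemma corner_poly_0 [simp]: "ev 0 = \<zero>"
  by (simp add: corner_poly_def)

lemma corner_poly_pCons [simp]: "ev (pCons a q) = scal A a p \<oplus> h \<otimes> ev q"
  by (cases "q = 0"; cases "a = 0") (use pc h in \<open>simp_all add: corner_poly_def\<close>)

lemma corner_poly_closed [simp]: "ev q \<in> carrier A"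
  by (induction q) (use pc h in simp_all)

lemma corner_poly_unit: "p \<otimes> ev q = ev q"
  by (induction q) (use pc h in \<open>simp_all add: r_distr scal_mult_right m_assoc[symmetric]\<close>)

lemma corner_poly_add: "ev (q + r) = ev q \<oplus> ev r"
  by (induction q r rule: poly_induct2) (use pc h in \<open>simp_all add: scal_add_left r_distr a_ac\<close>)

lemma corner_poly_smult: "ev (smult c q) = scal A c (ev q)"
  by (induction q) (use pc h in \<open>simp_all add: scal_add_right scal_scal scal_mult_right\<close>)

lemma corner_poly_mult: "ev (q * r) = ev q \<otimes> ev r"
  by (induction q) (use pc h in \<open>simp_all add: corner_poly_add corner_poly_smult corner_poly_unit
    l_distr scal_mult_left m_assoc\<close>)

lemma corner_poly_X: "ev [:0, 1:] = h"
  using pc h corner_commute by (simp add: scal_one)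

lemma corner_poly_adj: "adj A (ev q) = ev (map_poly cnj q)"
proof (induction q)
  case (pCons a q)
  have "ev (map_poly cnj q) \<otimes> h = h \<otimes> ev (map_poly cnj q)"
    using corner_poly_mult[of "map_poly cnj q" "[:0, 1:]"] corner_poly_mult[of "[:0, 1:]" "map_poly cnj q"]
    by (simp only: corner_poly_X mult.commute)
  then show ?case using pCons pc h by (simp add: map_poly_pCons adj_add adj_scal adj_mult)
qed simp

lemma corner_poly_nrm:
  "nrm A (ev (q + r)) \<le> nrm A (ev q) + nrm A (ev r)"
  "nrm A (ev (q * r)) \<le> nrm A (ev q) * nrm A (ev r)"
  "nrm A (ev (smult c q)) = cmod c * nrm A (ev q)"
  "nrm A (ev (map_poly cnj q * q)) = (nrm A (ev q))\<^sup>2"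
  using nrm_add nrm_mult nrm_scal nrm_adj_mult[of "ev q"]
  by (simp_all add: corner_poly_add corner_poly_mult corner_poly_smult corner_poly_adj)

text \<open>Let \<open>p + h\<close> and \<open>p - h\<close> be contractions. Then so are \<open>p + \<i>h\<close> and \<open>p - \<i>h\<close>, because the squared norm
of each is the norm of \<open>p + h\<^sup>2\<close>, the mean of \<open>(p + h)\<^sup>2\<close> and \<open>(p - h)\<^sup>2\<close>. Linear combinations of powers
of these four contractions then bound \<open>h\<close> and produce the element \<open>k = (3h + h\<^sup>3)/2\<close>, which satisfies
the same hypotheses as \<open>h\<close> and is larger by the factor \<open>11/8\<close>.\<close>

lemma corner_amplify:
  assumes "nrm A (p \<oplus> h) \<le> 1" "nrm A (p \<oplus> scal A (-1) h) \<le> 1"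
  shows "nrm A h \<le> 1/2"
    and "\<exists>k\<in>carrier A. adj A k = k \<and> p \<otimes> k = k \<and> nrm A (p \<oplus> k) \<le> 1 \<and>
      nrm A (p \<oplus> scal A (-1) k) \<le> 1 \<and> nrm A k \<ge> 11/8 * nrm A h"
proof -
  define N where "N q = nrm A (ev q)" for q
  note N = corner_poly_nrm[folded N_def]
  have N0: "0 \<le> N q" for q by (simp add: N_def nrm_nonneg)
  have ev1: "ev [:1, c:] = p \<oplus> scal A c h" for c
    using pc h corner_commute by (simp add: scal_one scal_mult_right)
  have N1: "N [:1, 1:] \<le> 1" "N [:1, -1:] \<le> 1"
    using assms h by (simp_all only: N_def ev1 scal_one)
  have mult_le: "N (q * r) \<le> 1" if "N q \<le> 1" "N r \<le> 1" for q r
    using N(2)[of q r] mult_mono[OF that] N0[of r] by simp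
  have cube_le: "N (q ^ 3) \<le> 1" if "N q \<le> 1" for q
    using that by (simp add: power3_eq_cube mult_le)
  have avg_le: "N (smult (1/2) (q + r)) \<le> 1" if "N q \<le> 1" "N r \<le> 1" for q r
    using N(1)[of q r] that by (simp add: N(3))
  have sq: "N [:1, 0, 1:] \<le> 1"
    using avg_le[OF mult_le[OF N1(1) N1(1)] mult_le[OF N1(2) N1(2)]] by simp
  have Ni: "N [:1, \<i>:] \<le> 1" "N [:1, -\<i>:] \<le> 1"
    using sq N(4)[of "[:1, \<i>:]"] N(4)[of "[:1, -\<i>:]"] abs_square_le_1[of "N [:1, \<i>:]"]
      abs_square_le_1[of "N [:1, -\<i>:]"] by (simp_all add: map_poly_pCons)
  have X: "N [:0, 1:] = nrm A h" unfolding N_def corner_poly_X ..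
  \<comment> \<open>Summing \<open>(1 + zX)\<^sup>2/z\<close> over the fourth roots of unity \<open>z\<close> leaves only the linear term.\<close>
  have "[:0, 8:] = [:1, 1:] * [:1, 1:] + (smult (-1) ([:1, -1:] * [:1, -1:])
      + (smult (-\<i>) ([:1, \<i>:] * [:1, \<i>:]) + smult \<i> ([:1, -\<i>:] * [:1, -\<i>:])))"
    by simp
  also have "N \<dots> \<le> 1 + (1 + (1 + 1))"
    by (intro order_trans[OF N(1)] add_mono)
      (use mult_le N1 Ni in \<open>simp_all only: N(3) norm_minus_cancel norm_ii norm_one mult_1\<close>)
  finally have "N (smult 8 [:0, 1:]) \<le> 4" by simp
  then show half: "nrm A h \<le> 1/2" unfolding N(3) X by simp
  define s where "s = [:0, 3/2, 0, 1/2 :: complex:]"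
  \<comment> \<open>In the cubes of \<open>1 + X\<close>, \<open>1 + \<i>X\<close> and \<open>1 - \<i>X\<close> with weights 1/2, 1/4, 1/4 the quadratic terms cancel.\<close>
  have "[:1, 3/2, 0, 1/2:] = smult (1/2) ([:1, 1:] ^ 3 + smult (1/2) ([:1, \<i>:] ^ 3 + [:1, -\<i>:] ^ 3))"
    by (simp add: power3_eq_cube)
  then have N3: "N [:1, 3/2, 0, 1/2:] \<le> 1"
    using avg_le[OF cube_le[OF N1(1)] avg_le[OF cube_le[OF Ni(1)] cube_le[OF Ni(2)]]] by simp
  have "[:1, -3/2, 0, -1/2:] = smult (1/2) ([:1, -1:] ^ 3 + smult (1/2) ([:1, \<i>:] ^ 3 + [:1, -\<i>:] ^ 3))"
    by (simp add: power3_eq_cube)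
  then have N3': "N [:1, -3/2, 0, -1/2:] \<le> 1"
    using avg_le[OF cube_le[OF N1(2)] avg_le[OF cube_le[OF Ni(1)] cube_le[OF Ni(2)]]] by simp
  have e1: "ev 1 = p" using pc h by (simp add: one_pCons scal_one)
  have "p \<oplus> ev s = ev (1 + s)" "p \<oplus> scal A (-1) (ev s) = ev (1 + smult (-1) s)"
    by (simp_all only: corner_poly_add corner_poly_smult e1)
  moreover have "1 + s = [:1, 3/2, 0, 1/2:]" "1 + smult (-1) s = [:1, -3/2, 0, -1/2:]"
    by (simp_all add: s_def one_pCons)
  ultimately have "nrm A (p \<oplus> ev s) \<le> 1" "nrm A (p \<oplus> scal A (-1) (ev s)) \<le> 1"
    using N3 N3' by (simp_all only: N_def)
  moreover have "adj A (ev s) = ev s"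
    unfolding corner_poly_adj by (simp add: s_def map_poly_pCons)
  moreover have "11/8 * nrm A h \<le> nrm A (ev s)"
  proof -
    \<comment> \<open>The cubic term costs at most \<open>1/8\<close> of the norm of \<open>h\<close>, since that norm is at most \<open>1/2\<close>.\<close>
    have "smult (3/2) [:0, 1:] = s + smult (-1/2) ([:0, 1:] * ([:0, 1:] * [:0, 1:]))" by (simp add: s_def)
    then have "3/2 * nrm A h \<le> N s + 1/2 * N ([:0, 1:] * ([:0, 1:] * [:0, 1:]))"
      using N(1)[of s "smult (-1/2) ([:0, 1:] * ([:0, 1:] * [:0, 1:]))"] N(3)[of "3/2" "[:0,1:]"]
        N(3)[of "-1/2" "[:0, 1:] * ([:0, 1:] * [:0, 1:])"] by (simp add: X)
    also have "N ([:0, 1:] * ([:0, 1:] * [:0, 1:])) \<le> nrm A h * (nrm A h * nrm A h)"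
      unfolding X[symmetric] by (intro order_trans[OF N(2)] mult_left_mono N N0)
    also have "\<dots> \<le> nrm A h * (1/2 * (1/2))"
      using half nrm_nonneg[OF h(1)] by (intro mult_left_mono mult_mono) auto
    finally show ?thesis by (simp add: N_def)
  qed
  ultimately show "\<exists>k\<in>carrier A. adj A k = k \<and> p \<otimes> k = k \<and> nrm A (p \<oplus> k) \<le> 1 \<and>
      nrm A (p \<oplus> scal A (-1) k) \<le> 1 \<and> nrm A k \<ge> 11/8 * nrm A h"
    using corner_poly_unit corner_poly_closed by blast
qed

end

text \<open>The self-adjoint case of the fact that the unit of the C*-algebra \<open>pAp\<close> is an extreme point of its
unit ball. If \<open>h\<close> were nonzero, then \<open>corner_amplify\<close> could be applied again and again, and the norms
would grow without bound although they never exceed \<open>1/2\<close>.\<close>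

lemma corner_unit_extreme:
  assumes p: "projection p" and h: "h \<in> carrier A" "adj A h = h" "p \<otimes> h = h"
    and le: "nrm A (p \<oplus> h) \<le> 1" "nrm A (p \<oplus> scal A (-1) h) \<le> 1"
  shows "h = \<zero>"
proof -
  have pow: "(11/8) ^ n * nrm A h \<le> 1/2" for n
    using h le
  proof (induction n arbitrary: h)
    case 0
    then show ?case using corner_amplify(1)[OF p] by simp
  next
    case (Suc n)
    obtain k where k: "k \<in> carrier A" "adj A k = k" "p \<otimes> k = k" "nrm A (p \<oplus> k) \<le> 1"
      "nrm A (p \<oplus> scal A (-1) k) \<le> 1" "nrm A k \<ge> 11/8 * nrm A h"
      using corner_amplify(2)[OF p Suc.prems] by blast
    have "(11/8) ^ Suc n * nrm A h = (11/8) ^ n * (11/8 * nrm A h)" by simp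
    also have "\<dots> \<le> (11/8) ^ n * nrm A k" by (rule mult_left_mono[OF k(6)]) simp
    also have "\<dots> \<le> 1/2" by (rule Suc.IH[OF k(1-5)])
    finally show ?case .
  qed
  have "\<not> nrm A h > 0"
  proof
    assume pos: "nrm A h > 0"
    obtain n where "(11/8) ^ n > 1 / nrm A h" using real_arch_pow[of "11/8"] by auto
    then have "1 < (11/8) ^ n * nrm A h" using pos by (simp add: pos_divide_less_eq)
    then show False using pow[of n] by simp
  qed
  then show ?thesis using nrm_nonneg[OF h(1)] nrm_eq_0_iff[OF h(1)] by simp
qed

lemma nrm_finsum_le:
  assumes "finite I" "\<And>i. i \<in> I \<Longrightarrow> f i \<in> carrier A"
  shows "nrm A (finsum A f I) \<le> (\<Sum>i\<in>I. nrm A (f i))"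
  using assms
proof (induction I)
  case (insert i I)
  then have "nrm A (finsum A f (insert i I)) \<le> nrm A (f i) + nrm A (finsum A f I)"
    by (simp add: Pi_def nrm_add)
  with insert show ?case by force
qed simp

lemma scal_finsum:
  assumes "finite I" "\<And>i. i \<in> I \<Longrightarrow> f i \<in> carrier A"
  shows "scal A c (finsum A f I) = (\<Oplus>i\<in>I. scal A c (f i))"
  using assms by (induction I) (auto simp: Pi_def scal_add_right)

lemma adj_finsum:
  assumes "finite I" "\<And>i. i \<in> I \<Longrightarrow> f i \<in> carrier A"
  shows "adj A (finsum A f I) = (\<Oplus>i\<in>I. adj A (f i))"
  using assms by (induction I) (auto simp: Pi_def adj_add)

text \<open>Since \<open>2q - 1\<close> is a self-adjoint unitary. This lemma and the next one express by a norm bound that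
the spectrum of a projection, or of its compression to a corner, lies in the unit interval.\<close>

lemma projection_minus_half:
  assumes q: "projection q" shows "nrm A (q \<oplus> scal A (-1/2) \<one>) \<le> 1/2"
proof -
  let ?u = "q \<oplus> scal A (-1/2) \<one>"
  have qc: "q \<in> carrier A" "q \<otimes> q = q" "adj A q = q" using q by (simp_all add: projection_def)
  have "(nrm A ?u)\<^sup>2 = nrm A (?u \<otimes> ?u)"
    using nrm_adj_mult[of ?u] qc by (simp add: adj_add adj_scal)
  also have "?u \<otimes> ?u = (q \<oplus> scal A (-1) q) \<oplus> scal A (1/4) \<one>"
    using qc scal_add_left[of q "-1/2" "-1/2"]
    by (simp add: l_distr r_distr scal_mult_left scal_mult_right scal_scal scal_add_right a_ac)
  also have "q \<oplus> scal A (-1) q = \<zero>"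
    using qc scal_add_left[of q 1 "-1"] by (simp add: scal_one)
  also have "nrm A (\<zero> \<oplus> scal A (1/4) \<one>) \<le> (1/2)\<^sup>2"
    using projection_nrm_le_1[OF projection_one] by (simp add: nrm_scal power2_eq_square)
  finally show ?thesis by (rule power2_le_imp_le) simp
qed

lemma compression_minus_half:
  assumes p: "projection p" and q: "projection q"
  shows "nrm A (p \<otimes> q \<otimes> p \<oplus> scal A (-1/2) p) \<le> 1/2"
proof -
  let ?u = "q \<oplus> scal A (-1/2) \<one>"
  have c: "p \<in> carrier A" "p \<otimes> p = p" "q \<in> carrier A" using p q by (simp_all add: projection_def)
  have "p \<otimes> q \<otimes> p \<oplus> scal A (-1/2) p = p \<otimes> ?u \<otimes> p"
    using c by (simp add: l_distr r_distr scal_mult_left scal_mult_right)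
  also have "nrm A \<dots> \<le> nrm A p * nrm A ?u * nrm A p"
    using c by (intro order_trans[OF nrm_mult] mult_right_mono nrm_mult nrm_nonneg) auto
  also have "\<dots> \<le> 1 * (1/2) * 1"
    using projection_nrm_le_1[OF p] projection_minus_half[OF q] c
    by (intro mult_mono) (auto intro: nrm_nonneg)
  finally show ?thesis by simp
qed

text \<open>Compressing the sum to the corner of \<open>p = e\<^sub>i\<close> gives \<open>\<Sum>\<^sub>k p e\<^sub>k p = 0\<close> over the \<open>k \<noteq> i\<close>, and each summand is
positive, so all of them vanish. Positivity enters only through norm bounds: for \<open>y\<^sub>j = p e\<^sub>j p\<close> and a suitable
\<open>t > 0\<close> both \<open>tp + y\<^sub>j\<close> and \<open>tp - y\<^sub>j\<close> have norm at most \<open>t\<close>, the first because \<open>-y\<^sub>j\<close> is the sum of the other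
summands. So \<open>y\<^sub>j = 0\<close> by \<open>corner_unit_extreme\<close>, and \<open>y\<^sub>j = (e\<^sub>j p)\<^sup>* (e\<^sub>j p)\<close>.\<close>

lemma projections_orthogonal:
  assumes fin: "finite I" and proj: "\<And>i. i \<in> I \<Longrightarrow> projection (e i)"
    and one: "(\<Oplus>i\<in>I. e i) = \<one>" and ij: "i \<in> I" "j \<in> I" "i \<noteq> j"
  shows "e i \<otimes> e j = \<zero>"
proof -
  have ec: "k \<in> I \<Longrightarrow> e k \<in> carrier A" "k \<in> I \<Longrightarrow> e k \<otimes> e k = e k"
    "k \<in> I \<Longrightarrow> adj A (e k) = e k" for k
    using proj[of k] by (simp_all add: projection_def)
  define p where "p = e i"
  define y where "y k = p \<otimes> e k \<otimes> p" for k
  define J where "J = I - {i, j}"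
  define t where "t = real (card J) / 2 + 1/2"
  have p: "projection p" and pc: "p \<in> carrier A" "p \<otimes> p = p" "adj A p = p"
    using ec proj ij by (simp_all add: p_def)
  have yc [simp]: "k \<in> I \<Longrightarrow> y k \<in> carrier A" for k using ec pc by (simp add: y_def)
  have JI: "J \<subseteq> I" "finite J" "i \<notin> J" "j \<notin> J" "I = insert i (insert j J)"
    using fin ij by (auto simp: J_def)
  then have yJ: "y \<in> J \<rightarrow> carrier A" by auto
  have "p = p \<otimes> (\<Oplus>k\<in>I. e k) \<otimes> p" using pc one by simp
  also have "\<dots> = (\<Oplus>k\<in>I. y k)"
    using fin ec pc by (simp add: finsum_ldistr finsum_rdistr Pi_def y_def)
  also have "\<dots> = y i \<oplus> (y j \<oplus> (\<Oplus>k\<in>J. y k))"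
    using JI ij(3) by (simp add: Pi_def)
  also have "y i = p" using pc by (simp add: y_def p_def[symmetric])
  finally have sum0: "y j \<oplus> (\<Oplus>k\<in>J. y k) = \<zero>"
    using pc ij JI yJ by (metis add.l_cancel_one a_closed finsum_closed yc)
  then have yj: "y j = scal A (-1) (\<Oplus>k\<in>J. y k)"
    using ij yJ by (simp add: minus_equality a_inv_scal[symmetric])
  have half: "nrm A (y k \<oplus> scal A (-1/2) p) \<le> 1/2" if "k \<in> I" for k
    unfolding y_def by (rule compression_minus_half[OF p proj[OF that]])
  have card_p: "(\<Oplus>k\<in>J. scal A c p) = scal A (of_nat (card J) * c) p" for c
    using JI(2) pc by (induction J) (auto simp: algebra_simps scal_add_left)
  have np: "nrm A p \<le> 1" by (rule projection_nrm_le_1[OF p])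
  have t: "t > 0" by (simp add: t_def add_nonneg_pos)
  \<comment> \<open>Each of the card J other summands lies within 1/2 of p/2; the extra 1/2 in t makes the same t work for the lower bound.\<close>
  have upper: "nrm A (scal A t p \<oplus> y j) \<le> t"
  proof -
    have "scal A t p \<oplus> y j = scal A (1/2) p \<oplus> scal A (-1) (\<Oplus>k\<in>J. y k \<oplus> scal A (-1/2) p)"
      using yJ pc card_p[of "-1/2"] scal_add_left[of p "1/2" "of_nat (card J) / 2"]
      by (simp add: yj finsum_addf Pi_def scal_add_right scal_scal a_ac t_def algebra_simps)
    also have "nrm A \<dots> \<le> cmod (1/2) * nrm A p
        + cmod (-1) * nrm A (\<Oplus>k\<in>J. y k \<oplus> scal A (-1/2) p)"
      using yJ pc by (intro order_trans[OF nrm_add]) (auto simp: nrm_scal Pi_def)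
    also have "nrm A (\<Oplus>k\<in>J. y k \<oplus> scal A (-1/2) p) \<le> (\<Sum>k\<in>J. 1/2)"
      using JI pc half yJ by (intro order_trans[OF nrm_finsum_le] sum_mono) auto
    finally show ?thesis using np by (simp add: t_def)
  qed
  have lower: "nrm A (scal A t p \<oplus> scal A (-1) (y j)) \<le> t"
  proof -
    have "scal A t p \<oplus> scal A (-1) (y j)
        = scal A (of_nat (card J) / 2) p \<oplus> scal A (-1) (y j \<oplus> scal A (-1/2) p)"
      using pc ij(2) scal_add_left[of p "of_nat (card J) / 2" "1/2"]
      by (simp add: scal_add_right scal_scal a_ac t_def)
    also have "nrm A \<dots> \<le> cmod (of_nat (card J) / 2) * nrm A p
        + cmod (-1) * nrm A (y j \<oplus> scal A (-1/2) p)"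
      using pc ij(2) by (intro order_trans[OF nrm_add]) (auto simp: nrm_scal)
    also have "\<dots> \<le> real (card J) / 2 * 1 + 1/2"
      using np half[OF ij(2)] by (intro add_mono) (auto simp: norm_divide intro!: mult_left_le)
    finally show ?thesis by (simp add: t_def)
  qed
  have inv_t: "complex_of_real (1/t) * t = 1" using t by (simp flip: of_real_mult)
  have "scal A (1/t) (y j) = \<zero>"
  proof (rule corner_unit_extreme[OF p])
    show "adj A (scal A (1/t) (y j)) = scal A (1/t) (y j)"
      using pc ec ij by (simp add: adj_scal y_def adj_mult m_assoc)
    show "p \<otimes> scal A (1/t) (y j) = scal A (1/t) (y j)"
      using pc ec ij by (simp add: scal_mult_right y_def m_assoc[symmetric])
    have "p \<oplus> scal A c (scal A (1/t) (y j)) = scal A (1/t) (scal A t p \<oplus> scal A c (y j))" for c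
      using pc ij inv_t by (simp add: scal_add_right scal_scal scal_one mult.commute)
    from this[of 1] this[of "-1"] show "nrm A (p \<oplus> scal A (1/t) (y j)) \<le> 1"
      "nrm A (p \<oplus> scal A (-1) (scal A (1/t) (y j))) \<le> 1"
      using upper lower t pc ij by (simp_all add: scal_one nrm_scal norm_divide)
  qed (use ij in simp)
  then have "y j = \<zero>" using inv_t ij by (metis mult.commute scal_one scal_scal scal_zero yc)
  then have "adj A (e j \<otimes> p) \<otimes> (e j \<otimes> p) = \<zero>"
    using ec pc ij by (simp add: adj_mult y_def m_assoc) (metis m_assoc)
  then have "e j \<otimes> p = \<zero>"
    using nrm_adj_mult[of "e j \<otimes> p"] nrm_eq_0_iff[of "e j \<otimes> p"] ec pc ij by simp
  then have "adj A (e j \<otimes> p) = \<zero>" by simp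
  then show ?thesis using ec pc ij by (simp add: adj_mult p_def)
qed

end


section \<open>Calculus in a Cuntz--Krieger family\<close>

lemma (in abelian_monoid) finsum_Sigma:
  assumes "finite I" "\<And>i. i \<in> I \<Longrightarrow> finite (F i)"
    and "\<And>i j. i \<in> I \<Longrightarrow> j \<in> F i \<Longrightarrow> g (i, j) \<in> carrier G"
  shows "(\<Oplus>b\<in>Sigma I F. g b) = (\<Oplus>i\<in>I. \<Oplus>j\<in>F i. g (i, j))"
  using assms
proof (induction I)
  case (insert i I)
  have "Sigma (insert i I) F = Pair i ` F i \<union> Sigma I F" by auto
  moreover have "Pair i ` F i \<inter> Sigma I F = {}" using insert.hyps(2) by auto
  ultimately have "(\<Oplus>b\<in>Sigma (insert i I) F. g b) = (\<Oplus>b\<in>Pair i ` F i. g b) \<oplus> (\<Oplus>b\<in>Sigma I F. g b)"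
    using insert.prems insert.hyps(1)
    by (simp only:) (rule finsum_Un_disjoint, auto intro!: finite_SigmaI)
  also have "(\<Oplus>b\<in>Pair i ` F i. g b) = (\<Oplus>j\<in>F i. g (i, j))"
    using insert.prems by (intro finsum_reindex) (auto simp: inj_on_def)
  finally show ?case using insert by (simp add: Pi_def)
qed simp

lemma (in ring) finsum_mult_orthogonal:
  assumes fin: "finite I" and c: "\<And>i. i \<in> I \<Longrightarrow> x i \<in> carrier R" "\<And>i. i \<in> I \<Longrightarrow> y i \<in> carrier R"
    and orth: "\<And>i j. i \<in> I \<Longrightarrow> j \<in> I \<Longrightarrow> i \<noteq> j \<Longrightarrow> x i \<otimes> y j = \<zero>"
  shows "(\<Oplus>i\<in>I. x i) \<otimes> (\<Oplus>i\<in>I. y i) = (\<Oplus>i\<in>I. x i \<otimes> y i)"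
proof -
  have "(\<Oplus>i\<in>I. x i) \<otimes> (\<Oplus>j\<in>I. y j) = (\<Oplus>i\<in>I. \<Oplus>j\<in>I. x i \<otimes> y j)"
    using fin c by (subst finsum_ldistr) (auto simp: Pi_def finsum_rdistr intro!: finsum_cong')
  also have "\<dots> = (\<Oplus>i\<in>I. x i \<otimes> y i)"
  proof (rule finsum_cong')
    fix i assume i: "i \<in> I"
    have "(\<Oplus>j\<in>I. x i \<otimes> y j) = (\<Oplus>j\<in>I. if i = j then x i \<otimes> y j else \<zero>)"
      using i c orth by (intro finsum_cong') auto
    also have "\<dots> = x i \<otimes> y i" using i fin c by (intro finsum_singleton) auto
    finally show "(\<Oplus>j\<in>I. x i \<otimes> y j) = x i \<otimes> y i" .
  qed (use c in auto)
  finally show ?thesis .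
qed

locale ck_system = cstar_algebra A for A :: "'a cstar" (structure) +
  fixes G :: "('v, 'e) pre_digraph" and S :: "'e \<Rightarrow> 'a"
  assumes finite_arcs: "finite (arcs G)" and family: "ck_family G A S"
begin

text \<open>The range projection of a set of edges. As the range projections of the single edges are mutually
orthogonal, sets of edges multiply like their intersections (\<open>range_sum_mult\<close>), and the
Cuntz--Krieger relations say that the whole edge set gives the unit and that the edges leaving
the head of \<open>a\<close> give the source projection of \<open>S a\<close>.\<close>

definition range_sum :: "'e set \<Rightarrow> 'a" where
  "range_sum F = (\<Oplus>b\<in>F. S b \<otimes> adj A (S b))"

lemma S_closed [simp]: "a \<in> arcs G \<Longrightarrow> S a \<in> carrier A"
  using family by (simp add: ck_family_def partial_isometry_def)

lemma S_adj_S: "a \<in> arcs G \<Longrightarrow> S a \<otimes> (adj A (S a) \<otimes> S a) = S a"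
  using family m_assoc[of "S a" "adj A (S a)" "S a"] by (simp add: ck_family_def partial_isometry_def)

lemma adj_S_S_adj: "a \<in> arcs G \<Longrightarrow> adj A (S a) \<otimes> (S a \<otimes> adj A (S a)) = adj A (S a)"
  using arg_cong[OF S_adj_S, of a "adj A"] by (simp add: adj_mult adj_adj m_assoc)

lemma projection_range: "a \<in> arcs G \<Longrightarrow> projection (S a \<otimes> adj A (S a))"
  by (simp add: projection_def adj_mult adj_adj m_assoc adj_S_S_adj)

lemma range_sum_arcs: "range_sum (arcs G) = \<one>"
  using family by (simp add: ck_family_def range_sum_def)

lemma source_eq: "a \<in> arcs G \<Longrightarrow> adj A (S a) \<otimes> S a = range_sum (out_arcs G (head G a))"
  using family by (simp add: ck_family_def range_sum_def out_arcs_def)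

lemma adj_S_S_orthogonal:
  assumes "a \<in> arcs G" "b \<in> arcs G" "a \<noteq> b" shows "adj A (S a) \<otimes> S b = \<zero>"
proof -
  have orth: "(S a \<otimes> adj A (S a)) \<otimes> (S b \<otimes> adj A (S b)) = \<zero>"
    using projections_orthogonal[OF finite_arcs projection_range _ assms] range_sum_arcs
    by (simp add: range_sum_def)
  have "adj A (S a) \<otimes> S b = adj A (S a) \<otimes> ((S a \<otimes> adj A (S a)) \<otimes> (S b \<otimes> adj A (S b))) \<otimes> S b"
    using assms S_adj_S adj_S_S_adj by (simp add: m_assoc) (simp add: m_assoc[symmetric])
  then show ?thesis using assms by (simp add: orth)
qed

lemma range_sum_closed [simp]: "F \<subseteq> arcs G \<Longrightarrow> range_sum F \<in> carrier A"
  unfolding range_sum_def by (rule finsum_closed) auto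

lemma range_sum_mult_S:
  assumes F: "F \<subseteq> arcs G" and a: "a \<in> arcs G"
  shows "range_sum F \<otimes> S a = (if a \<in> F then S a else \<zero>)"
proof -
  have fin: "finite F" using F finite_arcs by (rule finite_subset)
  have "range_sum F \<otimes> S a = (\<Oplus>b\<in>F. S b \<otimes> adj A (S b) \<otimes> S a)"
    unfolding range_sum_def using fin F a by (subst finsum_ldistr) auto
  also have "\<dots> = (\<Oplus>b\<in>F. if a = b then S b else \<zero>)"
    using F a by (intro finsum_cong') (auto simp: m_assoc S_adj_S adj_S_S_orthogonal subset_iff)
  also have "\<dots> = (if a \<in> F then S a else \<zero>)"
  proof (cases "a \<in> F")
    case True
    then show ?thesis using fin F by (simp only: if_True) (rule finsum_singleton, auto)
  next
    case False
    then have "(\<Oplus>b\<in>F. if a = b then S b else \<zero>) = (\<Oplus>b\<in>F. \<zero>)" by (intro finsum_cong') auto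
    then show ?thesis using False by simp
  qed
  finally show ?thesis .
qed

lemma range_sum_adj:
  assumes "F \<subseteq> arcs G" shows "adj A (range_sum F) = range_sum F"
  unfolding range_sum_def using assms
  by (subst adj_finsum) (auto simp: finite_subset[OF _ finite_arcs] adj_mult adj_adj subset_iff
    intro!: finsum_cong')

lemma range_sum_mult:
  assumes "F \<subseteq> arcs G" "F' \<subseteq> arcs G"
  shows "range_sum F \<otimes> range_sum F' = range_sum (F \<inter> F')"
proof -
  have fin: "finite F'" using assms finite_arcs finite_subset by blast
  have "range_sum F \<otimes> range_sum F' = (\<Oplus>c\<in>F'. range_sum F \<otimes> (S c \<otimes> adj A (S c)))"
    unfolding range_sum_def[of F'] using fin assms by (subst finsum_rdistr) auto
  also have "\<dots> = (\<Oplus>c\<in>F \<inter> F'. S c \<otimes> adj A (S c))"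
    using fin assms by (intro add.finprod_mono_neutral_cong_right)
      (auto simp: m_assoc[symmetric] range_sum_mult_S subset_iff)
  finally show ?thesis by (simp add: range_sum_def)
qed

lemma out_arcs_sub [simp]: "out_arcs G v \<subseteq> arcs G"
  by auto

lemma S_mult_range_sum: "a \<in> arcs G \<Longrightarrow> S a \<otimes> range_sum (out_arcs G (head G a)) = S a"
  by (simp add: source_eq[symmetric] S_adj_S)

lemma S_mult_out_arcs:
  assumes a: "a \<in> arcs G"
  shows "S a \<otimes> range_sum (out_arcs G v) = (if v = head G a then S a else \<zero>)"
proof -
  have "S a \<otimes> range_sum (out_arcs G v) = S a \<otimes> range_sum (out_arcs G (head G a)) \<otimes> range_sum (out_arcs G v)"
    using a by (simp add: S_mult_range_sum)
  also have "\<dots> = S a \<otimes> range_sum (out_arcs G (head G a) \<inter> out_arcs G v)"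
    using a by (simp add: m_assoc range_sum_mult)
  also have "\<dots> = (if v = head G a then S a else \<zero>)"
  proof (cases "v = head G a")
    case False
    then have "out_arcs G (head G a) \<inter> out_arcs G v = {}" by auto
    then show ?thesis using a False by (simp add: range_sum_def)
  qed (use a S_mult_range_sum in simp)
  finally show ?thesis .
qed

text \<open>Edges with different heads have orthogonal source projections; an element commuting with source
projections cannot connect them.\<close>

lemma S_sandwich_orthogonal:
  assumes a: "a \<in> arcs G" "b \<in> arcs G" "head G a \<noteq> head G b"
    and x: "x \<in> carrier A" "x \<otimes> range_sum (out_arcs G (head G b)) = range_sum (out_arcs G (head G b)) \<otimes> x"
  shows "S a \<otimes> x \<otimes> adj A (S b) = \<zero>"
proof -
  let ?q = "range_sum (out_arcs G (head G b))"
  have "adj A (S b) = ?q \<otimes> adj A (S b)"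
    using arg_cong[OF S_mult_range_sum[OF a(2)], of "adj A"] a by (simp add: adj_mult range_sum_adj)
  then have "S a \<otimes> x \<otimes> adj A (S b) = S a \<otimes> (x \<otimes> ?q) \<otimes> adj A (S b)"
    using a x by (metis adj_closed m_assoc m_closed S_closed range_sum_closed out_arcs_sub)
  also have "\<dots> = S a \<otimes> ?q \<otimes> x \<otimes> adj A (S b)" using a x by (simp add: m_assoc)
  also have "S a \<otimes> ?q = \<zero>" using a S_mult_out_arcs[of a "head G b"] by simp
  finally show ?thesis using a x by simp
qed

end


section \<open>Families for a graph and its out-splitting\<close>

text \<open>A vertex without outgoing edges has no copies, and the edges ending in it are represented by zero
in every Cuntz--Krieger family.\<close>

locale edge_split =
  fixes G :: "('v, 'e) pre_digraph" and m :: "'v \<Rightarrow> nat" and P :: "'v \<Rightarrow> nat \<Rightarrow> 'e set"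
  assumes finite_arcs: "finite (arcs G)"
    and head_in_verts: "e \<in> arcs G \<Longrightarrow> head G e \<in> verts G"
    and tail_in_verts: "e \<in> arcs G \<Longrightarrow> tail G e \<in> verts G"
    and partition: "out_edge_partition G m P"
begin

abbreviation H where "H \<equiv> out_split G m P"

lemma arcs_H: "arcs H = (SIGMA e:arcs G. {1..m (head G e)})"
  and verts_H: "verts H = (SIGMA I:verts G. {1..m I})"
  and head_H [simp]: "head H (e, j) = (head G e, j)"
  by (simp_all add: out_split_def)

lemma finite_arcs_H: "finite (arcs H)"
  using finite_arcs by (simp add: arcs_H)

lemma UN_P: "J \<in> verts G \<Longrightarrow> (\<Union>j\<in>{1..m J}. P J j) = out_arcs G J"
  and disjoint_P: "J \<in> verts G \<Longrightarrow> disjoint_family_on (P J) {1..m J}"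
  using partition by (auto simp: out_edge_partition_def)

lemma P_sub: "J \<in> verts G \<Longrightarrow> j \<in> {1..m J} \<Longrightarrow> P J j \<subseteq> out_arcs G J"
  using UN_P[of J] by blast

lemma P_arcs: "J \<in> verts G \<Longrightarrow> j \<in> {1..m J} \<Longrightarrow> P J j \<subseteq> arcs G"
  using P_sub[of J j] by auto

lemma tail_H:
  assumes "e \<in> arcs G" "i \<in> {1..m (tail G e)}" "e \<in> P (tail G e) i"
  shows "tail H (e, j) = (tail G e, i)"
proof -
  have "(THE i. i \<in> {1..m (tail G e)} \<and> e \<in> P (tail G e) i) = i"
    using assms disjoint_family_onD[OF disjoint_P[OF tail_in_verts[OF assms(1)]]]
    by (intro the_equality) blast+
  then show ?thesis by (simp add: out_split_def)
qed

lemma tail_class: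
  assumes "e \<in> arcs G"
  obtains i where "i \<in> {1..m (tail G e)}" "e \<in> P (tail G e) i" "\<And>j. tail H (e, j) = (tail G e, i)"
proof -
  have "e \<in> (\<Union>i\<in>{1..m (tail G e)}. P (tail G e) i)"
    unfolding UN_P[OF tail_in_verts[OF assms]] using assms by simp
  then show ?thesis using that tail_H[OF assms] by blast
qed

lemma out_arcs_H:
  assumes J: "J \<in> verts G" and j: "j \<in> {1..m J}"
  shows "out_arcs H (J, j) = (SIGMA f:P J j. {1..m (head G f)})"
proof -
  have "tail H (f, k) = (J, j) \<longleftrightarrow> f \<in> P J j" if f: "f \<in> arcs G" for f k
  proof
    assume "f \<in> P J j"
    then show "tail H (f, k) = (J, j)"
      using P_sub[OF J j] tail_H[OF f, of j k] j by auto
  next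
    assume "tail H (f, k) = (J, j)"
    then show "f \<in> P J j" using tail_class[OF f] by (metis Pair_inject)
  qed
  then show ?thesis using P_arcs[OF J j] by (auto simp: out_arcs_def arcs_H)
qed

lemma H_wf:
  assumes "h \<in> arcs H" shows "head H h \<in> verts H" "tail H h \<in> verts H"
proof -
  obtain e j where h: "h = (e, j)" "e \<in> arcs G" "j \<in> {1..m (head G e)}" using assms by (auto simp: arcs_H)
  show "head H h \<in> verts H" using h head_in_verts by (simp add: verts_H)
  obtain i where "i \<in> {1..m (tail G e)}" "tail H (e, j) = (tail G e, i)" using tail_class[OF h(2)] by metis
  then show "tail H h \<in> verts H" using h tail_in_verts by (simp add: verts_H)
qed

end

text \<open>The two translations between families. An edge is the union of its copies, so it is represented by
the sum of their representatives. The copy \<open>e\<^sup>j\<close> is \<open>e\<close> restricted to the paths that continue with an edge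
of the class \<open>j\<close>, so its representative is that of \<open>e\<close> cut down by the range projection of this class.\<close>

definition merge_family :: "'a cstar \<Rightarrow> ('v, 'e) pre_digraph \<Rightarrow> ('v \<Rightarrow> nat) \<Rightarrow> ('e \<times> nat \<Rightarrow> 'a) \<Rightarrow> 'e \<Rightarrow> 'a" where
  "merge_family A G m S e = (\<Oplus>\<^bsub>A\<^esub>j\<in>{1..m (head G e)}. S (e, j))"

definition split_family ::
  "'a cstar \<Rightarrow> ('v, 'e) pre_digraph \<Rightarrow> ('v \<Rightarrow> nat \<Rightarrow> 'e set) \<Rightarrow> ('e \<Rightarrow> 'a) \<Rightarrow> 'e \<times> nat \<Rightarrow> 'a" where
  "split_family A G P T = (\<lambda>(e, j). T e \<otimes>\<^bsub>A\<^esub> (\<Oplus>\<^bsub>A\<^esub>f\<in>P (head G e) j. T f \<otimes>\<^bsub>A\<^esub> adj A (T f)))"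

locale merging = edge_split G m P + Y: ck_system Y "out_split G m P" S
  for G :: "('v, 'e) pre_digraph" and m P and Y :: "'a cstar" (structure) and S
begin

abbreviation M where "M \<equiv> merge_family Y G m S"

lemma copy: "e \<in> arcs G \<Longrightarrow> j \<in> {1..m (head G e)} \<Longrightarrow> (e, j) \<in> arcs H"
  by (simp add: arcs_H)

lemma M_closed [simp]: "e \<in> arcs G \<Longrightarrow> M e \<in> carrier Y"
  unfolding merge_family_def using copy by (intro Y.finsum_closed) auto

lemma adj_M: "e \<in> arcs G \<Longrightarrow> adj Y (M e) = (\<Oplus>j\<in>{1..m (head G e)}. adj Y (S (e, j)))"
  unfolding merge_family_def using copy by (intro Y.adj_finsum) auto

lemma range_sum_Sigma:
  assumes "F \<subseteq> arcs G"
  shows "Y.range_sum (SIGMA f:F. {1..m (head G f)}) = (\<Oplus>f\<in>F. \<Oplus>j\<in>{1..m (head G f)}. S (f, j) \<otimes> adj Y (S (f, j)))"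
  unfolding Y.range_sum_def using assms finite_subset[OF assms finite_arcs] copy
  by (intro Y.finsum_Sigma) (auto simp: subset_iff)

text \<open>The mixed terms vanish since different copies of \<open>e\<close> have different heads. The case \<open>x = \<one>\<close> computes
range projections; diagonal elements \<open>x\<close> are needed to compare the diagonals.\<close>

lemma M_conj:
  assumes e: "e \<in> arcs G" and x: "x \<in> carrier Y"
    and comm: "\<And>j. x \<otimes> Y.range_sum (out_arcs H (head G e, j)) = Y.range_sum (out_arcs H (head G e, j)) \<otimes> x"
  shows "M e \<otimes> x \<otimes> adj Y (M e) = (\<Oplus>j\<in>{1..m (head G e)}. S (e, j) \<otimes> x \<otimes> adj Y (S (e, j)))"
proof -
  have "M e \<otimes> x = (\<Oplus>j\<in>{1..m (head G e)}. S (e, j) \<otimes> x)"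
    unfolding merge_family_def using x copy[OF e] by (intro Y.finsum_ldistr) auto
  then show ?thesis unfolding adj_M[OF e]
    using x copy[OF e] comm by (simp only:) (rule Y.finsum_mult_orthogonal, auto intro: Y.S_sandwich_orthogonal)
qed

lemma M_range: "e \<in> arcs G \<Longrightarrow> M e \<otimes> adj Y (M e) = (\<Oplus>j\<in>{1..m (head G e)}. S (e, j) \<otimes> adj Y (S (e, j)))"
  using M_conj[of e \<one>] copy by (simp cong: Y.finsum_cong)

lemma range_sum_copies:
  assumes "F \<subseteq> arcs G"
  shows "Y.range_sum (SIGMA f:F. {1..m (head G f)}) = (\<Oplus>f\<in>F. M f \<otimes> adj Y (M f))"
  unfolding range_sum_Sigma[OF assms] using assms copy
  by (intro Y.finsum_cong') (auto simp: M_range subset_iff intro!: Y.finsum_closed)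

text \<open>The copies of \<open>e\<close> end in the copies of the head \<open>J\<close> of \<open>e\<close>, and the copies of \<open>J\<close> share the outgoing edges of
\<open>J\<close> among them, each with all its copies.\<close>

lemma M_source:
  assumes e: "e \<in> arcs G"
  shows "adj Y (M e) \<otimes> M e = (\<Oplus>f\<in>out_arcs G (head G e). M f \<otimes> adj Y (M f))"
proof -
  note J = head_in_verts[OF e]
  have "adj Y (M e) \<otimes> M e = (\<Oplus>j\<in>{1..m (head G e)}. adj Y (S (e, j)) \<otimes> S (e, j))"
    unfolding adj_M[OF e] unfolding merge_family_def using copy[OF e]
    by (intro Y.finsum_mult_orthogonal) (auto intro: Y.adj_S_S_orthogonal)
  also have "\<dots> = (\<Oplus>j\<in>{1..m (head G e)}. \<Oplus>f\<in>P (head G e) j. M f \<otimes> adj Y (M f))"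
  proof (rule Y.finsum_cong')
    fix j assume j: "j \<in> {1..m (head G e)}"
    show "adj Y (S (e, j)) \<otimes> S (e, j) = (\<Oplus>f\<in>P (head G e) j. M f \<otimes> adj Y (M f))"
      using range_sum_copies[OF P_arcs[OF J j]] by (simp add: Y.source_eq[OF copy[OF e j]] out_arcs_H[OF J j])
  qed (use P_arcs[OF J] in \<open>auto intro!: Y.finsum_closed simp: subset_iff\<close>)
  also have "\<dots> = (\<Oplus>f\<in>(\<Union>j\<in>{1..m (head G e)}. P (head G e) j). M f \<otimes> adj Y (M f))"
    using P_arcs[OF J] finite_subset[OF P_arcs[OF J] finite_arcs] disjoint_P[OF J]
    by (intro Y.add.finprod_UN_disjoint[symmetric])
      (auto simp: subset_iff disjoint_family_on_def pairwise_def disjnt_def)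
  finally show ?thesis unfolding UN_P[OF J] .
qed

lemma ck_family_M: "ck_family G Y M"
  unfolding ck_family_def partial_isometry_def
proof (intro conjI ballI)
  have "(\<Oplus>e\<in>arcs G. M e \<otimes> adj Y (M e)) = Y.range_sum (arcs H)"
    unfolding arcs_H by (rule range_sum_copies[symmetric]) simp
  then show "(\<Oplus>e\<in>arcs G. M e \<otimes> adj Y (M e)) = \<one>" by (simp add: Y.range_sum_arcs)
  fix e assume e: "e \<in> arcs G"
  show "M e \<in> carrier Y" using e by simp
  show "adj Y (M e) \<otimes> M e = (\<Oplus>b\<in>{b \<in> arcs G. tail G b = head G e}. M b \<otimes> adj Y (M b))"
    using M_source[OF e] by (simp add: out_arcs_def)
  have "M e \<otimes> adj Y (M e) \<otimes> M e = Y.range_sum (SIGMA f:{e}. {1..m (head G f)}) \<otimes> M e"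
    using e by (subst range_sum_copies) auto
  also have "\<dots> = (\<Oplus>j\<in>{1..m (head G e)}. Y.range_sum (SIGMA f:{e}. {1..m (head G f)}) \<otimes> S (e, j))"
    unfolding merge_family_def using e copy by (intro Y.finsum_rdistr Y.range_sum_closed) (auto simp: arcs_H)
  also have "\<dots> = M e"
    unfolding merge_family_def
  proof (rule Y.finsum_cong')
    fix j assume "j \<in> {1..m (head G e)}"
    then show "Y.range_sum (SIGMA f:{e}. {1..m (head G f)}) \<otimes> S (e, j) = S (e, j)"
      using e by (subst Y.range_sum_mult_S) (auto simp: arcs_H)
  qed (use e copy in auto)
  finally show "M e \<otimes> adj Y (M e) \<otimes> M e = M e" .
qed

lemma split_merge:
  assumes "h \<in> arcs H" shows "split_family Y G P M h = S h"
proof -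
  obtain e j where h: "h = (e, j)" and e: "e \<in> arcs G" and j: "j \<in> {1..m (head G e)}"
    using assms by (auto simp: arcs_H)
  note J = head_in_verts[OF e]
  have "split_family Y G P M h = M e \<otimes> Y.range_sum (out_arcs H (head G e, j))"
    by (simp only: split_family_def h out_arcs_H[OF J j] range_sum_copies[OF P_arcs[OF J j]] split)
  also have "\<dots> = (\<Oplus>k\<in>{1..m (head G e)}. S (e, k) \<otimes> Y.range_sum (out_arcs H (head G e, j)))"
    unfolding merge_family_def using copy[OF e] by (intro Y.finsum_ldistr) auto
  also have "\<dots> = (\<Oplus>k\<in>{1..m (head G e)}. if j = k then S (e, k) else \<zero>)"
    using copy[OF e] by (intro Y.finsum_cong') (auto simp: Y.S_mult_out_arcs)
  also have "\<dots> = S (e, j)" using j copy[OF e] by (intro Y.finsum_singleton) auto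
  finally show ?thesis by (simp add: h)
qed

end

locale splitting = edge_split G m P + X: ck_system X G T
  for G :: "('v, 'e) pre_digraph" and m P and X :: "'a cstar" (structure) and T
begin

abbreviation R where "R \<equiv> split_family X G P T"

lemma R_eq: "R (e, j) = T e \<otimes> X.range_sum (P (head G e) j)"
  by (simp add: split_family_def X.range_sum_def)

context
  fixes e j assumes e: "e \<in> arcs G" and j: "j \<in> {1..m (head G e)}"
begin

lemma class_arcs [simp]: "P (head G e) j \<subseteq> arcs G"
  by (rule P_arcs[OF head_in_verts[OF e] j])

lemma R_closed [simp]: "R (e, j) \<in> carrier X"
  using e by (simp add: R_eq)

lemma R_conj: "x \<in> carrier X \<Longrightarrow> R (e, j) \<otimes> x \<otimes> adj X (R (e, j)) =
    T e \<otimes> (X.range_sum (P (head G e) j) \<otimes> x \<otimes> X.range_sum (P (head G e) j)) \<otimes> adj X (T e)"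
  using e by (simp add: R_eq X.adj_mult X.range_sum_adj X.m_assoc)

lemma R_range: "R (e, j) \<otimes> adj X (R (e, j)) = T e \<otimes> X.range_sum (P (head G e) j) \<otimes> adj X (T e)"
  using R_conj[of \<one>] by (simp add: X.range_sum_mult)

text \<open>The source projection of \<open>T e\<close> dominates that of each class, because the edges in the class leave the
head of \<open>e\<close>.\<close>

lemma R_source: "adj X (R (e, j)) \<otimes> R (e, j) = X.range_sum (P (head G e) j)"
proof -
  have "adj X (R (e, j)) \<otimes> R (e, j) =
      X.range_sum (P (head G e) j) \<otimes> (adj X (T e) \<otimes> T e) \<otimes> X.range_sum (P (head G e) j)"
    using e by (simp add: R_eq X.adj_mult X.range_sum_adj X.m_assoc)
  also have "\<dots> = X.range_sum (P (head G e) j \<inter> out_arcs G (head G e) \<inter> P (head G e) j)"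
    unfolding X.source_eq[OF e] by (subst X.range_sum_mult | simp add: le_infI1)+
  also have "P (head G e) j \<inter> out_arcs G (head G e) \<inter> P (head G e) j = P (head G e) j"
    using P_sub[OF head_in_verts[OF e] j] by blast
  finally show ?thesis .
qed

lemma R_partial_isometry: "partial_isometry X (R (e, j))"
  using e R_source by (simp add: partial_isometry_def X.m_assoc R_eq X.range_sum_mult)

end

lemma sum_classes:
  assumes J: "J \<in> verts G"
  shows "(\<Oplus>j\<in>{1..m J}. X.range_sum (P J j)) = X.range_sum (out_arcs G J)"
  unfolding X.range_sum_def UN_P[OF J, symmetric]
  using P_arcs[OF J] finite_subset[OF P_arcs[OF J] finite_arcs] disjoint_P[OF J]
  by (intro X.add.finprod_UN_disjoint[symmetric])
    (auto simp: subset_iff disjoint_family_on_def pairwise_def disjnt_def)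

lemma merge_split:
  assumes e: "e \<in> arcs G" shows "merge_family X G m R e = T e"
proof -
  have "merge_family X G m R e = T e \<otimes> (\<Oplus>j\<in>{1..m (head G e)}. X.range_sum (P (head G e) j))"
    unfolding merge_family_def R_eq using e by (intro X.finsum_rdistr[symmetric]) auto
  then show ?thesis
    unfolding sum_classes[OF head_in_verts[OF e]] using X.S_mult_range_sum[OF e] by simp
qed

lemma sum_copies:
  assumes e: "e \<in> arcs G"
  shows "(\<Oplus>j\<in>{1..m (head G e)}. R (e, j) \<otimes> adj X (R (e, j))) = T e \<otimes> adj X (T e)"
proof -
  have "(\<Oplus>j\<in>{1..m (head G e)}. R (e, j) \<otimes> adj X (R (e, j)))
      = (\<Oplus>j\<in>{1..m (head G e)}. T e \<otimes> X.range_sum (P (head G e) j) \<otimes> adj X (T e))"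
    using e by (intro X.finsum_cong') (auto simp: R_range)
  also have "\<dots> = (\<Oplus>j\<in>{1..m (head G e)}. R (e, j)) \<otimes> adj X (T e)"
    using e by (subst X.finsum_ldistr) (auto simp: R_eq)
  finally show ?thesis using merge_split[OF e] by (simp add: merge_family_def)
qed

lemma sum_Sigma:
  assumes F: "F \<subseteq> arcs G"
  shows "(\<Oplus>h\<in>(SIGMA f:F. {1..m (head G f)}). R h \<otimes> adj X (R h)) = X.range_sum F"
proof -
  have "(\<Oplus>h\<in>(SIGMA f:F. {1..m (head G f)}). R h \<otimes> adj X (R h))
      = (\<Oplus>f\<in>F. \<Oplus>j\<in>{1..m (head G f)}. R (f, j) \<otimes> adj X (R (f, j)))"
    using F finite_subset[OF F finite_arcs] by (intro X.finsum_Sigma) auto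
  also have "\<dots> = X.range_sum F"
    unfolding X.range_sum_def using F by (intro X.finsum_cong' sum_copies) auto
  finally show ?thesis .
qed

lemma ck_family_R: "ck_family H X R"
  unfolding ck_family_def
proof (intro conjI ballI)
  show "(\<Oplus>h\<in>arcs H. R h \<otimes> adj X (R h)) = \<one>"
    unfolding arcs_H sum_Sigma[OF subset_refl] by (rule X.range_sum_arcs)
  fix h assume "h \<in> arcs H"
  then obtain e j where h: "h = (e, j)" and e: "e \<in> arcs G" and j: "j \<in> {1..m (head G e)}"
    by (auto simp: arcs_H)
  show "partial_isometry X (R h)" unfolding h by (rule R_partial_isometry[OF e j])
  have "{b \<in> arcs H. tail H b = head H h} = (SIGMA f:P (head G e) j. {1..m (head G f)})"
    using out_arcs_H[OF head_in_verts[OF e] j] by (simp add: h out_arcs_def)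
  then show "adj X (R h) \<otimes> R h = (\<Oplus>b\<in>{b \<in> arcs H. tail H b = head H h}. R b \<otimes> adj X (R b))"
    by (simp only: h R_source[OF e j] sum_Sigma[OF class_arcs[OF e j]])
qed

end


section \<open>Homomorphisms out of a Cuntz--Krieger algebra\<close>

definition contractive_hom :: "'a cstar \<Rightarrow> 'b cstar \<Rightarrow> ('a \<Rightarrow> 'b) \<Rightarrow> bool" where
  "contractive_hom A B f \<longleftrightarrow> star_hom A B f \<and> (\<forall>x\<in>carrier A. nrm B (f x) \<le> nrm A x)"

lemma contractive_homD:
  assumes "contractive_hom A B f"
  shows "star_hom A B f" "x \<in> carrier A \<Longrightarrow> nrm B (f x) \<le> nrm A x"
  using assms by (auto simp: contractive_hom_def)

lemma contractive_hom_id: "contractive_hom A A (\<lambda>x. x)"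
  by (auto simp: contractive_hom_def star_hom_def Ring.ring_hom_def)

lemma contractive_hom_comp:
  assumes f: "contractive_hom A B f" and g: "contractive_hom B C g"
  shows "contractive_hom A C (\<lambda>x. g (f x))"
proof -
  note fh = contractive_homD(1)[OF f] and gh = contractive_homD(1)[OF g]
  have "star_hom A C (\<lambda>x. g (f x))"
    unfolding star_hom_def Ring.ring_hom_def by (auto simp: star_homD[OF fh] star_homD[OF gh])
  moreover have "nrm C (g (f x)) \<le> nrm A x" if "x \<in> carrier A" for x
    using contractive_homD(2)[OF g star_homD(1)[OF fh that]] contractive_homD(2)[OF f that] by simp
  ultimately show ?thesis by (simp add: contractive_hom_def)
qed

lemma cstar_iso_contractive: "cstar_iso A B f \<Longrightarrow> contractive_hom A B f"
  by (simp add: cstar_iso_def contractive_hom_def)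

lemma star_hom_finsum:
  assumes f: "star_hom A B f" and A: "cstar_algebra A" and B: "cstar_algebra B"
    and I: "finite I" "\<And>i. i \<in> I \<Longrightarrow> g i \<in> carrier A"
  shows "f (finsum A g I) = (\<Oplus>\<^bsub>B\<^esub>i\<in>I. f (g i))"
proof -
  interpret A: cstar_algebra A by (rule A)
  interpret B: cstar_algebra B by (rule B)
  note h = star_homD[OF f]
  have f0: "f \<zero>\<^bsub>A\<^esub> = \<zero>\<^bsub>B\<^esub>" using h(5)[of "\<zero>\<^bsub>A\<^esub>" 0] h(1)[of "\<zero>\<^bsub>A\<^esub>"] by simp
  show ?thesis using I by (induction I) (auto simp: f0 h(1,2) Pi_def)
qed

lemma ck_family_star_hom:
  assumes f: "star_hom A B f" and A: "cstar_algebra A" and B: "cstar_algebra B"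
    and fin: "finite (arcs G)" and S: "ck_family G A S"
  shows "ck_family G B (\<lambda>a. f (S a))"
proof -
  interpret A: cstar_algebra A by (rule A)
  interpret B: cstar_algebra B by (rule B)
  note h = star_homD[OF f]
  have c: "a \<in> arcs G \<Longrightarrow> S a \<in> carrier A" for a using S by (simp add: ck_family_def partial_isometry_def)
  have e: "f (S a \<otimes>\<^bsub>A\<^esub> adj A (S a)) = f (S a) \<otimes>\<^bsub>B\<^esub> adj B (f (S a))"
    "f (adj A (S a) \<otimes>\<^bsub>A\<^esub> S a) = adj B (f (S a)) \<otimes>\<^bsub>B\<^esub> f (S a)"
    "f (S a \<otimes>\<^bsub>A\<^esub> adj A (S a) \<otimes>\<^bsub>A\<^esub> S a) = f (S a) \<otimes>\<^bsub>B\<^esub> adj B (f (S a)) \<otimes>\<^bsub>B\<^esub> f (S a)"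
    if "a \<in> arcs G" for a using c[OF that] by (simp_all add: h)
  have sum: "(\<Oplus>\<^bsub>B\<^esub>a\<in>I. f (S a) \<otimes>\<^bsub>B\<^esub> adj B (f (S a))) = f (\<Oplus>\<^bsub>A\<^esub>a\<in>I. S a \<otimes>\<^bsub>A\<^esub> adj A (S a))"
    if "I \<subseteq> arcs G" for I
  proof -
    have "f (\<Oplus>\<^bsub>A\<^esub>a\<in>I. S a \<otimes>\<^bsub>A\<^esub> adj A (S a)) = (\<Oplus>\<^bsub>B\<^esub>a\<in>I. f (S a \<otimes>\<^bsub>A\<^esub> adj A (S a)))"
      using that c finite_subset[OF that fin] by (intro star_hom_finsum[OF f A B]) auto
    also have "\<dots> = (\<Oplus>\<^bsub>B\<^esub>a\<in>I. f (S a) \<otimes>\<^bsub>B\<^esub> adj B (f (S a)))"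
      using that c by (intro B.finsum_cong') (auto simp: e h(1))
    finally show ?thesis by simp
  qed
  have "{b \<in> arcs G. tail G b = v} \<subseteq> arcs G" for v by blast
  from sum[OF this] sum[OF subset_refl] e S c show ?thesis
    unfolding ck_family_def partial_isometry_def by (auto simp: h(1,4))
qed

text \<open>The images of the generators under a homomorphism form a Cuntz--Krieger family again, so that
uniqueness is an instance of the universal property.\<close>

lemma cuntz_krieger_hom_unique:
  assumes B: "cstar_algebra B" and fin: "finite (arcs (graph_of A))"
    and f: "contractive_hom (cuntz_krieger A) B f" and g: "contractive_hom (cuntz_krieger A) B g"
    and eq: "\<And>a. a \<in> arcs (graph_of A) \<Longrightarrow> f (ck_gen A a) = g (ck_gen A a)"
    and x: "x \<in> carrier (cuntz_krieger A)"
  shows "f x = g x"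
proof -
  define X where "X = cuntz_krieger A"
  interpret X: cstar_algebra X unfolding X_def by (rule cuntz_krieger_cstar_algebra)
  note fam = cuntz_krieger_family[of A, folded X_def]
  have gen: "a \<in> arcs (graph_of A) \<Longrightarrow> ck_gen A a \<in> carrier X" for a
    using fam by (simp add: ck_family_def partial_isometry_def)
  have f: "contractive_hom X B f" and g: "contractive_hom X B g" using f g by (simp_all add: X_def)
  define good where "good h \<longleftrightarrow> h \<in> extensional (carrier X) \<and> star_hom X B h \<and>
    (\<forall>x\<in>carrier X. nrm B (h x) \<le> nrm X x) \<and> (\<forall>a\<in>arcs (graph_of A). h (ck_gen A a) = f (ck_gen A a))" for h
  have "ck_family (graph_of A) B (\<lambda>a. f (ck_gen A a))"
    by (rule ck_family_star_hom[OF contractive_homD(1)[OF f] X.cstar_algebra_axioms B fin fam])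
  then have ex1: "\<exists>!h. good h"
    using cuntz_krieger_universal[OF B] unfolding good_def X_def by blast
  have "good (restrict h (carrier X))" if h: "contractive_hom X B h"
    and "\<And>a. a \<in> arcs (graph_of A) \<Longrightarrow> h (ck_gen A a) = f (ck_gen A a)" for h
    using contractive_homD[OF h] that(2) gen star_homD[OF contractive_homD(1)[OF h]]
    unfolding good_def star_hom_def[of X B "restrict h (carrier X)"] Ring.ring_hom_def by auto
  from this[OF f] this[OF g] eq have "good (restrict f (carrier X))" "good (restrict g (carrier X))" by auto
  then have "restrict f (carrier X) = restrict g (carrier X)" using ex1 by blast
  then show ?thesis using x by (metis X_def restrict_apply')
qed

lemma cuntz_krieger_hom_exists:
  assumes "cstar_algebra B" "ck_family (graph_of A) B T"
  obtains f where "contractive_hom (cuntz_krieger A) B f"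
    "\<And>a. a \<in> arcs (graph_of A) \<Longrightarrow> f (ck_gen A a) = T a"
  using cuntz_krieger_universal[OF assms] unfolding contractive_hom_def by blast

section \<open>Graph isomorphisms\<close>

text \<open>The Cuntz--Krieger relations see the vertices only through the incidence of the head of one edge with
the tail of another, so vertices need not be matched explicitly.\<close>

lemma ck_family_relabel:
  assumes A: "cstar_algebra A" and bij: "bij_betw \<theta> (arcs H) (arcs K)"
    and inc: "\<And>g h. g \<in> arcs H \<Longrightarrow> h \<in> arcs H \<Longrightarrow> tail K (\<theta> g) = head K (\<theta> h) \<longleftrightarrow> tail H g = head H h"
    and S: "ck_family K A S"
  shows "ck_family H A (\<lambda>h. S (\<theta> h))"
proof -
  interpret cstar_algebra A by (rule A)
  have K: "arcs K = \<theta> ` arcs H" and inj: "inj_on \<theta> (arcs H)" using bij by (auto simp: bij_betw_def)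
  have c: "h \<in> arcs H \<Longrightarrow> S (\<theta> h) \<in> carrier A" for h
    using S by (simp add: ck_family_def partial_isometry_def K)
  have sum: "(\<Oplus>\<^bsub>A\<^esub>b\<in>\<theta> ` I. S b \<otimes>\<^bsub>A\<^esub> adj A (S b)) = (\<Oplus>\<^bsub>A\<^esub>h\<in>I. S (\<theta> h) \<otimes>\<^bsub>A\<^esub> adj A (S (\<theta> h)))"
    if "I \<subseteq> arcs H" for I
    using that c by (intro finsum_reindex) (auto intro: inj_on_subset[OF inj])
  have out: "{b \<in> arcs K. tail K b = head K (\<theta> h)} = \<theta> ` {g \<in> arcs H. tail H g = head H h}"
    if "h \<in> arcs H" for h using that inc by (auto simp: K)
  have "{g \<in> arcs H. tail H g = head H h} \<subseteq> arcs H" for h by blast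
  from sum[OF this] sum[OF subset_refl] out S show ?thesis
    unfolding ck_family_def by (simp add: K)
qed

lemma graph_of_simps [simp]:
  "arcs (graph_of A) = {(i, j, k). i < dim_row A \<and> j < dim_row A \<and> k < A $$ (i, j)}"
  "verts (graph_of A) = {..<dim_row A}"
  "tail (graph_of A) (i, j, k) = i" "head (graph_of A) (i, j, k) = j"
  by (simp_all add: graph_of_def)

lemma finite_arcs_graph_of: "finite (arcs (graph_of A))"
proof -
  have "arcs (graph_of A) = (SIGMA i:{..<dim_row A}. SIGMA j:{..<dim_row A}. {..<A $$ (i, j)})" by auto
  then show ?thesis by simp
qed

text \<open>A finite graph is recovered from its transition matrix by numbering the edges between any two
vertices.\<close>

lemma transition_graph_iso:
  assumes fin: "finite (arcs H)" and vs: "distinct vs" "set vs = verts H"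
    and wf: "\<And>h. h \<in> arcs H \<Longrightarrow> head H h \<in> verts H" "\<And>h. h \<in> arcs H \<Longrightarrow> tail H h \<in> verts H"
  obtains \<theta> where "bij_betw \<theta> (arcs H) (arcs (graph_of (transition_matrix H vs)))"
    "\<And>g h. g \<in> arcs H \<Longrightarrow> h \<in> arcs H \<Longrightarrow>
      tail (graph_of (transition_matrix H vs)) (\<theta> g) = head (graph_of (transition_matrix H vs)) (\<theta> h)
        \<longleftrightarrow> tail H g = head H h"
proof -
  define E where "E u v = {h \<in> arcs H. tail H h = u \<and> head H h = v}" for u v
  have "finite (E u v)" for u v using fin by (simp add: E_def)
  then have "\<exists>b. bij_betw b (E u v) {0..<card (E u v)}" for u v by (rule ex_bij_betw_finite_nat)
  then obtain b where b: "bij_betw (b u v) (E u v) {0..<card (E u v)}" for u v by metis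
  have "inj_on ((!) vs) {..<length vs}" using vs(1) by (auto simp: inj_on_def nth_eq_iff_index_eq)
  then obtain \<nu> where \<nu>: "\<And>i. i < length vs \<Longrightarrow> \<nu> (vs ! i) = i"
    using the_inv_into_f_f[of "(!) vs" "{..<length vs}"] by (metis lessThan_iff)
  have \<nu>v: "\<nu> v < length vs" "vs ! \<nu> v = v" if "v \<in> verts H" for v
    using that \<nu> unfolding vs(2)[symmetric] by (metis in_set_conv_nth)+
  define \<theta> where "\<theta> h = (\<nu> (tail H h), \<nu> (head H h), b (tail H h) (head H h) h)" for h
  let ?K = "graph_of (transition_matrix H vs)"
  have K: "arcs ?K = {(i, j, k). i < length vs \<and> j < length vs \<and> k < card (E (vs ! i) (vs ! j))}"
    by (auto simp: transition_matrix_def E_def)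
  have bij: "bij_betw \<theta> (arcs H) (arcs ?K)"
  proof (rule bij_betw_imageI)
    show "inj_on \<theta> (arcs H)"
    proof (rule inj_onI)
      fix g h assume gh: "g \<in> arcs H" "h \<in> arcs H" "\<theta> g = \<theta> h"
      have "tail H g = tail H h" "head H g = head H h"
        using gh \<nu>v(2)[OF wf(1)] \<nu>v(2)[OF wf(2)] by (metis \<theta>_def Pair_inject)+
      then show "g = h"
        using gh bij_betw_imp_inj_on[OF b[of "tail H g" "head H g"]]
        by (auto simp: \<theta>_def E_def dest: inj_onD)
    qed
    have "\<theta> h \<in> arcs ?K" if h: "h \<in> arcs H" for h
      using bij_betwE[OF b[of "tail H h" "head H h"]] h \<nu>v[OF wf(1)[OF h]] \<nu>v[OF wf(2)[OF h]]
      unfolding K by (auto simp: \<theta>_def E_def)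
    moreover have "x \<in> \<theta> ` arcs H" if x: "x \<in> arcs ?K" for x
    proof -
      obtain i j k where x: "x = (i, j, k)" "i < length vs" "j < length vs" "k < card (E (vs ! i) (vs ! j))"
        using x unfolding K by auto
      then obtain h where "h \<in> E (vs ! i) (vs ! j)" "b (vs ! i) (vs ! j) h = k"
        using bij_betw_imp_surj_on[OF b[of "vs ! i" "vs ! j"]] by (metis atLeast0LessThan imageE lessThan_iff)
      then have "\<theta> h = x" "h \<in> arcs H" using x \<nu> by (auto simp: \<theta>_def E_def)
      then show ?thesis by blast
    qed
    ultimately show "\<theta> ` arcs H = arcs ?K" by blast
  qed
  have "tail ?K (\<theta> g) = head ?K (\<theta> h) \<longleftrightarrow> tail H g = head H h" if "g \<in> arcs H" "h \<in> arcs H" for g h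
    using \<nu>v(2)[OF wf(2)[OF that(1)]] \<nu>v(2)[OF wf(1)[OF that(2)]] by (metis \<theta>_def graph_of_simps(3,4))
  with bij show ?thesis using that by blast
qed

section \<open>The diagonal subalgebra\<close>

lemma cstar_subalgebraD:
  assumes "cstar_subalgebra A D"
  shows "x \<in> D \<Longrightarrow> x \<in> carrier A" "\<zero>\<^bsub>A\<^esub> \<in> D"
    "x \<in> D \<Longrightarrow> y \<in> D \<Longrightarrow> x \<oplus>\<^bsub>A\<^esub> y \<in> D" "x \<in> D \<Longrightarrow> y \<in> D \<Longrightarrow> x \<otimes>\<^bsub>A\<^esub> y \<in> D"
    "x \<in> D \<Longrightarrow> adj A x \<in> D" "x \<in> D \<Longrightarrow> scal A c x \<in> D"
    "(\<And>n. X n \<in> D) \<Longrightarrow> x \<in> carrier A \<Longrightarrow> (\<lambda>n. nrm A (X (n::nat) \<ominus>\<^bsub>A\<^esub> x)) \<longlonglongrightarrow> 0 \<Longrightarrow> x \<in> D"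
  using assms unfolding cstar_subalgebra_def by blast+

lemma generated_subset: "cstar_subalgebra A D \<Longrightarrow> M \<subseteq> D \<Longrightarrow> generated_cstar_subalgebra A M \<subseteq> D"
  by (auto simp: generated_cstar_subalgebra_def)

lemma generated_superset: "M \<subseteq> generated_cstar_subalgebra A M"
  by (auto simp: generated_cstar_subalgebra_def)

lemma preimage_subalgebra:
  assumes A: "cstar_algebra A" and B: "cstar_algebra B" and f: "contractive_hom A B f"
    and D: "cstar_subalgebra B D"
  shows "cstar_subalgebra A {x \<in> carrier A. f x \<in> D}"
proof -
  interpret A: cstar_algebra A by (rule A)
  interpret B: cstar_algebra B by (rule B)
  note fs = contractive_homD(1)[OF f]
  note h = star_homD[OF fs]
  note d = cstar_subalgebraD[OF D]
  have f0: "f \<zero>\<^bsub>A\<^esub> = \<zero>\<^bsub>B\<^esub>" using h(5)[of "\<zero>\<^bsub>A\<^esub>" 0] h(1)[of "\<zero>\<^bsub>A\<^esub>"] by simp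
  have lim: "f x \<in> D" if X': "\<forall>n. X n \<in> carrier A \<and> f (X n) \<in> D" and x: "x \<in> carrier A"
    and l: "(\<lambda>n. nrm A (X (n::nat) \<ominus>\<^bsub>A\<^esub> x)) \<longlonglongrightarrow> 0" for X x
  proof -
    have X: "X n \<in> carrier A" "f (X n) \<in> D" for n using X' by auto
    have "nrm B (f (X n) \<ominus>\<^bsub>B\<^esub> f x) \<le> nrm A (X n \<ominus>\<^bsub>A\<^esub> x)" for n
      using contractive_homD(2)[OF f, of "X n \<ominus>\<^bsub>A\<^esub> x"] X(1) x by (simp add: star_hom_minus[OF fs A B])
    then have "B.lim_to (\<lambda>n. f (X n)) (f x)" by (rule B.lim_toI[OF h(1)[OF X(1)] h(1)[OF x] _ l])
    then show ?thesis using d(7)[OF X(2) h(1)[OF x]] by (simp add: B.lim_to_def)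
  qed
  show ?thesis
    unfolding cstar_subalgebra_def using h d(2-6) f0 lim by (intro conjI ballI allI impI) auto
qed

definition path_element :: "'a cstar \<Rightarrow> ('e \<Rightarrow> 'a) \<Rightarrow> 'e list \<Rightarrow> 'a" where
  "path_element A S \<mu> = foldr (\<lambda>a x. S a \<otimes>\<^bsub>A\<^esub> x) \<mu> \<one>\<^bsub>A\<^esub>"

definition diagonal :: "'a cstar \<Rightarrow> ('v, 'e) pre_digraph \<Rightarrow> ('e \<Rightarrow> 'a) \<Rightarrow> 'a set" where
  "diagonal A G S = generated_cstar_subalgebra A
     {path_element A S \<mu> \<otimes>\<^bsub>A\<^esub> adj A (path_element A S \<mu>) | \<mu>. \<mu> \<noteq> [] \<and> set \<mu> \<subseteq> arcs G}"

lemma ck_diagonal_eq: "ck_diagonal A = diagonal (cuntz_krieger A) (graph_of A) (ck_gen A)"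
  by (simp add: ck_diagonal_def diagonal_def ck_word_def path_element_def)

lemma path_element_simps [simp]:
  "path_element A S [] = \<one>\<^bsub>A\<^esub>" "path_element A S (a # \<mu>) = S a \<otimes>\<^bsub>A\<^esub> path_element A S \<mu>"
  by (simp_all add: path_element_def)

lemma diagonal_relabel:
  assumes "bij_betw \<theta> (arcs H) (arcs K)"
  shows "diagonal A H (\<lambda>h. S (\<theta> h)) = diagonal A K S"
proof -
  have W: "path_element A (\<lambda>h. S (\<theta> h)) \<mu> = path_element A S (map \<theta> \<mu>)" for \<mu>
    by (induction \<mu>) auto
  have K: "arcs K = \<theta> ` arcs H" using assms by (simp add: bij_betw_def)
  have surj: "\<exists>\<mu>. \<nu> = map \<theta> \<mu> \<and> set \<mu> \<subseteq> arcs H" if "set \<nu> \<subseteq> arcs K" for \<nu>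
    using that
  proof (induction \<nu>)
    case (Cons k \<nu>)
    then obtain h \<mu> where "h \<in> arcs H" "k = \<theta> h" "\<nu> = map \<theta> \<mu>" "set \<mu> \<subseteq> arcs H" by (auto simp: K)
    then show ?case by (intro exI[of _ "h # \<mu>"]) simp
  qed simp
  have "{path_element A S (map \<theta> \<mu>) \<otimes>\<^bsub>A\<^esub> adj A (path_element A S (map \<theta> \<mu>)) | \<mu>. \<mu> \<noteq> [] \<and> set \<mu> \<subseteq> arcs H}
      = {path_element A S \<mu> \<otimes>\<^bsub>A\<^esub> adj A (path_element A S \<mu>) | \<mu>. \<mu> \<noteq> [] \<and> set \<mu> \<subseteq> arcs K}" (is "?L = ?R")
  proof
    show "?L \<subseteq> ?R"
    proof
      fix x assume "x \<in> ?L"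
      then obtain \<mu> where "x = path_element A S (map \<theta> \<mu>) \<otimes>\<^bsub>A\<^esub> adj A (path_element A S (map \<theta> \<mu>))"
        "\<mu> \<noteq> []" "set \<mu> \<subseteq> arcs H" by blast
      moreover from this have "map \<theta> \<mu> \<noteq> []" "set (map \<theta> \<mu>) \<subseteq> arcs K" by (auto simp: K)
      ultimately show "x \<in> ?R" by blast
    qed
    show "?R \<subseteq> ?L"
    proof
      fix x assume "x \<in> ?R"
      then obtain \<nu> where \<nu>: "x = path_element A S \<nu> \<otimes>\<^bsub>A\<^esub> adj A (path_element A S \<nu>)"
        "\<nu> \<noteq> []" "set \<nu> \<subseteq> arcs K" by blast
      obtain \<mu> where "\<nu> = map \<theta> \<mu>" "set \<mu> \<subseteq> arcs H" using surj[OF \<nu>(3)] by blast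
      with \<nu> show "x \<in> ?L" by auto
    qed
  qed
  then show ?thesis by (simp add: diagonal_def W)
qed

context cstar_algebra
begin

lemma path_element_closed:
  "(\<And>a. a \<in> E \<Longrightarrow> S a \<in> carrier A) \<Longrightarrow> set \<mu> \<subseteq> E \<Longrightarrow> path_element A S \<mu> \<in> carrier A"
  by (induction \<mu>) auto

lemma carrier_subalgebra: "cstar_subalgebra A (carrier A)"
  by (simp add: cstar_subalgebra_def)

lemma generated_subalgebra:
  assumes "M \<subseteq> carrier A" shows "cstar_subalgebra A (generated_cstar_subalgebra A M)"
proof -
  let ?D = "generated_cstar_subalgebra A M"
  have memI: "x \<in> ?D" if "\<And>D. cstar_subalgebra A D \<Longrightarrow> M \<subseteq> D \<Longrightarrow> x \<in> D" for x
    using that by (simp add: generated_cstar_subalgebra_def)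
  have memD: "x \<in> D" if "x \<in> ?D" "cstar_subalgebra A D" "M \<subseteq> D" for x D
    using that by (simp add: generated_cstar_subalgebra_def)
  have "?D \<subseteq> carrier A" by (rule generated_subset[OF carrier_subalgebra assms])
  moreover have "\<zero> \<in> ?D" by (rule memI) (rule cstar_subalgebraD(2))
  moreover have "x \<oplus> y \<in> ?D" if "x \<in> ?D" "y \<in> ?D" for x y
    by (rule memI, rule cstar_subalgebraD(3)) (use that memD in auto)
  moreover have "x \<otimes> y \<in> ?D" if "x \<in> ?D" "y \<in> ?D" for x y
    by (rule memI, rule cstar_subalgebraD(4)) (use that memD in auto)
  moreover have "adj A x \<in> ?D" if "x \<in> ?D" for x
    by (rule memI, rule cstar_subalgebraD(5)) (use that memD in auto)
  moreover have "scal A c x \<in> ?D" if "x \<in> ?D" for x c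
    by (rule memI, rule cstar_subalgebraD(6)) (use that memD in auto)
  moreover have "x \<in> ?D" if "\<forall>n. X n \<in> ?D" "x \<in> carrier A" "(\<lambda>n. nrm A (X (n::nat) \<ominus> x)) \<longlonglongrightarrow> 0" for X x
    by (rule memI, rule cstar_subalgebraD(7)[OF _ _ that(2,3)]) (use that(1) memD in auto)
  ultimately show ?thesis
    unfolding cstar_subalgebra_def[of A ?D] by simp
qed

lemma subalgebra_finsum:
  assumes D: "cstar_subalgebra A D" and f: "finite I" "\<And>i. i \<in> I \<Longrightarrow> f i \<in> D"
  shows "finsum A f I \<in> D"
  using f
proof (induction I)
  case (insert i I)
  then show ?case using cstar_subalgebraD(1,3)[OF D] by (subst finsum_insert) auto
qed (use cstar_subalgebraD(2)[OF D] in simp)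

lemma lim_to_const: "c \<in> carrier A \<Longrightarrow> lim_to (\<lambda>n. c) c"
  by (simp add: lim_to_def a_minus_def r_neg)

lemma commutant_subalgebra:
  assumes y: "y \<in> carrier A" "adj A y = y"
  shows "cstar_subalgebra A {x \<in> carrier A. x \<otimes> y = y \<otimes> x}"
  unfolding cstar_subalgebra_def
proof (intro conjI ballI allI impI)
  fix X x
  assume x: "x \<in> carrier A" and X: "\<forall>n::nat. X n \<in> {x \<in> carrier A. x \<otimes> y = y \<otimes> x}"
    and l: "(\<lambda>n. nrm A (X n \<ominus> x)) \<longlonglongrightarrow> 0"
  have l: "lim_to X x" using l by (simp add: lim_to_def)
  have Xc: "X n \<in> carrier A" "X n \<otimes> y = y \<otimes> X n" for n using X by auto
  have "lim_to (\<lambda>n. X n \<otimes> y) (x \<otimes> y)" "lim_to (\<lambda>n. y \<otimes> X n) (y \<otimes> x)"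
    using Xc(1) x y l lim_to_const by (auto intro!: lim_to_mult)
  then have "x \<otimes> y = y \<otimes> x"
    using lim_to_unique[of "\<lambda>n. X n \<otimes> y" "x \<otimes> y" "y \<otimes> x"] Xc x y by simp
  with x show "x \<in> {x \<in> carrier A. x \<otimes> y = y \<otimes> x}" by simp
next
  fix x z assume x: "x \<in> {x \<in> carrier A. x \<otimes> y = y \<otimes> x}" and z: "z \<in> {x \<in> carrier A. x \<otimes> y = y \<otimes> x}"
  then show "x \<oplus> z \<in> {x \<in> carrier A. x \<otimes> y = y \<otimes> x}" using y by (simp add: l_distr r_distr)
  from x z have c: "x \<in> carrier A" "z \<in> carrier A" and comm: "x \<otimes> y = y \<otimes> x" "z \<otimes> y = y \<otimes> z" by auto
  have "x \<otimes> z \<otimes> y = x \<otimes> (y \<otimes> z)" by (simp only: m_assoc[OF c y(1)] comm(2))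
  also have "\<dots> = y \<otimes> (x \<otimes> z)" by (simp only: m_assoc[OF c(1) y(1) c(2), symmetric] comm(1) m_assoc[OF y(1) c])
  finally show "x \<otimes> z \<in> {x \<in> carrier A. x \<otimes> y = y \<otimes> x}" using c by simp
next
  fix x assume x: "x \<in> {x \<in> carrier A. x \<otimes> y = y \<otimes> x}"
  then have c: "x \<in> carrier A" and "adj A (y \<otimes> x) = adj A (x \<otimes> y)" by simp_all
  then have "adj A x \<otimes> y = y \<otimes> adj A x" using y by (simp only: adj_mult)
  then show "adj A x \<in> {x \<in> carrier A. x \<otimes> y = y \<otimes> x}" using c by simp
qed (use y in \<open>auto simp: scal_mult_left scal_mult_right\<close>)

text \<open>The generators of the diagonal arise from the unit by applying the maps \<open>x \<mapsto> U\<^sub>b x U\<^sub>b\<^sup>*\<close> repeatedly.\<close>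

lemma diagonal_subset:
  assumes D: "cstar_subalgebra A D" "\<one> \<in> D" and U: "\<And>b. b \<in> arcs G \<Longrightarrow> U b \<in> carrier A"
    and conj: "\<And>b x. b \<in> arcs G \<Longrightarrow> x \<in> D \<Longrightarrow> U b \<otimes> x \<otimes> adj A (U b) \<in> D"
  shows "diagonal A G U \<subseteq> D"
proof -
  have "path_element A U \<mu> \<otimes> adj A (path_element A U \<mu>) \<in> D" if "set \<mu> \<subseteq> arcs G" for \<mu>
    using that
  proof (induction \<mu>)
    case (Cons b \<mu>)
    then show ?case
      using conj[of b "path_element A U \<mu> \<otimes> adj A (path_element A U \<mu>)"] U[of b]
        path_element_closed[of "arcs G" U \<mu>] U by (simp add: adj_mult m_assoc)
  qed (use D in simp)
  then show ?thesis unfolding diagonal_def by (intro generated_subset[OF D(1)]) auto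
qed

end

context ck_system
begin

abbreviation D where "D \<equiv> diagonal A G S"

lemma diagonal_subalgebra: "cstar_subalgebra A D"
  unfolding diagonal_def
proof (rule generated_subalgebra)
  have "path_element A S \<mu> \<in> carrier A" if "set \<mu> \<subseteq> arcs G" for \<mu>
    by (rule path_element_closed[OF S_closed that])
  then show "{path_element A S \<mu> \<otimes> adj A (path_element A S \<mu>) | \<mu>. \<mu> \<noteq> [] \<and> set \<mu> \<subseteq> arcs G} \<subseteq> carrier A"
    by auto
qed

lemmas diagonalD = cstar_subalgebraD[OF diagonal_subalgebra]

lemma path_projection_mem:
  "\<mu> \<noteq> [] \<Longrightarrow> set \<mu> \<subseteq> arcs G \<Longrightarrow> path_element A S \<mu> \<otimes> adj A (path_element A S \<mu>) \<in> D"
  unfolding diagonal_def by (rule subsetD[OF generated_superset]) blast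

lemma range_sum_mem: "F \<subseteq> arcs G \<Longrightarrow> range_sum F \<in> D"
  unfolding range_sum_def
  using path_projection_mem[of "[a]" for a] finite_subset[OF _ finite_arcs]
  by (intro subalgebra_finsum[OF diagonal_subalgebra]) auto

lemma one_mem: "\<one> \<in> D"
  using range_sum_mem[OF subset_refl] by (simp add: range_sum_arcs)

text \<open>A range projection either fixes or kills the element of a nonempty path, depending on the first edge, and
so commutes with the generators of the diagonal.\<close>

lemma diagonal_commute:
  assumes x: "x \<in> D" and F: "F \<subseteq> arcs G" shows "x \<otimes> range_sum F = range_sum F \<otimes> x"
proof -
  have "path_element A S \<mu> \<otimes> adj A (path_element A S \<mu>) \<in> {x \<in> carrier A. x \<otimes> range_sum F = range_sum F \<otimes> x}"
    if \<mu>: "\<mu> \<noteq> []" "set \<mu> \<subseteq> arcs G" for \<mu>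
  proof -
    obtain a \<nu> where a: "\<mu> = a # \<nu>" "a \<in> arcs G" "set \<nu> \<subseteq> arcs G" using \<mu> by (cases \<mu>) auto
    define w where "w = path_element A S \<mu>"
    have w: "w \<in> carrier A" unfolding w_def using \<mu>(2) by (intro path_element_closed) auto
    have wF: "range_sum F \<otimes> w = (if a \<in> F then w else \<zero>)"
      using a path_element_closed[of "arcs G" S \<nu>] F
      by (simp add: w_def m_assoc[symmetric] range_sum_mult_S)
    have "adj A w \<otimes> range_sum F = adj A (range_sum F \<otimes> w)" using w F by (simp add: adj_mult range_sum_adj)
    then have "w \<otimes> adj A w \<otimes> range_sum F = range_sum F \<otimes> (w \<otimes> adj A w)"
      using w F wF by (simp add: m_assoc) (simp add: m_assoc[symmetric])
    then show ?thesis using w by (simp add: w_def)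
  qed
  then have "D \<subseteq> {x \<in> carrier A. x \<otimes> range_sum F = range_sum F \<otimes> x}"
    unfolding diagonal_def using F by (intro generated_subset commutant_subalgebra) (auto simp: range_sum_adj)
  then show ?thesis using x by blast
qed

text \<open>The map \<open>x \<mapsto> S\<^sub>a x S\<^sub>a\<^sup>*\<close> sends generators to generators by prolonging the path. On the diagonal it is
multiplicative, because diagonal elements commute with the source projection of \<open>S\<^sub>a\<close>; hence the
elements sent into the diagonal form a C*-subalgebra.\<close>

lemma diagonal_conj:
  assumes x: "x \<in> D" and a: "a \<in> arcs G" shows "S a \<otimes> x \<otimes> adj A (S a) \<in> D"
proof -
  let ?c = "\<lambda>x. S a \<otimes> x \<otimes> adj A (S a)"
  let ?E = "{x \<in> D. ?c x \<in> D}"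
  have mult: "?c (x \<otimes> y) = ?c x \<otimes> ?c y" if xy: "x \<in> D" "y \<in> D" for x y
  proof -
    let ?q = "range_sum (out_arcs G (head G a))"
    note c = diagonalD(1)[OF xy(1)] diagonalD(1)[OF xy(2)]
    have "?c x \<otimes> ?c y = S a \<otimes> (x \<otimes> (adj A (S a) \<otimes> S a)) \<otimes> y \<otimes> adj A (S a)"
      using c a by (simp add: m_assoc)
    also have "\<dots> = S a \<otimes> (?q \<otimes> x) \<otimes> y \<otimes> adj A (S a)"
      by (simp only: source_eq[OF a] diagonal_commute[OF xy(1) out_arcs_sub])
    also have "\<dots> = (S a \<otimes> ?q) \<otimes> x \<otimes> y \<otimes> adj A (S a)" using c a by (simp add: m_assoc)
    finally show ?thesis using c a by (simp add: S_mult_range_sum m_assoc)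
  qed
  have "cstar_subalgebra A ?E"
    unfolding cstar_subalgebra_def
  proof (intro conjI ballI allI impI)
    fix X x assume x: "x \<in> carrier A" and X: "\<forall>n::nat. X n \<in> ?E" and l: "(\<lambda>n. nrm A (X n \<ominus> x)) \<longlonglongrightarrow> 0"
    have XD: "X n \<in> D" "?c (X n) \<in> D" "X n \<in> carrier A" for n using X diagonalD(1) by auto
    have "lim_to (\<lambda>n. ?c (X n)) (?c x)"
      using XD(3) x a l by (intro lim_to_mult lim_to_const) (auto simp: lim_to_def)
    then have "?c x \<in> D" using diagonalD(7)[OF XD(2)] x a by (simp add: lim_to_def)
    then show "x \<in> ?E" using diagonalD(7)[OF XD(1) x l] by simp
  next
    fix x y assume xy: "x \<in> ?E" "y \<in> ?E"
    then have "?c (x \<oplus> y) = ?c x \<oplus> ?c y" using a diagonalD(1) by (simp add: l_distr r_distr)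
    with xy show "x \<oplus> y \<in> ?E" using diagonalD(3) by auto
    show "x \<otimes> y \<in> ?E" using xy diagonalD(4) by (auto simp: mult)
  next
    fix x c assume x: "x \<in> ?E"
    then have "?c (adj A x) = adj A (?c x)" "?c (scal A c x) = scal A c (?c x)"
      using a diagonalD(1) by (simp_all add: adj_mult adj_adj scal_mult_left scal_mult_right m_assoc)
    with x show "adj A x \<in> ?E" "scal A c x \<in> ?E" using diagonalD(5,6) by auto
  qed (use a diagonalD(1,2) in auto)
  moreover have "path_element A S \<mu> \<otimes> adj A (path_element A S \<mu>) \<in> ?E" if \<mu>: "\<mu> \<noteq> []" "set \<mu> \<subseteq> arcs G" for \<mu>
  proof -
    have "?c (path_element A S \<mu> \<otimes> adj A (path_element A S \<mu>))
        = path_element A S (a # \<mu>) \<otimes> adj A (path_element A S (a # \<mu>))"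
      using a \<mu> path_element_closed[of "arcs G" S \<mu>] by (simp add: adj_mult m_assoc)
    then show ?thesis using path_projection_mem[OF \<mu>] path_projection_mem[of "a # \<mu>"] a \<mu> by simp
  qed
  ultimately have "D \<subseteq> ?E" by (subst diagonal_def, intro generated_subset) auto
  then show ?thesis using x by blast
qed

end

lemma (in merging) diagonal_merge_subset: "diagonal Y G M \<subseteq> diagonal Y H S"
proof (rule Y.diagonal_subset[OF Y.diagonal_subalgebra Y.one_mem])
  fix e x assume e: "e \<in> arcs G" and x: "x \<in> Y.D"
  have "M e \<otimes> x \<otimes> adj Y (M e) = (\<Oplus>j\<in>{1..m (head G e)}. S (e, j) \<otimes> x \<otimes> adj Y (S (e, j)))"
    using Y.diagonal_commute[OF x Y.out_arcs_sub] by (rule M_conj[OF e Y.diagonalD(1)[OF x]])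
  also have "\<dots> \<in> Y.D"
    using Y.diagonal_conj[OF x copy[OF e]] by (intro Y.subalgebra_finsum[OF Y.diagonal_subalgebra]) auto
  finally show "M e \<otimes> x \<otimes> adj Y (M e) \<in> Y.D" .
qed simp

lemma (in splitting) diagonal_split_subset: "diagonal X H R \<subseteq> diagonal X G T"
proof (rule X.diagonal_subset[OF X.diagonal_subalgebra X.one_mem])
  fix h x assume "h \<in> arcs H"
  then obtain e j where h: "h = (e, j)" and e: "e \<in> arcs G" and j: "j \<in> {1..m (head G e)}"
    by (auto simp: arcs_H)
  show "R h \<in> carrier X" unfolding h by (rule R_closed[OF e j])
  assume x: "x \<in> X.D"
  show "R h \<otimes> x \<otimes> adj X (R h) \<in> X.D"
    unfolding h R_conj[OF e j X.diagonalD(1)[OF x]]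
    by (intro X.diagonal_conj X.diagonalD(4) X.range_sum_mem x e class_arcs[OF e j])
qed

lemma diagonal_image_subset:
  assumes A: "cstar_algebra A" and B: "cstar_algebra B" and f: "contractive_hom A B f"
    and S: "\<And>a. a \<in> arcs G \<Longrightarrow> S a \<in> carrier A" and S': "\<And>a. a \<in> arcs G \<Longrightarrow> f (S a) = S' a"
  shows "f ` diagonal A G S \<subseteq> diagonal B G S'"
proof -
  interpret A: cstar_algebra A by (rule A)
  interpret B: cstar_algebra B by (rule B)
  note h = star_homD[OF contractive_homD(1)[OF f]]
  have Wc: "path_element A S \<mu> \<in> carrier A" if "set \<mu> \<subseteq> arcs G" for \<mu>
    by (rule A.path_element_closed[OF S that])
  have W: "f (path_element A S \<mu>) = path_element B S' \<mu>" if "set \<mu> \<subseteq> arcs G" for \<mu>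
    using that Wc by (induction \<mu>) (auto simp: h S S')
  have Wc': "path_element B S' \<mu> \<in> carrier B" if "set \<mu> \<subseteq> arcs G" for \<mu>
    using W[OF that] h(1)[OF Wc[OF that]] by simp
  have sub: "cstar_subalgebra B (diagonal B G S')"
    unfolding diagonal_def using Wc' by (intro B.generated_subalgebra) auto
  have "diagonal A G S \<subseteq> {x \<in> carrier A. f x \<in> diagonal B G S'}"
    unfolding diagonal_def[of A]
  proof (intro generated_subset preimage_subalgebra[OF A B f sub] subsetI)
    fix x assume "x \<in> {path_element A S \<mu> \<otimes>\<^bsub>A\<^esub> adj A (path_element A S \<mu>) | \<mu>. \<mu> \<noteq> [] \<and> set \<mu> \<subseteq> arcs G}"
    then obtain \<mu> where \<mu>: "x = path_element A S \<mu> \<otimes>\<^bsub>A\<^esub> adj A (path_element A S \<mu>)" "\<mu> \<noteq> []" "set \<mu> \<subseteq> arcs G"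
      by blast
    then have "f x = path_element B S' \<mu> \<otimes>\<^bsub>B\<^esub> adj B (path_element B S' \<mu>)" using Wc W by (simp add: h)
    also have "\<dots> \<in> diagonal B G S'"
      unfolding diagonal_def using \<mu> by (intro subsetD[OF generated_superset]) blast
    finally show "x \<in> {x \<in> carrier A. f x \<in> diagonal B G S'}" using \<mu> Wc by simp
  qed
  then show ?thesis by blast
qed

section \<open>The isomorphism\<close>

theorem theorem4p2:
  fixes A B :: "nat mat"
    and m :: "nat \<Rightarrow> nat"
    and P :: "nat \<Rightarrow> nat \<Rightarrow> edge set"
    and vs :: "(nat \<times> nat) list"
  assumes "square_mat A"
    and "irreducible_matrix A"
    and "\<not> permutation_matrix A"
    and "out_edge_partition (graph_of A) m P"
    and "distinct vs"
    and "set vs = verts (out_split (graph_of A) m P)"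
    and "B = transition_matrix (out_split (graph_of A) m P) vs"
  shows "\<exists>\<Phi>. cstar_iso (cuntz_krieger A) (cuntz_krieger B) \<Phi> \<and>
    \<Phi> ` ck_diagonal A = ck_diagonal B \<and>
    (\<forall>t::real. \<forall>x\<in>carrier (cuntz_krieger A).
       \<Phi> (gauge_action A t x) = gauge_action B t (\<Phi> x))"
proof -
  define G where "G = graph_of A"
  define K where "K = graph_of B"
  define X where "X = cuntz_krieger A"
  define Y where "Y = cuntz_krieger B"
  define T where "T = ck_gen A"
  define S' where "S' = ck_gen B"
  have fin: "finite (arcs G)" "finite (arcs K)" unfolding G_def K_def by (rule finite_arcs_graph_of)+
  have famT: "ck_family G X T" unfolding G_def X_def T_def by (rule cuntz_krieger_family)
  have famS': "ck_family K Y S'" unfolding K_def Y_def S'_def by (rule cuntz_krieger_family)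
  have XA: "cstar_algebra X" and YA: "cstar_algebra Y"
    unfolding X_def Y_def by (rule cuntz_krieger_cstar_algebra)+
  interpret edge_split G m P
    using fin assms(4) by unfold_locales (auto simp: G_def)
  obtain \<theta> where \<theta>: "bij_betw \<theta> (arcs H) (arcs K)"
    and inc: "\<And>g h. g \<in> arcs H \<Longrightarrow> h \<in> arcs H \<Longrightarrow> tail K (\<theta> g) = head K (\<theta> h) \<longleftrightarrow> tail H g = head H h"
    using transition_graph_iso[OF finite_arcs_H assms(5) assms(6)[folded G_def] H_wf]
    unfolding K_def assms(7) G_def by metis
  define S where "S h = S' (\<theta> h)" for h
  have famS: "ck_family H Y S" unfolding S_def by (rule ck_family_relabel[OF YA \<theta> inc famS'])
  interpret Y: merging G m P Y S
    unfolding merging_def ck_system_def ck_system_axioms_def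
    using edge_split_axioms YA finite_arcs_H famS by blast
  interpret X: splitting G m P X T
    unfolding splitting_def ck_system_def ck_system_axioms_def
    using edge_split_axioms XA fin famT by blast
  define \<theta>' where "\<theta>' = the_inv_into (arcs H) \<theta>"
  have \<theta>': "bij_betw \<theta>' (arcs K) (arcs H)" "\<And>h. h \<in> arcs H \<Longrightarrow> \<theta>' (\<theta> h) = h" "\<And>k. k \<in> arcs K \<Longrightarrow> \<theta> (\<theta>' k) = k"
    unfolding \<theta>'_def using \<theta> bij_betw_the_inv_into[OF \<theta>] the_inv_into_f_f[of \<theta> "arcs H"]
      f_the_inv_into_f_bij_betw[OF \<theta>] by (auto simp: bij_betw_def)
  have famR: "ck_family K X (\<lambda>k. X.R (\<theta>' k))"
  proof (rule ck_family_relabel[OF XA \<theta>'(1) _ X.ck_family_R])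
    fix g h assume "g \<in> arcs K" "h \<in> arcs K"
    then show "tail H (\<theta>' g) = head H (\<theta>' h) \<longleftrightarrow> tail K g = head K h"
      using inc[of "\<theta>' g" "\<theta>' h"] \<theta>' bij_betwE[OF \<theta>'(1)] by auto
  qed
  obtain \<Phi> where \<Phi>: "contractive_hom X Y \<Phi>" and \<Phi>T: "\<And>e. e \<in> arcs G \<Longrightarrow> \<Phi> (T e) = Y.M e"
    using cuntz_krieger_hom_exists[OF YA Y.ck_family_M[unfolded G_def]]
    unfolding X_def T_def G_def by metis
  obtain \<Psi> where \<Psi>: "contractive_hom Y X \<Psi>" and "\<And>k. k \<in> arcs K \<Longrightarrow> \<Psi> (S' k) = X.R (\<theta>' k)"
    using cuntz_krieger_hom_exists[OF XA famR[unfolded K_def]]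
    unfolding Y_def S'_def K_def by metis
  then have \<Psi>S: "\<Psi> (S h) = X.R h" if "h \<in> arcs H" for h
    using that \<theta>'(2) bij_betwE[OF \<theta>] by (auto simp: S_def)
  note \<Phi>h = contractive_homD(1)[OF \<Phi>] and \<Psi>h = contractive_homD(1)[OF \<Psi>]
  note hom = star_homD[OF \<Phi>h] star_homD[OF \<Psi>h]
  \<comment> \<open>Both composites fix the generators, since merging and splitting of families are inverse to each other.\<close>
  have \<Psi>\<Phi>: "\<Psi> (\<Phi> x) = x" if x: "x \<in> carrier X" for x
  proof (rule cuntz_krieger_hom_unique[OF XA finite_arcs_graph_of])
    show "contractive_hom (cuntz_krieger A) X (\<lambda>x. \<Psi> (\<Phi> x))" "contractive_hom (cuntz_krieger A) X (\<lambda>x. x)"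
      using contractive_hom_comp[OF \<Phi> \<Psi>] contractive_hom_id unfolding X_def by blast+
    show "x \<in> carrier (cuntz_krieger A)" using x by (simp add: X_def)
    fix e assume "e \<in> arcs (graph_of A)"
    then have e: "e \<in> arcs G" by (simp only: G_def)
    have "\<Psi> (\<Phi> (T e)) = \<Psi> (\<Oplus>\<^bsub>Y\<^esub>j\<in>{1..m (head G e)}. S (e, j))"
      using \<Phi>T[OF e] by (simp only: merge_family_def)
    also have "\<dots> = (\<Oplus>\<^bsub>X\<^esub>j\<in>{1..m (head G e)}. \<Psi> (S (e, j)))"
      using Y.copy[OF e] by (intro star_hom_finsum[OF \<Psi>h YA XA]) auto
    also have "\<dots> = merge_family X G m X.R e"
      unfolding merge_family_def using Y.copy[OF e] X.R_closed[OF e] \<Psi>S by (intro X.X.finsum_cong') auto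
    finally show "\<Psi> (\<Phi> (ck_gen A e)) = ck_gen A e" using X.merge_split[OF e] by (simp only: T_def)
  qed
  have \<Phi>R: "\<Phi> (X.R h) = S h" if h: "h \<in> arcs H" for h
  proof -
    obtain e j where h': "h = (e, j)" and e: "e \<in> arcs G" and j: "j \<in> {1..m (head G e)}"
      using h by (auto simp: arcs_H)
    note PG = X.class_arcs[OF e j]
    have "\<Phi> (X.R h) = \<Phi> (T e) \<otimes>\<^bsub>Y\<^esub> \<Phi> (\<Oplus>\<^bsub>X\<^esub>f\<in>P (head G e) j. T f \<otimes>\<^bsub>X\<^esub> adj X (T f))"
      using e PG X.X.range_sum_closed[OF PG] by (simp add: split_family_def h' hom X.X.range_sum_def)
    also have "\<Phi> (\<Oplus>\<^bsub>X\<^esub>f\<in>P (head G e) j. T f \<otimes>\<^bsub>X\<^esub> adj X (T f))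
        = (\<Oplus>\<^bsub>Y\<^esub>f\<in>P (head G e) j. \<Phi> (T f \<otimes>\<^bsub>X\<^esub> adj X (T f)))"
      using PG finite_subset[OF PG fin(1)] by (intro star_hom_finsum[OF \<Phi>h XA YA]) auto
    also have "\<dots> = (\<Oplus>\<^bsub>Y\<^esub>f\<in>P (head G e) j. Y.M f \<otimes>\<^bsub>Y\<^esub> adj Y (Y.M f))"
      using PG \<Phi>T by (intro Y.Y.finsum_cong') (auto simp: hom subset_iff)
    also have "\<Phi> (T e) \<otimes>\<^bsub>Y\<^esub> \<dots> = split_family Y G P Y.M h"
      using \<Phi>T[OF e] by (simp add: split_family_def h')
    finally show ?thesis using Y.split_merge[OF h] by simp
  qed
  have \<Phi>\<Psi>: "\<Phi> (\<Psi> y) = y" if y: "y \<in> carrier Y" for y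
  proof (rule cuntz_krieger_hom_unique[OF YA finite_arcs_graph_of])
    show "contractive_hom (cuntz_krieger B) Y (\<lambda>y. \<Phi> (\<Psi> y))" "contractive_hom (cuntz_krieger B) Y (\<lambda>y. y)"
      using contractive_hom_comp[OF \<Psi> \<Phi>] contractive_hom_id unfolding Y_def by blast+
    show "y \<in> carrier (cuntz_krieger B)" using y by (simp add: Y_def)
    fix k assume "k \<in> arcs (graph_of B)"
    then have k: "k \<in> arcs K" by (simp only: K_def)
    have h: "\<theta>' k \<in> arcs H" using bij_betwE[OF \<theta>'(1)] k by blast
    have "S' k = S (\<theta>' k)" using \<theta>'(3)[OF k] by (simp add: S_def)
    then have "\<Phi> (\<Psi> (S' k)) = S' k" using \<Psi>S[OF h] \<Phi>R[OF h] by simp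
    then show "\<Phi> (\<Psi> (ck_gen B k)) = ck_gen B k" by (simp only: S'_def)
  qed
  \<comment> \<open>Mutually inverse contractions are isometric.\<close>
  have iso: "cstar_iso X Y \<Phi>"
    unfolding cstar_iso_def
  proof (intro conjI ballI)
    show "bij_betw \<Phi> (carrier X) (carrier Y)"
      by (rule bij_betw_byWitness[where f' = \<Psi>]) (use \<Psi>\<Phi> \<Phi>\<Psi> hom(1,7) in auto)
    show "nrm Y (\<Phi> x) = nrm X x" if x: "x \<in> carrier X" for x
      using contractive_homD(2)[OF \<Phi> x] contractive_homD(2)[OF \<Psi> hom(1)[OF x]] by (simp add: \<Psi>\<Phi>[OF x])
  qed (rule \<Phi>h)
  have dX: "ck_diagonal A = X.X.D" by (simp only: ck_diagonal_eq X_def G_def T_def)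
  have dY: "ck_diagonal B = Y.Y.D"
    unfolding ck_diagonal_eq S_def diagonal_relabel[OF \<theta>] by (simp only: Y_def K_def S'_def)
  have \<Phi>D: "\<Phi> ` X.X.D \<subseteq> Y.Y.D"
    using diagonal_image_subset[where G = G and S = T, OF XA YA \<Phi> X.X.S_closed \<Phi>T] Y.diagonal_merge_subset
    by (rule subset_trans)
  have \<Psi>D: "\<Psi> ` Y.Y.D \<subseteq> X.X.D"
    using diagonal_image_subset[where G = H and S = S, OF YA XA \<Psi> Y.Y.S_closed \<Psi>S] X.diagonal_split_subset
    by (rule subset_trans)
  have "y \<in> \<Phi> ` X.X.D" if y: "y \<in> Y.Y.D" for y
    using \<Psi>D y \<Phi>\<Psi>[OF Y.Y.diagonalD(1)[OF y]] by (intro image_eqI[of y \<Phi> "\<Psi> y"]) auto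
  with \<Phi>D have "\<Phi> ` X.X.D = Y.Y.D" by blast
  then have diag: "\<Phi> ` ck_diagonal A = ck_diagonal B" by (simp only: dX dY)
  \<comment> \<open>The image of a generator is a sum of generators, so both sides scale it by the same factor.\<close>
  have gauge: "\<Phi> (gauge_action A t x) = gauge_action B t (\<Phi> x)" if x: "x \<in> carrier X" for t x
  proof (rule cuntz_krieger_hom_unique[where A = A and x = x and f = "\<lambda>x. \<Phi> (gauge_action A t x)"
        and g = "\<lambda>x. gauge_action B t (\<Phi> x)", OF YA finite_arcs_graph_of])
    note rA = cstar_iso_contractive[OF gauge_action(2)[of A t, folded X_def]]
    note rB = cstar_iso_contractive[OF gauge_action(2)[of B t, folded Y_def]]
    show "contractive_hom (cuntz_krieger A) Y (\<lambda>x. \<Phi> (gauge_action A t x))"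
      "contractive_hom (cuntz_krieger A) Y (\<lambda>x. gauge_action B t (\<Phi> x))"
      using contractive_hom_comp[OF rA \<Phi>] contractive_hom_comp[OF \<Phi> rB] unfolding X_def by blast+
    show "x \<in> carrier (cuntz_krieger A)" using x by (simp add: X_def)
    fix e assume e': "e \<in> arcs (graph_of A)"
    then have e: "e \<in> arcs G" by (simp only: G_def)
    let ?c = "exp (2 * pi * \<i> * t)"
    have S: "gauge_action B t (S h) = scal Y ?c (S h)" if "h \<in> arcs H" for h
      using gauge_action(3)[of "\<theta> h" B t] bij_betwE[OF \<theta>] that by (simp only: S_def S'_def K_def Y_def)
    have "gauge_action B t (\<Phi> (T e)) = gauge_action B t (\<Oplus>\<^bsub>Y\<^esub>j\<in>{1..m (head G e)}. S (e, j))"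
      using \<Phi>T[OF e] by (simp only: merge_family_def)
    also have "\<dots> = (\<Oplus>\<^bsub>Y\<^esub>j\<in>{1..m (head G e)}. gauge_action B t (S (e, j)))"
      using Y.copy[OF e] by (intro star_hom_finsum[OF contractive_homD(1)[OF rB] YA YA]) auto
    also have "\<dots> = (\<Oplus>\<^bsub>Y\<^esub>j\<in>{1..m (head G e)}. scal Y ?c (S (e, j)))"
      using Y.copy[OF e] S by (intro Y.Y.finsum_cong') auto
    also have "\<dots> = scal Y ?c (\<Phi> (T e))"
      unfolding \<Phi>T[OF e] merge_family_def using Y.copy[OF e] by (intro Y.Y.scal_finsum[symmetric]) auto
    also have "\<dots> = \<Phi> (gauge_action A t (T e))"
      using gauge_action(3)[OF e', of t] hom(5)[OF X.X.S_closed[OF e]] by (simp only: T_def X_def)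
    finally show "\<Phi> (gauge_action A t (ck_gen A e)) = gauge_action B t (\<Phi> (ck_gen A e))"
      by (simp only: T_def)
  qed
  show ?thesis using iso diag gauge unfolding X_def Y_def by blast
qed

end
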